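(* Let $A=(a_{ij})$ be a $d\times n$ integer matrix of rank $d$ with $n-d=2$, whose columns $a_1,\dots,a_n$ lie in $\{1\}\times\mathbb{Z}^{d-1}$ and span the lattice $\mathbb{Z}^d$. Let $B=(b_{ji})$ be an $n\times 2$ integer matrix whose columns $B_1,B_2$ form a $\mathbb{Z}$-basis of $\ker_{\mathbb{Z}}(A)=\{u\in\mathbb{Z}^n: Au=0\}$, and assume: $b_{11},b_{12}>0$; $b_{21}<0<b_{22}$; $b_{31},b_{32}<0$; $b_{41}>0>b_{42}$; and, if the second and fourth rows of $B$ are linearly independent, the cone $\{z\in\mathbb{R}^2:(Bz)_2\ge 0,\ (Bz)_4\ge 0\}$ is contained in the first quadrant of $\mathbb{R}^2$. Choose non-rational numbers $\alpha_5,\dots,\alpha_n\in\mathbb{C}$ such that $\alpha_i\notin\mathbb{Q}(\alpha_5,\dots,\alpha_{i-1},\alpha_{i+1},\dots,\alpha_n)$ for $5\le i\le n$, and put \[ v=B_{1+}+B_{2+}-e_1-e_2-e_4+\sum_{i=5}^n\alpha_i e_i,\qquad \beta=A\cdot(v-e_3). \] Then $\operatorname{rank}(H_A(\beta))\ge \operatorname{vol}(A)+1$.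
   Context: $D$ denotes the Weyl algebra over $\mathbb{C}$ generated by $x_1,\dots,x_n,\partial_1,\dots,\partial_n$ (with $\partial_i x_j=x_j\partial_i+\delta_{ij}$, all other pairs commuting). For $\beta\in\mathbb{C}^d$, the $A$-hypergeometric system $H_A(\beta)$ is the left ideal of $D$ generated by the toric operators $\partial^u-\partial^{u'}$ for $u,u'\in\mathbb{N}^n$ with $Au=Au'$, and the homogeneities $\sum_{j=1}^n a_{ij}x_j\partial_j-\beta_i$, $i=1,\dots,d$. It is regular holonomic, and $\operatorname{rank}(H_A(\beta))$ denotes its holonomic rank, i.e. the dimension of the space of holomorphic solutions near a generic nonsingular point. $\operatorname{vol}(A)$ is the normalized volume of the $(d-1)$-dimensional polytope $\operatorname{conv}(a_1,\dots,a_n)$ (normalized with respect to the lattice so that a unimodular simplex has volume 1). $e_i$ is the $i$-th standard basis vector of $\mathbb{C}^n$. For $u\in\mathbb{Z}^n$, $u_+$ is the vector with $(u_+)_l=u_l$ if $u_l\ge0$ and $0$ otherwise. *)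

theory Defs
  imports "HOL-Analysis.Analysis" "HOL-Library.Poly_Mapping" "HOL-Computational_Algebra.Polynomial"
begin

text \<open>
  Multi-indices over the variables are vectors of type \<open>nat^'n\<close>.  An element of the Weyl algebra
  over the complex numbers is stored by its normally ordered expansion: the pair \<open>(a, b)\<close> stands
  for the basis element \<open>x^a \<partial>^b\<close>.
\<close>

datatype ('n::finite) weyl = Weyl (weyl_coeffs: "((nat^'n) \<times> (nat^'n)) \<Rightarrow>\<^sub>0 complex")

text \<open>
  The product of two basis elements, normally ordered by the Leibniz rule:
  \<open>x^a \<partial>^b \<cdot> x^c \<partial>^d = \<Sum>k. (\<Prod>i. C(b_i, k_i) C(c_i, k_i) k_i!) x^(a+c-k) \<partial>^(b+d-k)\<close>,
  summed over the multi-indices \<open>k \<le> b, c\<close>.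
\<close>

definition weyl_mult_basis ::
  "(nat^'n) \<times> (nat^'n) \<Rightarrow> (nat^'n) \<times> (nat^'n) \<Rightarrow> ((nat^'n) \<times> (nat^'n)) \<Rightarrow>\<^sub>0 complex" where
  "weyl_mult_basis = (\<lambda>(a, b) (c, d). \<Sum>k \<in> {k. k \<le> b \<and> k \<le> c}.
     Poly_Mapping.single (a + c - k, b + d - k)
       (of_nat (\<Prod>i\<in>UNIV. (b $ i choose k $ i) * (c $ i choose k $ i) * fact (k $ i))))"

instantiation weyl :: (finite) "{zero, one, plus, minus, uminus, times}"
begin

definition "0 = Weyl 0"

definition "1 = Weyl (Poly_Mapping.single (0, 0) 1)"

definition "P + Q = Weyl (weyl_coeffs P + weyl_coeffs Q)"

definition "P - Q = Weyl (weyl_coeffs P - weyl_coeffs Q)"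

definition "- P = Weyl (- weyl_coeffs P)"

definition "P * Q = Weyl (\<Sum>k \<in> Poly_Mapping.keys (weyl_coeffs P). \<Sum>l \<in> Poly_Mapping.keys (weyl_coeffs Q).
     Poly_Mapping.map ((*) (Poly_Mapping.lookup (weyl_coeffs P) k * Poly_Mapping.lookup (weyl_coeffs Q) l))
       (weyl_mult_basis k l))"

instance ..

end

text \<open>
  Associativity of the product is obtained from the faithful action on polynomials,
  \<open>x^a \<partial>^b x^g = (\<Prod>i. b_i! C(g_i, b_i)) x^(g-b+a)\<close>.
\<close>

definition pm_lin :: "('k \<Rightarrow> ('l::comm_monoid_add \<Rightarrow>\<^sub>0 complex)) \<Rightarrow> ('k \<Rightarrow>\<^sub>0 complex) \<Rightarrow> ('l \<Rightarrow>\<^sub>0 complex)" where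
  "pm_lin f P = (\<Sum>k \<in> Poly_Mapping.keys P. Poly_Mapping.single 0 (Poly_Mapping.lookup P k) * f k)"

lemma pm_lin_0 [simp]: "pm_lin f 0 = 0"
  by (simp add: pm_lin_def)

lemma pm_lin_add: "pm_lin f (P + Q) = pm_lin f P + pm_lin f Q"
  unfolding pm_lin_def
  by (rule setsum_keys_plus_distrib) (simp_all add: single_add distrib_right)

lemma pm_lin_single: "pm_lin f (Poly_Mapping.single k c) = Poly_Mapping.single 0 c * f k"
  by (cases "c = 0") (simp_all add: pm_lin_def)

lemma pm_lin_sum: "pm_lin f (sum g S) = (\<Sum>s\<in>S. pm_lin f (g s))"
  by (induction S rule: infinite_finite_induct) (simp_all add: pm_lin_add)

lemma pm_decompose: "P = (\<Sum>k \<in> Poly_Mapping.keys P. Poly_Mapping.single k (Poly_Mapping.lookup P k))"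
  by (rule poly_mapping_eqI)
    (simp add: lookup_sum lookup_single when_def in_keys_iff)

lemma pm_induct [case_names add single]:
  fixes P :: "'k \<Rightarrow>\<^sub>0 'a::comm_monoid_add"
  assumes "\<And>P Q. R P \<Longrightarrow> R Q \<Longrightarrow> R (P + Q)" "\<And>k c. R (Poly_Mapping.single k c)"
  shows "R P"
proof -
  have R0: "R 0" using assms(2)[of undefined 0] by simp
  have "R (\<Sum>k \<in> S. Poly_Mapping.single k (Poly_Mapping.lookup P k))" for S
    by (induction S rule: infinite_finite_induct) (auto simp: R0 intro: assms)
  then show ?thesis by (subst pm_decompose)
qed

lemma pm_lin_scale:
  fixes P :: "'k::comm_monoid_add \<Rightarrow>\<^sub>0 complex"
  shows "pm_lin f (Poly_Mapping.single 0 c * P) = Poly_Mapping.single 0 c * pm_lin f P"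
  by (induction P rule: pm_induct)
    (simp_all add: distrib_left pm_lin_add mult_single pm_lin_single mult.assoc [symmetric])

lemma pm_lin_add_fun: "pm_lin (\<lambda>k. f k + g k) P = pm_lin f P + pm_lin g P"
  by (simp add: pm_lin_def distrib_left sum.distrib)

lemma pm_lin_scale_fun: "pm_lin (\<lambda>k. Poly_Mapping.single 0 c * g k) P = Poly_Mapping.single 0 c * pm_lin g P"
  by (simp add: pm_lin_def sum_distrib_left mult.left_commute)

lemma weyl_coeffs_mult:
  fixes P Q :: "'n::finite weyl"
  shows "weyl_coeffs (P * Q) = pm_lin (\<lambda>k. pm_lin (weyl_mult_basis k) (weyl_coeffs Q)) (weyl_coeffs P)"
proof -
  have "Poly_Mapping.single 0 (a * b) * W = Poly_Mapping.single 0 a * (Poly_Mapping.single 0 b * W)"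
    for a b :: complex and W :: "((nat^'n) \<times> (nat^'n)) \<Rightarrow>\<^sub>0 complex"
    by (simp add: mult.assoc [symmetric] mult_single)
  then show ?thesis
    by (simp add: times_weyl_def pm_lin_def mult_map_scale_conv_mult sum_distrib_left)
qed

definition weyl_op_basis :: "(nat^'n) \<times> (nat^'n) \<Rightarrow> nat^'n \<Rightarrow> (nat^'n \<Rightarrow>\<^sub>0 complex)" where
  "weyl_op_basis = (\<lambda>(a, b) g. Poly_Mapping.single (g - b + a)
     (of_nat (\<Prod>i\<in>UNIV. fact (b $ i) * (g $ i choose b $ i))))"

definition weyl_op :: "(((nat^'n) \<times> (nat^'n)) \<Rightarrow>\<^sub>0 complex) \<Rightarrow> (nat^'n \<Rightarrow>\<^sub>0 complex) \<Rightarrow> (nat^'n \<Rightarrow>\<^sub>0 complex)" where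
  "weyl_op P p = pm_lin (\<lambda>k. pm_lin (weyl_op_basis k) p) P"

lemma weyl_leibniz_coeff:
  fixes b c d g :: nat
  shows "(\<Sum>k \<in> {..min b c}. (b choose k) * (c choose k) * fact k * (fact (b + d - k) * (g choose (b + d - k))))
     = fact d * (g choose d) * (fact b * ((g - d + c) choose b))"
proof (cases "d \<le> g")
  case False
  then show ?thesis
    by (auto simp: binomial_eq_0)
next
  case True
  have term_eq: "(b choose k) * (c choose k) * fact k * (fact (b + d - k) * (g choose (b + d - k)))
      = fact d * (g choose d) * fact b * ((c choose k) * ((g - d) choose (b - k)))"
    if k: "k \<le> b" for k
  proof -
    have 1: "fact k * fact (b - k) * (b choose k) = (fact b :: nat)"
      using k by (rule binomial_fact_lemma)
    have 2: "fact (b + d - k) * (g choose (b + d - k)) = fact d * (g choose d) * (fact (b - k) * ((g - d) choose (b - k)))"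
    proof (cases "b + d - k \<le> g")
      case True
      have e: "g - d - (b - k) = g - (b + d - k)" using k True by simp
      have "fact (b + d - k) * (g choose (b + d - k)) * fact (g - (b + d - k)) = (fact g :: nat)"
        using binomial_fact_lemma[OF True] by (simp add: ac_simps)
      moreover have "fact d * (g choose d) * fact (g - d) = (fact g :: nat)"
        using binomial_fact_lemma[OF \<open>d \<le> g\<close>] by (simp add: ac_simps)
      moreover have "fact (b - k) * ((g - d) choose (b - k)) * fact (g - (b + d - k)) = (fact (g - d) :: nat)"
        using binomial_fact_lemma[of "b - k" "g - d"] True k by (simp add: ac_simps e)
      ultimately have "fact (b + d - k) * (g choose (b + d - k)) * fact (g - (b + d - k))
         = fact d * (g choose d) * (fact (b - k) * ((g - d) choose (b - k))) * fact (g - (b + d - k))"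
        by (metis mult.assoc)
      then show ?thesis by simp
    next
      case False
      then show ?thesis using k True by (simp add: binomial_eq_0)
    qed
    show ?thesis unfolding 2 1[symmetric] by (simp add: ac_simps)
  qed
  have "(\<Sum>k \<in> {..min b c}. (b choose k) * (c choose k) * fact k * (fact (b + d - k) * (g choose (b + d - k))))
     = (\<Sum>k \<in> {..b}. (b choose k) * (c choose k) * fact k * (fact (b + d - k) * (g choose (b + d - k))))"
    by (intro sum.mono_neutral_left) (auto simp: binomial_eq_0)
  also have "\<dots> = (\<Sum>k \<le> b. fact d * (g choose d) * fact b * ((c choose k) * ((g - d) choose (b - k))))"
    by (intro sum.cong refl term_eq) simp
  also have "\<dots> = fact d * (g choose d) * fact b * ((c + (g - d)) choose b)"
    by (simp add: sum_distrib_left [symmetric] vandermonde)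
  finally show ?thesis by (simp add: ac_simps)
qed

lemma finite_multi_index_le: "finite {k :: nat^'n. k \<le> b \<and> k \<le> c}"
proof -
  have "{k. k \<le> b \<and> k \<le> c} \<subseteq> vec_lambda ` (Pi\<^sub>E UNIV (\<lambda>i. {..b $ i}))"
  proof
    fix k :: "nat^'n" assume "k \<in> {k. k \<le> b \<and> k \<le> c}"
    then have "vec_nth k \<in> Pi\<^sub>E UNIV (\<lambda>i. {..b $ i})" by (auto simp: less_eq_vec_def)
    then show "k \<in> vec_lambda ` (Pi\<^sub>E UNIV (\<lambda>i. {..b $ i}))"
      by (metis image_eqI vec_nth_inverse)
  qed
  then show ?thesis by (rule finite_subset) (intro finite_imageI finite_PiE, auto)
qed

lemma sum_prod_multi_index:
  fixes b c :: "nat^'n" and f :: "'n \<Rightarrow> nat \<Rightarrow> nat"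
  shows "(\<Sum>k \<in> {k. k \<le> b \<and> k \<le> c}. \<Prod>i\<in>UNIV. f i (k $ i)) = (\<Prod>i\<in>UNIV. \<Sum>j \<in> {..min (b $ i) (c $ i)}. f i j)"
proof -
  have "(\<Prod>i\<in>UNIV. \<Sum>j \<in> {..min (b $ i) (c $ i)}. f i j)
      = (\<Sum>g \<in> Pi\<^sub>E UNIV (\<lambda>i. {..min (b $ i) (c $ i)}). \<Prod>i\<in>UNIV. f i (g i))"
    by (rule prod_sum_PiE) auto
  also have "\<dots> = (\<Sum>k \<in> {k. k \<le> b \<and> k \<le> c}. \<Prod>i\<in>UNIV. f i (k $ i))"
    by (rule sum.reindex_bij_witness [where i = vec_nth and j = vec_lambda])
      (auto simp: less_eq_vec_def PiE_iff)
  finally show ?thesis by simp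
qed

lemma weyl_op_mult_basis:
  "weyl_op (weyl_mult_basis k l) (Poly_Mapping.single g 1)
     = weyl_op (Poly_Mapping.single k 1) (weyl_op (Poly_Mapping.single l 1) (Poly_Mapping.single g 1))"
proof -
  obtain a b c d where kl: "k = (a, b)" "l = (c, d)" by (metis surj_pair)
  let ?h = "g - d + c - b + a"
  let ?w = "\<lambda>k i. (b $ i choose k $ i) * (c $ i choose k $ i) * fact (k $ i)"
  have t: "Poly_Mapping.single 0 (of_nat (\<Prod>i\<in>UNIV. ?w k i)) * weyl_op_basis (a + c - k, b + d - k) g
     = Poly_Mapping.single ?h (of_nat (\<Prod>i\<in>UNIV. ?w k i * (fact (b $ i + d $ i - k $ i) * (g $ i choose (b $ i + d $ i - k $ i)))))"
    if k: "k \<le> b" "k \<le> c" for k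
  proof (cases "\<forall>i. b $ i + d $ i - k $ i \<le> g $ i")
    case True
    have "g $ i - (b $ i + d $ i - k $ i) + (a $ i + c $ i - k $ i) = g $ i - d $ i + c $ i - b $ i + a $ i" for i
    proof -
      have "k $ i \<le> b $ i" "k $ i \<le> c $ i" "b $ i + d $ i - k $ i \<le> g $ i"
        using k True by (auto simp: less_eq_vec_def)
      then show ?thesis by linarith
    qed
    then have "g - (b + d - k) + (a + c - k) = ?h"
      by (simp add: vec_eq_iff)
    then show ?thesis
      by (simp add: weyl_op_basis_def mult_single prod.distrib)
  next
    case False
    then obtain i where i: "g $ i < b $ i + d $ i - k $ i" by (auto simp: not_le)
    have z1: "(\<Prod>i\<in>UNIV. fact ((b + d - k) $ i) * (g $ i choose (b + d - k) $ i)) = 0"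
      using i by (intro prod_zero) (auto intro!: bexI[of _ i] simp: binomial_eq_0)
    have z2: "(\<Prod>i\<in>UNIV. ?w k i * (fact (b $ i + d $ i - k $ i) * (g $ i choose (b $ i + d $ i - k $ i)))) = 0"
      using i by (intro prod_zero) (auto intro!: bexI[of _ i] simp: binomial_eq_0)
    show ?thesis unfolding z2 by (simp only: weyl_op_basis_def prod.case z1) simp
  qed
  have "weyl_op (weyl_mult_basis k l) (Poly_Mapping.single g 1)
      = (\<Sum>k \<in> {k. k \<le> b \<and> k \<le> c}. Poly_Mapping.single 0 (of_nat (\<Prod>i\<in>UNIV. ?w k i)) * weyl_op_basis (a + c - k, b + d - k) g)"
    by (simp add: weyl_op_def weyl_mult_basis_def kl pm_lin_sum pm_lin_single)
  also have "\<dots> = (\<Sum>k \<in> {k. k \<le> b \<and> k \<le> c}. Poly_Mapping.single ?h (of_nat (\<Prod>i\<in>UNIV. ?w k i * (fact (b $ i + d $ i - k $ i) * (g $ i choose (b $ i + d $ i - k $ i))))))"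
    by (intro sum.cong refl t) auto
  also have "\<dots> = Poly_Mapping.single ?h (of_nat (\<Sum>k \<in> {k. k \<le> b \<and> k \<le> c}. \<Prod>i\<in>UNIV. ?w k i * (fact (b $ i + d $ i - k $ i) * (g $ i choose (b $ i + d $ i - k $ i)))))"
    using finite_multi_index_le[of b c]
    by (induction rule: finite_induct) (simp_all add: single_add)
  also have "(\<Sum>k \<in> {k. k \<le> b \<and> k \<le> c}. \<Prod>i\<in>UNIV. ?w k i * (fact (b $ i + d $ i - k $ i) * (g $ i choose (b $ i + d $ i - k $ i))))
     = (\<Prod>i\<in>UNIV. fact (d $ i) * (g $ i choose d $ i) * (fact (b $ i) * ((g $ i - d $ i + c $ i) choose b $ i)))"
    by (subst sum_prod_multi_index) (simp add: weyl_leibniz_coeff)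
  finally show ?thesis
    by (simp add: weyl_op_def kl pm_lin_single weyl_op_basis_def mult_single prod.distrib ac_simps)
qed

lemma weyl_op_add_left: "weyl_op (P + Q) p = weyl_op P p + weyl_op Q p"
  by (simp add: weyl_op_def pm_lin_add)

lemma weyl_op_add_right: "weyl_op P (p + q) = weyl_op P p + weyl_op P q"
  by (simp add: weyl_op_def pm_lin_add pm_lin_add_fun)

lemma weyl_op_scale_left: "weyl_op (Poly_Mapping.single 0 c * P) p = Poly_Mapping.single 0 c * weyl_op P p"
  by (simp add: weyl_op_def pm_lin_scale)

lemma weyl_op_scale_right: "weyl_op P (Poly_Mapping.single 0 c * p) = Poly_Mapping.single 0 c * weyl_op P p"
  by (simp add: weyl_op_def pm_lin_scale pm_lin_scale_fun)

lemma single_eq_scale: "Poly_Mapping.single k c = Poly_Mapping.single 0 c * Poly_Mapping.single (k::'k::comm_monoid_add) (1::complex)"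
  by (simp add: mult_single)

lemma weyl_op_mult: "weyl_op (weyl_coeffs (P * Q)) p = weyl_op (weyl_coeffs P) (weyl_op (weyl_coeffs Q) p)"
proof -
  have "weyl_op (pm_lin (\<lambda>k. pm_lin (weyl_mult_basis k) W) V) p = weyl_op V (weyl_op W p)" for V W
  proof (induction V rule: pm_induct)
    case (add V1 V2)
    then show ?case by (simp add: pm_lin_add weyl_op_add_left)
  next
    case (single k c)
    have "weyl_op (pm_lin (weyl_mult_basis k) W) p = weyl_op (Poly_Mapping.single k 1) (weyl_op W p)"
    proof (induction W rule: pm_induct)
      case (add W1 W2)
      then show ?case by (simp add: pm_lin_add weyl_op_add_left weyl_op_add_right)
    next
      case (single l e)
      have "weyl_op (weyl_mult_basis k l) p = weyl_op (Poly_Mapping.single k 1) (weyl_op (Poly_Mapping.single l 1) p)"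
      proof (induction p rule: pm_induct)
        case (add p1 p2)
        then show ?case by (simp add: weyl_op_add_right)
      next
        case (single g f)
        show ?case
          by (subst (1 2) single_eq_scale) (simp only: weyl_op_scale_right weyl_op_mult_basis)
      qed
      then show ?case
        by (simp only: pm_lin_single weyl_op_scale_left single_eq_scale[of l e] pm_lin_scale weyl_op_scale_right)
          simp
    qed
    then show ?case
      by (simp only: pm_lin_single weyl_op_scale_left single_eq_scale[of k c] pm_lin_scale) simp
  qed
  then show ?thesis by (simp add: weyl_coeffs_mult)
qed

lemma weyl_op_inject:
  assumes "\<And>p. weyl_op P p = weyl_op Q p"
  shows "P = Q"
proof -
  define R where "R = P - Q"
  have "P = Q + R" by (simp add: R_def)
  then have R0: "weyl_op R p = 0" for p
    using assms[of p] by (simp add: weyl_op_add_left)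
  have "R = 0"
  proof (rule ccontr)
    assume "R \<noteq> 0"
    then have ne: "snd ` Poly_Mapping.keys R \<noteq> {}" by simp
    define deg where "deg = (\<lambda>b :: nat^'a. \<Sum>i\<in>UNIV. b $ i)"
    obtain b where b: "b \<in> snd ` Poly_Mapping.keys R"
      and bmin: "\<And>b'. b' \<in> snd ` Poly_Mapping.keys R \<Longrightarrow> deg b \<le> deg b'"
      using arg_min_if_finite[OF _ ne, of deg] by (metis finite_imageI finite_keys not_le)
    then obtain a where ab: "(a, b) \<in> Poly_Mapping.keys R" by auto
    let ?c = "\<lambda>b'. of_nat (\<Prod>i\<in>UNIV. fact (b' $ i) * (b $ i choose b' $ i)) :: complex"
    have zero: "?c b' = 0" if "b' \<noteq> b" "(a', b') \<in> Poly_Mapping.keys R" for a' b'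
    proof -
      have "\<exists>i. b $ i < b' $ i"
      proof (rule ccontr)
        assume "\<nexists>i. b $ i < b' $ i"
        then have le: "\<And>i. b' $ i \<le> b $ i" by (auto simp: not_less)
        moreover obtain i where "b' $ i \<noteq> b $ i" using \<open>b' \<noteq> b\<close> by (auto simp: vec_eq_iff)
        ultimately have "deg b' < deg b"
          unfolding deg_def by (intro sum_strict_mono_ex1) (auto intro!: bexI[of _ i] simp: order.strict_iff_order)
        moreover have "deg b \<le> deg b'" using that(2) by (intro bmin) force
        ultimately show False by simp
      qed
      then obtain i where "b $ i < b' $ i" ..
      then have "(\<Prod>i\<in>UNIV. fact (b' $ i) * (b $ i choose b' $ i)) = 0"
        by (intro prod_zero) (auto intro!: bexI[of _ i] simp: binomial_eq_0)
      then show ?thesis by (metis of_nat_0)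
    qed
    have "0 = Poly_Mapping.lookup (weyl_op R (Poly_Mapping.single b 1)) a"
      by (simp add: R0)
    also have "\<dots> = (\<Sum>k \<in> Poly_Mapping.keys R. Poly_Mapping.lookup R k * (?c (snd k) when b - snd k + fst k = a))"
      by (simp add: weyl_op_def pm_lin_single pm_lin_def[of _ R] lookup_sum weyl_op_basis_def case_prod_beta mult_single
          lookup_single mult_when)
    also have "\<dots> = (\<Sum>k \<in> Poly_Mapping.keys R. if k = (a, b) then Poly_Mapping.lookup R k * ?c b else 0)"
    proof (intro sum.cong refl)
      fix k assume "k \<in> Poly_Mapping.keys R"
      then show "Poly_Mapping.lookup R k * (?c (snd k) when b - snd k + fst k = a)
         = (if k = (a, b) then Poly_Mapping.lookup R k * ?c b else 0)"
      proof (cases "snd k = b")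
        case True
        have "b - b + fst k = fst k" by (simp add: vec_eq_iff)
        with True show ?thesis by (cases k) auto
      next
        case False
        with zero[of "snd k" "fst k"] \<open>k \<in> Poly_Mapping.keys R\<close> have "?c (snd k) = 0" by simp
        then show ?thesis using False by auto
      qed
    qed
    also have "\<dots> = Poly_Mapping.lookup R (a, b) * ?c b"
      using ab by simp
    finally show False using ab by (simp add: in_keys_iff)
  qed
  then show ?thesis by (simp add: R_def)
qed

lemma weyl_op_one: "weyl_op (Poly_Mapping.single (0, 0) 1) p = p"
proof (induction p rule: pm_induct)
  case (add p1 p2)
  then show ?case by (simp add: weyl_op_add_right)
next
  case (single g c)
  have "g - 0 + 0 = g" by (simp add: vec_eq_iff)
  then show ?case
    by (simp add: weyl_op_def pm_lin_single weyl_op_basis_def mult_single)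
qed

instance weyl :: (finite) ring_1
proof
  fix P Q R :: "'a weyl"
  show "P + Q + R = P + (Q + R)" "P + Q = Q + P" "0 + P = P" "- P + P = 0" "P - Q = P + - Q"
    by (simp_all add: plus_weyl_def zero_weyl_def uminus_weyl_def minus_weyl_def ac_simps)
  have coeffs_eqI: "P = Q" if "\<And>p. weyl_op (weyl_coeffs P) p = weyl_op (weyl_coeffs Q) p" for P Q :: "'a weyl"
    using weyl_op_inject[of "weyl_coeffs P" "weyl_coeffs Q"] that by (simp add: weyl.expand)
  show "P * Q * R = P * (Q * R)"
    by (rule coeffs_eqI) (simp add: weyl_op_mult)
  show "1 * P = P" "P * 1 = P"
    by (rule coeffs_eqI, simp add: weyl_op_mult one_weyl_def weyl_op_one)+
  show "(P + Q) * R = P * R + Q * R" "P * (Q + R) = P * Q + P * R"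
    by (rule coeffs_eqI, simp add: weyl_op_mult plus_weyl_def weyl_op_add_left weyl_op_add_right)+
  show "(0::'a weyl) \<noteq> 1"
    by (simp add: zero_weyl_def one_weyl_def) (metis lookup_single_eq lookup_zero zero_neq_one)
qed

definition weyl_const :: "complex \<Rightarrow> 'n::finite weyl" where
  "weyl_const c = Weyl (Poly_Mapping.single (0, 0) c)"

definition weyl_x :: "'n::finite \<Rightarrow> 'n weyl" where
  "weyl_x j = Weyl (Poly_Mapping.single (axis j 1, 0) 1)"

definition weyl_d :: "'n::finite \<Rightarrow> 'n weyl" where
  "weyl_d j = Weyl (Poly_Mapping.single (0, axis j 1) 1)"

definition weyl_d_power :: "nat^'n \<Rightarrow> 'n weyl" where
  "weyl_d_power u = Weyl (Poly_Mapping.single (0, u) 1)"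

lemma weyl_mult_single:
  "Weyl (Poly_Mapping.single k c) * Weyl (Poly_Mapping.single l e)
     = Weyl (Poly_Mapping.single 0 (c * e) * weyl_mult_basis k l)"
proof -
  have "weyl_coeffs (Weyl (Poly_Mapping.single k c) * Weyl (Poly_Mapping.single l e))
      = Poly_Mapping.single 0 (c * e) * weyl_mult_basis k l"
    by (simp add: weyl_coeffs_mult pm_lin_single mult_single mult.assoc [symmetric])
  then show ?thesis by (metis weyl.collapse)
qed

lemma multi_index_le_0: "{k :: nat^'n. k \<le> b \<and> k \<le> 0} = {0}" "{k :: nat^'n. k \<le> 0 \<and> k \<le> b} = {0}"
  by (auto simp: less_eq_vec_def vec_eq_iff)

lemma weyl_mult_basis_comm: "weyl_mult_basis (a, 0) (c, d) = Poly_Mapping.single (a + c, d) 1"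
  "weyl_mult_basis (a, b) (0, d) = Poly_Mapping.single (a, b + d) 1"
proof -
  have [simp]: "x - 0 = x" for x :: "nat^'a" by (simp add: vec_eq_iff)
  show "weyl_mult_basis (a, 0) (c, d) = Poly_Mapping.single (a + c, d) 1"
    "weyl_mult_basis (a, b) (0, d) = Poly_Mapping.single (a, b + d) 1"
    by (simp_all add: weyl_mult_basis_def multi_index_le_0)
qed

lemma weyl_x_commute: "weyl_x i * weyl_x j = weyl_x j * weyl_x i"
  by (simp add: weyl_x_def weyl_mult_single weyl_mult_basis_comm add.commute)

lemma weyl_d_commute: "weyl_d i * weyl_d j = weyl_d j * weyl_d i"
  by (simp add: weyl_d_def weyl_mult_single weyl_mult_basis_comm add.commute)

lemma weyl_d_x: "weyl_d i * weyl_x j = weyl_x j * weyl_d i + (if i = j then 1 else 0)"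
proof -
  have [simp]: "x - 0 = x" for x :: "nat^'a" by (simp add: vec_eq_iff)
  have set: "{k. k \<le> axis i 1 \<and> k \<le> axis j (1::nat)} = (if i = j then {0, axis i 1} else {0})"
  proof (intro equalityI subsetI)
    fix k :: "nat^'a" assume "k \<in> {k. k \<le> axis i 1 \<and> k \<le> axis j 1}"
    then have le: "k $ l \<le> axis i 1 $ l" "k $ l \<le> axis j 1 $ l" for l
      by (auto simp: less_eq_vec_def)
    have k: "k = axis i (k $ i)"
    proof (rule vec_eq_iff [THEN iffD2], rule allI)
      fix l
      show "k $ l = axis i (k $ i) $ l" using le(1)[of l] by (simp add: axis_def split: if_splits)
    qed
    have "k $ i = 0 \<or> k $ i = 1" using le(1)[of i] by (auto simp: axis_def)
    moreover have "k $ i = 0" if "i \<noteq> j" using le(2)[of i] that by (auto simp: axis_def)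
    moreover have "axis i (0::nat) = 0" by (simp add: axis_def vec_eq_iff)
    ultimately show "k \<in> (if i = j then {0, axis i 1} else {0})" using k by auto
  qed (auto simp: less_eq_vec_def split: if_splits)
  have prod1: "(\<Prod>l\<in>UNIV. fact (axis i (Suc 0) $ l)) = (1::complex)"
    by (rule prod.neutral) (auto simp: axis_def)
  have ne: "(0 :: nat^'a) \<noteq> axis i 1" by (simp add: vec_eq_iff axis_def)
  have "weyl_mult_basis (0, axis i 1) (axis j 1, 0)
      = Poly_Mapping.single (axis j 1, axis i 1) 1 + (if i = j then Poly_Mapping.single (0, 0) 1 else 0)"
  proof (cases "i = j")
    case True
    have "weyl_mult_basis (0, axis i 1) (axis j 1, 0)
        = (\<Sum>k \<in> {0, axis i 1}. Poly_Mapping.single (0 + axis i 1 - k, axis i 1 + 0 - k)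
            (of_nat (\<Prod>l\<in>UNIV. (axis i 1 $ l choose k $ l) * (axis i 1 $ l choose k $ l) * fact (k $ l))))"
      using True set by (simp only: weyl_mult_basis_def prod.case if_True refl)
    also have "\<dots> = Poly_Mapping.single (axis i 1, axis i 1) 1 + Poly_Mapping.single (0, 0) 1"
      using ne by (simp add: prod1)
    finally show ?thesis using True by simp
  next
    case False
    have "weyl_mult_basis (0, axis i 1) (axis j 1, 0)
        = (\<Sum>k \<in> {0}. Poly_Mapping.single (0 + axis j 1 - k, axis i 1 + 0 - k)
            (of_nat (\<Prod>l\<in>UNIV. (axis i 1 $ l choose k $ l) * (axis j 1 $ l choose k $ l) * fact (k $ l))))"
      using False set by (simp only: weyl_mult_basis_def prod.case if_False)
    then show ?thesis using False by simp
  qed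
  then show ?thesis
    by (simp add: weyl_d_def weyl_x_def weyl_mult_single weyl_mult_basis_comm plus_weyl_def one_weyl_def zero_weyl_def)
qed

lemma weyl_d_power_0: "weyl_d_power 0 = 1"
  by (simp add: weyl_d_power_def one_weyl_def)

lemma weyl_d_power_axis: "weyl_d_power (axis j 1) = weyl_d j"
  by (simp add: weyl_d_power_def weyl_d_def)

lemma weyl_d_power_add: "weyl_d_power (u + w) = weyl_d_power u * weyl_d_power w"
  by (simp add: weyl_d_power_def weyl_mult_single weyl_mult_basis_comm)

definition left_ideal_generated :: "'n::finite weyl set \<Rightarrow> 'n weyl set" where
  "left_ideal_generated G =
     \<Inter> {I. G \<subseteq> I \<and> 0 \<in> I \<and> (\<forall>P\<in>I. \<forall>Q\<in>I. P + Q \<in> I) \<and> (\<forall>P. \<forall>Q\<in>I. P * Q \<in> I)}"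

definition hypergeometric_ideal :: "int^'n^'d \<Rightarrow> complex^'d \<Rightarrow> 'n weyl set" where
  "hypergeometric_ideal A \<beta> = left_ideal_generated
     ({weyl_d_power u - weyl_d_power u' | u u'.
         \<forall>i. (\<Sum>j\<in>UNIV. A $ i $ j * int (u $ j)) = (\<Sum>j\<in>UNIV. A $ i $ j * int (u' $ j))} \<union>
      {(\<Sum>j\<in>UNIV. weyl_const (of_int (A $ i $ j)) * (weyl_x j * weyl_d j)) - weyl_const (\<beta> $ i) | i. True})"

definition holomorphic_Cn :: "(complex^'n \<Rightarrow> complex) \<Rightarrow> (complex^'n) set \<Rightarrow> bool" where
  "holomorphic_Cn f U \<longleftrightarrow> open U \<and>
     (\<forall>x\<in>U. \<exists>f'. (f has_derivative f') (at x) \<and> (\<forall>c v. f' (c *s v) = c * f' v))"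

definition partial_deriv :: "'n \<Rightarrow> (complex^'n \<Rightarrow> complex) \<Rightarrow> complex^'n \<Rightarrow> complex" where
  "partial_deriv j f = (\<lambda>x. deriv (\<lambda>t. f (x + axis j t)) 0)"

text \<open>
  The partial derivatives are taken in some fixed order of the variables, which is immaterial for
  holomorphic functions.
\<close>

definition variables :: "'n::finite list" where
  "variables = (SOME js. distinct js \<and> set js = UNIV)"

definition partial_deriv_power ::
  "nat^'n \<Rightarrow> (complex^'n \<Rightarrow> complex) \<Rightarrow> complex^'n \<Rightarrow> complex" where
  "partial_deriv_power u f = foldr (\<lambda>j. partial_deriv j ^^ (u $ j)) variables f"

definition weyl_apply ::
  "'n weyl \<Rightarrow> (complex^'n \<Rightarrow> complex) \<Rightarrow> complex^'n \<Rightarrow> complex" where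
  "weyl_apply P f x = (\<Sum>(a, b) \<in> Poly_Mapping.keys (weyl_coeffs P).
     Poly_Mapping.lookup (weyl_coeffs P) (a, b) * (\<Prod>j\<in>UNIV. (x $ j) ^ (a $ j)) * partial_deriv_power b f x)"

definition solution_near ::
  "'n weyl set \<Rightarrow> complex^'n \<Rightarrow> (complex^'n \<Rightarrow> complex) \<Rightarrow> bool" where
  "solution_near I p f \<longleftrightarrow>
     (\<exists>U. p \<in> U \<and> holomorphic_Cn f U \<and> (\<forall>P\<in>I. \<forall>x\<in>U. weyl_apply P f x = 0))"

text \<open>
  The dimension of the space of germs at \<open>p\<close> of holomorphic solutions: the supremum of the sizes
  of its finite linearly independent families.  A linear combination is zero as a germ if it
  vanishes near \<open>p\<close>.
\<close>

definition solution_dim :: "'n weyl set \<Rightarrow> complex^'n \<Rightarrow> enat" where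
  "solution_dim I p = Sup {enat m | m. \<exists>f :: nat \<Rightarrow> complex^'n \<Rightarrow> complex.
     (\<forall>k<m. solution_near I p (f k)) \<and>
     (\<forall>c :: nat \<Rightarrow> complex. (\<forall>\<^sub>F x in nhds p. (\<Sum>k<m. c k * f k x) = 0) \<longrightarrow> (\<forall>k<m. c k = 0))}"

inductive polynomial_Cn :: "(complex^'n \<Rightarrow> complex) \<Rightarrow> bool" where
  const: "polynomial_Cn (\<lambda>x. c)"
| var: "polynomial_Cn (\<lambda>x. x $ j)"
| add: "polynomial_Cn q \<Longrightarrow> polynomial_Cn r \<Longrightarrow> polynomial_Cn (\<lambda>x. q x + r x)"
| mult: "polynomial_Cn q \<Longrightarrow> polynomial_Cn r \<Longrightarrow> polynomial_Cn (\<lambda>x. q x * r x)"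

definition generically :: "(complex^'n \<Rightarrow> bool) \<Rightarrow> bool" where
  "generically R \<longleftrightarrow> (\<exists>q. polynomial_Cn q \<and> (\<exists>x. q x \<noteq> 0) \<and> (\<forall>x. q x \<noteq> 0 \<longrightarrow> R x))"

text \<open>
  The holonomic rank is the dimension of the solution space at a generic point.  It is written as
  the largest generic lower bound for that dimension, so that the definition makes sense without
  knowing beforehand that the dimension is generically constant;
  \<open>holonomic_rank_eqI\<close> below shows that it is the generic value whenever there is one.
\<close>

definition holonomic_rank :: "'n::finite weyl set \<Rightarrow> enat" where
  "holonomic_rank I = Sup {r. generically (\<lambda>p. r \<le> solution_dim I p)}"

lemma polynomial_Cn_line:
  assumes "polynomial_Cn q"
  shows "\<exists>P. \<forall>t. q (x + t *s y) = poly P t"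
  using assms
proof induction
  case (const c)
  have "\<forall>t. c = poly [:c:] t" by simp
  then show ?case by blast
next
  case (var j)
  have "\<forall>t. (x + t *s y) $ j = poly [:x $ j, y $ j:] t" by simp
  then show ?case by blast
next
  case (add q r)
  then obtain P Q where "\<forall>t. q (x + t *s y) = poly P t" "\<forall>t. r (x + t *s y) = poly Q t" by blast
  then have "\<forall>t. q (x + t *s y) + r (x + t *s y) = poly (P + Q) t" by simp
  then show ?case by blast
next
  case (mult q r)
  then obtain P Q where "\<forall>t. q (x + t *s y) = poly P t" "\<forall>t. r (x + t *s y) = poly Q t" by blast
  then have "\<forall>t. q (x + t *s y) * r (x + t *s y) = poly (P * Q) t" by simp
  then show ?case by blast
qed

lemma generically_conj:
  assumes "generically R" "generically S"
  shows "\<exists>x. R x \<and> S x"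
proof -
  obtain q x where q: "polynomial_Cn q" "q x \<noteq> 0" "\<And>x. q x \<noteq> 0 \<Longrightarrow> R x"
    using assms(1) by (auto simp: generically_def)
  obtain r y where r: "polynomial_Cn r" "r y \<noteq> 0" "\<And>x. r x \<noteq> 0 \<Longrightarrow> S x"
    using assms(2) by (auto simp: generically_def)
  obtain P where P: "\<And>t. q (x + t *s (y - x)) = poly P t" using polynomial_Cn_line[OF q(1)] by blast
  obtain Q where Q: "\<And>t. r (x + t *s (y - x)) = poly Q t" using polynomial_Cn_line[OF r(1)] by blast
  have "poly P 0 \<noteq> 0" "poly Q 1 \<noteq> 0"
    using q(2) r(2) by (simp_all add: P [symmetric] Q [symmetric])
  then have "P * Q \<noteq> 0" by auto
  then have "finite {t. poly (P * Q) t = 0}" by (rule poly_roots_finite)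
  then obtain t where "poly (P * Q) t \<noteq> 0"
    using infinite_UNIV_char_0[where 'a = complex] by (metis (mono_tags, lifting) UNIV_I finite_subset mem_Collect_eq subsetI)
  then have "q (x + t *s (y - x)) \<noteq> 0" "r (x + t *s (y - x)) \<noteq> 0" unfolding P Q by auto
  then show ?thesis using q(3) r(3) by blast
qed

lemma holonomic_rank_eqI:
  assumes "generically (\<lambda>p. solution_dim I p = r)"
  shows "holonomic_rank I = r"
proof (unfold holonomic_rank_def, rule antisym)
  show "Sup {r. generically (\<lambda>p. r \<le> solution_dim I p)} \<le> r"
    using generically_conj[OF assms] by (intro Sup_least) fastforce
  have "generically (\<lambda>p. r \<le> solution_dim I p)"
    using assms unfolding generically_def by blast
  then show "r \<le> Sup {r. generically (\<lambda>p. r \<le> solution_dim I p)}"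
    by (simp add: Sup_upper)
qed

text \<open>
  For a matrix whose columns have \<open>r\<close>-th entry 1, the polytope spanned by the columns is identified
  with a polytope in the \<open>(d-1)\<close>-dimensional space of the remaining coordinates.  When the columns
  span the full integer lattice, a unimodular simplex has Lebesgue measure \<open>1 / (d-1)!\<close> there.
\<close>

definition normalized_volume :: "'d \<Rightarrow> int^'n^'d \<Rightarrow> real" where
  "normalized_volume r A = fact (CARD('d) - 1) *
     measure (\<Pi>\<^sub>M i\<in>UNIV - {r}. (lborel :: real measure))
       ((\<lambda>p. restrict (vec_nth p) (UNIV - {r})) ` (convex hull (range (\<lambda>j. column j (map_matrix real_of_int A)))))"

definition Z_basis_columns :: "int^'k^'n \<Rightarrow> (int^'n) set \<Rightarrow> bool" where
  "Z_basis_columns B L \<longleftrightarrow> range (\<lambda>c. B *v c) = L \<and> inj (\<lambda>c. B *v c)"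

definition pos_part :: "int^'n \<Rightarrow> int^'n" where
  "pos_part u = (\<chi> j. if u $ j \<ge> 0 then u $ j else 0)"

definition rat_adjoin :: "complex set \<Rightarrow> complex set" where
  "rat_adjoin S = \<Inter> {K. S \<subseteq> K \<and> 1 \<in> K \<and> (\<forall>x\<in>K. \<forall>y\<in>K. x - y \<in> K \<and> x * y \<in> K) \<and> (\<forall>x\<in>K. inverse x \<in> K)}"

end

theory Submission
  imports Defs
begin

text \<open>
  Write \<open>a\<^sub>k\<close> for the columns of \<open>A\<close>, \<open>S\<close> for the semigroup they generate and fix a generic point \<open>p\<close>.
  The Taylor series of \<open>f\<close> at \<open>p\<close> solves the system iff its coefficients are
  \<open>\<partial>^u f(p) = \<phi>(A u)\<close> with a functional \<open>\<phi>\<close> on \<open>N = \<complex>[S]\<close> that vanishes on the images of the commuting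
  operators \<open>D\<^sub>l = \<Sum>\<^sub>k l(a\<^sub>k) p\<^sub>k t^{a\<^sub>k} + l(\<theta>) - l(\<beta>)\<close>, where \<open>l\<close> runs through the linear forms.
  Nondegeneracy of \<open>p\<close> makes \<open>N\<close> a finitely generated module over the polynomial ring
  \<open>P = \<complex>[D\<^sub>1, ..., D\<^sub>d]\<close> and bounds \<open>\<phi>(a)\<close> by a constant times \<open>R^{|a|} |a|!\<close>, so that every \<open>\<phi>\<close> gives a
  convergent solution.  Hence the number of solutions at \<open>p\<close> is the dimension \<open>m\<close> of the fibre of \<open>N\<close>
  at the origin, and comparing the growth of \<open>N\<close> with that of \<open>P\<close> gives \<open>m \<ge> vol A\<close>.

  If equality held, \<open>N\<close> would be free near the origin.  But the degree \<open>b\<close> of the integral part of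
  \<open>v - e\<^sub>3\<close> is a hole of \<open>S\<close>: the sums \<open>b + a\<^sub>1, ..., b + a\<^sub>4\<close> lie in \<open>S\<close>, while no
  \<open>b + \<Sum>\<^sub>k\<^sub>\<ge>\<^sub>5 c\<^sub>k a\<^sub>k\<close> with \<open>c\<^sub>k \<ge> 0\<close> does.  So two independent variables of \<open>P\<close> map \<open>t^b\<close> into \<open>N\<close>, and
  if \<open>N\<close> were free near the origin, coprimality of the two variables would put \<open>s t^b\<close> into \<open>N\<close> for some
  \<open>s\<close> with \<open>s(0) \<noteq> 0\<close>, which the functional on \<open>t^b \<complex>[a\<^sub>5, ..., a\<^sub>n]\<close> killed by all \<open>D\<^sub>l\<close> excludes.
\<close>

section \<open>Modules over commuting operators\<close>

text \<open>The two variables arise as follows. The n - 4 = d - 2 columns other than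
  \<open>a\<^sub>1, ..., a\<^sub>4\<close> are linearly independent. They are completed by two
  further columns to a basis, and the operators \<open>D\<^sub>i\<close> belong to the dual basis of
  linear forms. The two forms dual to the added columns vanish on the face columns and on \<beta> -
  b, which is a combination of these. So the diagonal term of \<open>D\<^sub>i t^b\<close> cancels,
  and only the degrees \<open>b + a\<^sub>1, ..., b + a\<^sub>4\<close> remain. The excluding
  functional records the derivatives at \<open>p\<close> of the product of the powers
  \<open>x\<^sub>k^{\<alpha>\<^sub>k}\<close>, k \<ge> 5, divided by its value. Freeness near the
  origin is handled without localisation: Nakayama's lemma gives \<open>s\<close> with s(0) \<noteq>
  0 such that \<open>s N\<close> lies in the module generated by \<open>m\<close> elements. The hole
  forces a relation between them, and multiplication by one of its coefficients makes one generator
  redundant. Multiplication by a nonzero polynomial is injective, by leading terms for a generic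
  weight, so \<open>N\<close> grows no faster than m - 1 copies of \<open>P\<close>.\<close>

definition total_degree :: "nat^'n \<Rightarrow> nat" where
  "total_degree u = (\<Sum>i\<in>UNIV. u $ i)"

lemma total_degree_0 [simp]: "total_degree 0 = 0"
  by (simp add: total_degree_def)

lemma total_degree_add [simp]: "total_degree (u + w) = total_degree u + total_degree w"
  by (simp add: total_degree_def sum.distrib)

lemma total_degree_axis [simp]: "total_degree (axis j k) = k"
  by (simp add: total_degree_def axis_def)

lemma total_degree_eq_0 [simp]: "total_degree u = 0 \<longleftrightarrow> u = 0"
  by (simp add: total_degree_def vec_eq_iff)

lemma nat_vec_decompose:
  fixes u :: "nat^'n"
  assumes "u $ j > 0"
  obtains w where "u = w + axis j 1"
proof
  show "u = (u - axis j 1) + axis j 1"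
    using assms by (auto simp: vec_eq_iff axis_def)
qed

lemma nat_vec_induct [case_names zero add_axis]:
  fixes u :: "nat^'n"
  assumes "P 0" "\<And>u j. P u \<Longrightarrow> P (u + axis j 1)"
  shows "P u"
proof (induction "total_degree u" arbitrary: u)
  case 0
  then show ?case using assms(1) by simp
next
  case (Suc k)
  then obtain j where "u $ j > 0"
    by (metis gr0I nat.distinct(1) total_degree_eq_0 vec_eq_iff zero_index)
  then obtain w where w: "u = w + axis j 1" by (rule nat_vec_decompose)
  with Suc(2) have "k = total_degree w" by simp
  then show ?case using Suc(1) assms(2) w by blast
qed

lemma finite_total_degree_le: "finite {u :: nat^'n. total_degree u \<le> k}"
proof (rule finite_subset)
  show "{u :: nat^'n. total_degree u \<le> k} \<subseteq> {u. u \<le> (\<chi> i. k) \<and> u \<le> (\<chi> i. k)}"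
    by (auto simp: less_eq_vec_def total_degree_def)
      (meson finite_class.finite_UNIV le_trans member_le_sum UNIV_I zero_le)
qed (rule finite_multi_index_le)

lemma variables_props: "distinct (variables :: 'n::finite list)" "set (variables :: 'n list) = UNIV"
proof -
  have "\<exists>js :: 'n list. distinct js \<and> set js = UNIV"
    using finite_distinct_list[OF finite_class.finite_UNIV] by blast
  from someI_ex[OF this]
  show "distinct (variables :: 'n list)" "set (variables :: 'n list) = UNIV"
    by (simp_all add: variables_def)
qed

text \<open>Exponents are natural, so a sum of two vanishes only if both do. Evaluation at the
  origin is therefore multiplicative, and the polynomials with nonzero constant term, the
  denominators of the local ring, are closed under products.\<close>

lemma lookup_0_mult:
  fixes r q :: "(nat^'n) \<Rightarrow>\<^sub>0 complex"
  shows "Poly_Mapping.lookup (r * q) 0 = Poly_Mapping.lookup r 0 * Poly_Mapping.lookup q 0"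
proof (induction r rule: pm_induct)
  case (add P Q)
  then show ?case by (simp add: distrib_right lookup_add)
next
  case (single k c)
  show ?case
  proof (induction q rule: pm_induct)
    case (add P Q)
    then show ?case by (simp add: distrib_left lookup_add)
  next
    case (single l e)
    have "k + l = 0 \<longleftrightarrow> k = 0 \<and> l = 0" by (auto simp: vec_eq_iff)
    then show ?case by (auto simp: mult_single lookup_single when_def)
  qed
qed

text \<open>The operators act on a space that may be larger than the module \<open>N\<close> studied
  below: the decisive element \<open>n\<close> of \<open>fiber_bound\<close> lies outside
  \<open>N\<close>, and polynomials must still act on it.\<close>

locale commuting_operators = vector_space scale
  for scale :: "complex \<Rightarrow> 'v::ab_group_add \<Rightarrow> 'v" +
  fixes D :: "'i::finite \<Rightarrow> 'v \<Rightarrow> 'v"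
  assumes D_add: "D i (x + y) = D i x + D i y"
    and D_scale: "D i (scale c x) = scale c (D i x)"
    and D_commute: "D i (D j x) = D j (D i x)"
begin

definition mon :: "nat^'i \<Rightarrow> 'v \<Rightarrow> 'v" where
  "mon g = foldr (\<lambda>i. D i ^^ (g $ i)) variables"

definition act :: "((nat^'i) \<Rightarrow>\<^sub>0 complex) \<Rightarrow> 'v \<Rightarrow> 'v" where
  "act r h = (\<Sum>g \<in> Poly_Mapping.keys r. scale (Poly_Mapping.lookup r g) (mon g h))"

lemma D_funpow_commute: "(D i ^^ k) (D j x) = D j ((D i ^^ k) x)"
  by (induction k) (simp_all add: D_commute)

lemma mon_0 [simp]: "mon 0 h = h"
proof -
  have "foldr (\<lambda>i. D i ^^ ((0::nat^'i) $ i)) xs h = h" for xs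
    by (induction xs) simp_all
  then show ?thesis by (simp add: mon_def)
qed

lemma mon_add_axis: "mon (g + axis j 1) h = D j (mon g h)"
proof -
  have "foldr (\<lambda>i. D i ^^ ((g + axis j 1) $ i)) xs h
      = (if j \<in> set xs then D j (foldr (\<lambda>i. D i ^^ (g $ i)) xs h) else foldr (\<lambda>i. D i ^^ (g $ i)) xs h)"
    if "distinct xs" for xs
    using that by (induction xs) (auto simp: axis_def D_funpow_commute)
  from this[OF variables_props(1)] show ?thesis by (simp add: mon_def variables_props)
qed

lemma mon_add: "mon (g + g') h = mon g (mon g' h)"
proof (induction g rule: nat_vec_induct)
  case (add_axis u j)
  have "u + axis j 1 + g' = (u + g') + axis j 1" by (simp add: ac_simps)
  then show ?case by (simp only: mon_add_axis add_axis)
qed simp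

lemma mon_axis: "mon (axis j 1) h = D j h"
  using mon_add_axis[of 0 j h] by simp

lemma mon_linear: "mon g (x + y) = mon g x + mon g y" "mon g (scale c x) = scale c (mon g x)"
  by (induction g rule: nat_vec_induct) (simp_all only: mon_0 mon_add_axis D_add D_scale)

lemma mon_closed:
  assumes "\<And>i h. h \<in> N \<Longrightarrow> D i h \<in> N" "h \<in> N"
  shows "mon g h \<in> N"
  by (induction g rule: nat_vec_induct) (simp_all only: mon_0 mon_add_axis assms)

lemma act_add_left: "act (r + q) h = act r h + act q h"
  unfolding act_def by (rule setsum_keys_plus_distrib) (simp_all add: scale_left_distrib)

lemma act_0_left [simp]: "act 0 h = 0"
  by (simp add: act_def)

lemma act_uminus_left: "act (- r) h = - act r h"
  using act_add_left[of "- r" r h] by (simp add: eq_neg_iff_add_eq_0)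

lemma act_diff_left: "act (r - q) h = act r h - act q h"
  using act_add_left[of r "- q" h] by (simp add: act_uminus_left)

lemma act_single: "act (Poly_Mapping.single g c) h = scale c (mon g h)"
  by (cases "c = 0") (simp_all add: act_def)

lemma act_1 [simp]: "act 1 h = h"
  by (simp flip: single_one add: act_single)

lemma act_sum_left: "act (sum r S) h = (\<Sum>s\<in>S. act (r s) h)"
  by (induction S rule: infinite_finite_induct) (simp_all add: act_add_left)

lemma act_add_right: "act r (x + y) = act r x + act r y"
  by (simp add: act_def mon_linear scale_right_distrib sum.distrib)

lemma act_scale_right: "act r (scale c x) = scale c (act r x)"
  by (simp add: act_def mon_linear scale_sum_right mult.commute)

lemma linear_act: "Vector_Spaces.linear scale scale (act r)"
  by (simp add: Vector_Spaces.linear_iff act_add_right act_scale_right vector_space_axioms)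

lemma act_0_right [simp]: "act r 0 = 0"
  using act_scale_right[of r 0 0] by simp

lemma act_uminus_right: "act r (- x) = - act r x"
  using act_add_right[of r "- x" x] by (simp add: eq_neg_iff_add_eq_0)

lemma act_diff_right: "act r (x - y) = act r x - act r y"
  using act_add_right[of r x "- y"] by (simp add: act_uminus_right)

lemma act_sum_right: "act r (sum x S) = (\<Sum>s\<in>S. act r (x s))"
  by (induction S rule: infinite_finite_induct) (simp_all add: act_add_right)

lemma act_mult: "act (r * q) h = act r (act q h)"
proof (induction r rule: pm_induct)
  case (add P Q)
  then show ?case by (simp add: distrib_right act_add_left)
next
  case (single k c)
  show ?case
  proof (induction q rule: pm_induct)
    case (add P Q)
    then show ?case by (simp add: distrib_left act_add_left act_add_right)
  next
    case (single l e)
    show ?case by (simp add: mult_single act_single mon_add mon_linear)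
  qed
qed

lemma act_commute: "act r (act q h) = act q (act r h)"
  by (metis act_mult mult.commute)

abbreviation var :: "'i \<Rightarrow> (nat^'i) \<Rightarrow>\<^sub>0 complex" where
  "var i \<equiv> Poly_Mapping.single (axis i 1) 1"

lemma act_var: "act (var i) h = D i h"
  unfolding act_single by (simp add: mon_axis del: One_nat_def)

lemma act_closed:
  assumes "subspace N" "\<And>i h. h \<in> N \<Longrightarrow> D i h \<in> N" "h \<in> N"
  shows "act r h \<in> N"
  unfolding act_def using assms mon_closed[of N]
  by (intro subspace_sum subspace_scale) auto

text \<open>On \<open>N\<close> the functional factors through the quotient by the images of the
  \<open>D i\<close>, where every monomial except 1 acts as zero.\<close>

lemma act_functional:
  fixes chi :: "'v \<Rightarrow> complex"
  assumes N: "subspace N" "\<And>i h. h \<in> N \<Longrightarrow> D i h \<in> N" "h \<in> N"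
    and chi: "Vector_Spaces.linear scale (*) chi" "\<And>i h. h \<in> N \<Longrightarrow> chi (D i h) = 0"
  shows "chi (act r h) = Poly_Mapping.lookup r 0 * chi h"
proof -
  interpret chi: Vector_Spaces.linear scale "(*)" chi by fact
  have mon: "chi (mon g h) = (if g = 0 then chi h else 0)" for g
  proof (cases "g = 0")
    case False
    then obtain j where "g $ j > 0"
      by (metis gr0I vec_eq_iff zero_index)
    then obtain g' where "g = g' + axis j 1" by (rule nat_vec_decompose)
    then show ?thesis using False N mon_closed[of N h g'] by (simp only: mon_add_axis chi if_False)
  qed simp
  have "chi (act r h) = (\<Sum>g \<in> Poly_Mapping.keys r. if g = 0 then Poly_Mapping.lookup r g * chi h else 0)"
    by (simp add: act_def chi.sum chi.scale mon if_distrib cong: if_cong)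
  also have "\<dots> = Poly_Mapping.lookup r 0 * chi h"
    by (simp add: sum.delta in_keys_iff)
  finally show ?thesis .
qed

text \<open>Gaussian elimination in place of the determinant of Nakayama's lemma. In the equation
  for \<open>b0\<close> itself the coefficient of \<open>b0\<close> becomes
  \<open>s - q b0 b0\<close>, whose constant term is that of \<open>s\<close>; multiplying the other
  equations by it allows \<open>b0\<close> to be substituted. Products replace divisions throughout,
  so the local ring never appears.\<close>

lemma nakayama_elimination:
  fixes G :: "'v set"
  assumes "finite X" "X \<subseteq> W"
    and "\<exists>s. Poly_Mapping.lookup s 0 \<noteq> 0 \<and> (\<forall>w\<in>W. \<exists>r q. act s w = (\<Sum>g\<in>G. act (r g) g) + (\<Sum>b\<in>X. act (q b) b)
            \<and> (\<forall>b\<in>X. Poly_Mapping.lookup (q b) 0 = 0))"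
  shows "\<exists>s. Poly_Mapping.lookup s 0 \<noteq> 0 \<and> (\<forall>w\<in>W. \<exists>r. act s w = (\<Sum>g\<in>G. act (r g) g))"
  using assms
proof (induction X rule: finite_induct)
  case empty
  then show ?case by simp
next
  case (insert b0 X)
  from insert.prems(2) obtain s where s0: "Poly_Mapping.lookup s 0 \<noteq> 0"
    and ex: "\<And>w. w \<in> W \<Longrightarrow> \<exists>r q. act s w = (\<Sum>g\<in>G. act (r g) g) + (\<Sum>b\<in>insert b0 X. act (q b) b)
            \<and> (\<forall>b\<in>insert b0 X. Poly_Mapping.lookup (q b) 0 = 0)"
    by blast
  have "\<forall>w\<in>W. \<exists>z. act s w = (\<Sum>g\<in>G. act (fst z g) g) + (\<Sum>b\<in>insert b0 X. act (snd z b) b)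
            \<and> (\<forall>b\<in>insert b0 X. Poly_Mapping.lookup (snd z b) 0 = 0)"
    using ex by (simp only: split_paired_Ex fst_conv snd_conv) blast
  from bchoice[OF this] obtain z where
    z: "\<forall>w\<in>W. act s w = (\<Sum>g\<in>G. act (fst (z w) g) g) + (\<Sum>b\<in>insert b0 X. act (snd (z w) b) b)
            \<and> (\<forall>b\<in>insert b0 X. Poly_Mapping.lookup (snd (z w) b) 0 = 0)" ..
  define r q where "r = fst \<circ> z" and "q = snd \<circ> z"
  have s: "\<And>w. w \<in> W \<Longrightarrow> act s w = (\<Sum>g\<in>G. act (r w g) g) + (\<Sum>b\<in>insert b0 X. act (q w b) b)"
    and q: "\<And>w b. w \<in> W \<Longrightarrow> b \<in> insert b0 X \<Longrightarrow> Poly_Mapping.lookup (q w b) 0 = 0"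
    using z by (auto simp: r_def q_def)
  define t where "t = s - q b0 b0"
  have t0: "Poly_Mapping.lookup t 0 \<noteq> 0"
    using s0 q[of b0 b0] insert.prems by (simp add: t_def lookup_minus)
  have tb0: "act t b0 = (\<Sum>g\<in>G. act (r b0 g) g) + (\<Sum>b\<in>X. act (q b0 b) b)"
    using s[of b0] insert.prems insert.hyps by (simp add: t_def act_diff_left)
  have "\<exists>r' q'. act (t * s) w = (\<Sum>g\<in>G. act (r' g) g) + (\<Sum>b\<in>X. act (q' b) b)
      \<and> (\<forall>b\<in>X. Poly_Mapping.lookup (q' b) 0 = 0)" if w: "w \<in> W" for w
  proof (intro exI conjI ballI)
    have "act (t * s) w = act t ((\<Sum>g\<in>G. act (r w g) g) + (\<Sum>b\<in>X. act (q w b) b)) + act (q w b0) (act t b0)"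
      using s[OF w] insert.hyps by (simp add: act_mult act_add_right act_commute[of t])
    also have "\<dots> = (\<Sum>g\<in>G. act (t * r w g + q w b0 * r b0 g) g) + (\<Sum>b\<in>X. act (t * q w b + q w b0 * q b0 b) b)"
      unfolding tb0 by (simp add: act_mult act_add_right act_add_left act_sum_right sum.distrib)
    finally show "act (t * s) w = (\<Sum>g\<in>G. act (t * r w g + q w b0 * r b0 g) g) + (\<Sum>b\<in>X. act (t * q w b + q w b0 * q b0 b) b)" .
    show "Poly_Mapping.lookup (t * q w b + q w b0 * q b0 b) 0 = 0" if "b \<in> X" for b
      using q[OF w] insert.prems that q[of b0 b] by (simp add: lookup_add lookup_0_mult)
  qed
  moreover have "Poly_Mapping.lookup (t * s) 0 \<noteq> 0" using s0 t0 by (simp add: lookup_0_mult)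
  ultimately show ?case using insert.prems by (intro insert.IH) blast+
qed

text \<open>\<open>G\<close> spans the fibre. Expanding the \<open>u i\<close> in the generators
  \<open>W\<close> gives the boundary part coefficients that are divisible by variables and hence
  vanish at the origin: the input of the elimination with \<open>s = 1\<close> and all of
  \<open>W\<close> to be eliminated.\<close>

lemma nakayama:
  fixes G W :: "'v set"
  assumes W: "finite W" "W \<subseteq> N" "\<And>h. h \<in> N \<Longrightarrow> \<exists>r. h = (\<Sum>w\<in>W. act (r w) w)"
    and G: "\<And>h. h \<in> N \<Longrightarrow> \<exists>c u. (\<forall>i. u i \<in> N) \<and> h = (\<Sum>g\<in>G. scale (c g) g) + (\<Sum>i\<in>UNIV. D i (u i))"
  shows "\<exists>s. Poly_Mapping.lookup s 0 \<noteq> 0 \<and> (\<forall>w\<in>W. \<exists>r. act s w = (\<Sum>g\<in>G. act (r g) g))"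
proof (rule nakayama_elimination[OF W(1) subset_refl], intro exI[of _ 1] conjI ballI)
  fix w assume "w \<in> W"
  then obtain c u where u: "\<And>i. u i \<in> N" and w: "w = (\<Sum>g\<in>G. scale (c g) g) + (\<Sum>i\<in>UNIV. D i (u i))"
    using G[of w] W(2) by blast
  obtain r where r: "\<And>i. u i = (\<Sum>w\<in>W. act (r i w) w)" using W(3)[OF u] by metis
  have "(\<Sum>i\<in>UNIV. D i (u i)) = (\<Sum>i\<in>UNIV. \<Sum>b\<in>W. act (var i * r i b) b)"
    unfolding r by (simp add: act_sum_right act_mult flip: act_var)
  also have "\<dots> = (\<Sum>b\<in>W. act (\<Sum>i\<in>UNIV. var i * r i b) b)"
    by (subst sum.swap) (simp add: act_sum_left)
  finally have "act 1 w = (\<Sum>g\<in>G. act (Poly_Mapping.single 0 (c g)) g) + (\<Sum>b\<in>W. act (\<Sum>i\<in>UNIV. var i * r i b) b)"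
    using w by (simp add: act_single)
  moreover have "axis i (Suc 0) \<noteq> 0" for i :: 'i by (simp add: vec_eq_iff axis_def)
  then have "Poly_Mapping.lookup (\<Sum>i\<in>UNIV. var i * r i b) 0 = 0" for b
    by (simp add: lookup_sum lookup_0_mult lookup_single)
  ultimately show "\<exists>r q. act 1 w = (\<Sum>g\<in>G. act (r g) g) + (\<Sum>b\<in>W. act (q b) b)
      \<and> (\<forall>b\<in>W. Poly_Mapping.lookup (q b) 0 = 0)" by (intro exI conjI ballI)
qed (simp add: lookup_one)

text \<open>Multiplication by \<open>s\<close> embeds the span of \<open>X k\<close> into the module
  generated by \<open>H\<close> and raises the degree in the operators by a bounded amount
  only.\<close>

lemma growth_bound:
  fixes W H :: "'v set"
  assumes W: "finite W" and H: "finite H"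
    and X: "\<And>k. independent (X k)" "\<And>k. X k \<subseteq> span {mon g w | g w. total_degree g \<le> k \<and> w \<in> W}"
    and inj: "\<And>h. act s h = 0 \<Longrightarrow> h = 0"
    and s: "\<And>w. w \<in> W \<Longrightarrow> \<exists>r. act s w = (\<Sum>g\<in>H. act (r g) g)"
  shows "\<exists>c. \<forall>k. card (X k) \<le> card H * card {g :: nat^'i. total_degree g \<le> k + c}"
proof -
  obtain r where r: "\<And>w. w \<in> W \<Longrightarrow> act s w = (\<Sum>g\<in>H. act (r w g) g)" using s by metis
  define K where "K = (\<Union>w\<in>W. \<Union>g\<in>H. Poly_Mapping.keys (r w g))"
  \<comment> \<open>The largest degree among the finitely many coefficients that express
    \<open>act s w\<close>; inserting 0 covers the case that there are none.\<close>
  define c where "c = Max (insert 0 (total_degree ` K))"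
  have "finite K" using W H by (simp add: K_def)
  then have c: "total_degree g' \<le> c" if "g' \<in> Poly_Mapping.keys (r w g)" "w \<in> W" "g \<in> H" for g' w g
    using that by (auto simp: c_def K_def intro!: Max_ge)
  interpret p: vector_space_pair scale scale by unfold_locales
  have "card (X k) \<le> card H * card {g :: nat^'i. total_degree g \<le> k + c}" for k
  proof -
    let ?T = "(\<lambda>(g, h). mon g h) ` ({g. total_degree g \<le> k + c} \<times> H)"
    have fT: "finite ?T" using H by (intro finite_imageI finite_cartesian_product finite_total_degree_le)
    have "act s (mon g w) \<in> span ?T" if "total_degree g \<le> k" "w \<in> W" for g w
    proof -
      have "act s (mon g w) = act (Poly_Mapping.single g 1) (act s w)"
        using act_commute[of s "Poly_Mapping.single g 1" w] by (simp add: act_single)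
      also have "\<dots> = (\<Sum>h\<in>H. \<Sum>g' \<in> Poly_Mapping.keys (r w h). scale (Poly_Mapping.lookup (r w h) g') (mon (g + g') h))"
        unfolding r[OF that(2)]
        by (simp add: act_sum_right act_def[of "r w _"] act_scale_right act_single mon_add)
      also have "\<dots> \<in> span ?T"
      proof (intro span_sum span_scale span_base)
        fix h g' assume h: "h \<in> H" and g': "g' \<in> Poly_Mapping.keys (r w h)"
        have "total_degree (g + g') \<le> k + c" using that c[OF g' that(2) h] by (simp add: add_mono)
        then show "mon (g + g') h \<in> ?T" using h by (intro image_eqI[where x = "(g + g', h)"]) auto
      qed
      finally show ?thesis .
    qed
    then have "act s ` span {mon g w | g w. total_degree g \<le> k \<and> w \<in> W} \<subseteq> span ?T"
      by (subst module_hom.span_image[OF linear_act[of s, unfolded linear_iff_module_hom], symmetric])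
        (intro span_minimal, auto)
    then have sub: "act s ` X k \<subseteq> span ?T" using X(2)[of k] by blast
    have inj': "inj (act s)"
      by (rule injI) (metis act_diff_right inj right_minus_eq)
    then have "independent (act s ` X k)"
      using X(1) linear_act[of s] by (intro p.linear_independent_injective_image) (auto intro: inj_on_subset)
    from independent_span_bound[OF fT this sub] have "card (act s ` X k) \<le> card ?T" by simp
    also have "\<dots> \<le> card ({g :: nat^'i. total_degree g \<le> k + c} \<times> H)"
      using H by (intro card_image_le finite_cartesian_product finite_total_degree_le)
    finally show ?thesis
      using inj' by (simp add: card_image inj_on_subset card_cartesian_product mult.commute)
  qed
  then show ?thesis by blast
qed

text \<open>If the elements of \<open>G\<close> were independent over the polynomial ring,
  \<open>s\<close> times \<open>D x n\<close> and \<open>s\<close> times \<open>D y n\<close> would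
  have unique coordinates. Cross multiplication would make those of the former divisible by the
  variable x and put \<open>act s n\<close> into \<open>N\<close>. So there is a relation, and it
  saves one generator in the growth bound.\<close>

theorem fiber_bound:
  fixes G W N :: "'v set"
  assumes N: "subspace N" "\<And>i h. h \<in> N \<Longrightarrow> D i h \<in> N"
    and torsion: "\<And>r h. act r h = 0 \<Longrightarrow> r = 0 \<or> h = 0"
    and W: "finite W" "W \<subseteq> N" "\<And>h. h \<in> N \<Longrightarrow> \<exists>r. h = (\<Sum>w\<in>W. act (r w) w)"
    and X: "\<And>k. independent (X k)" "\<And>k. X k \<subseteq> span {mon g w | g w. total_degree g \<le> k \<and> w \<in> W}"
    and G: "finite G" "G \<subseteq> N"
      "\<And>h. h \<in> N \<Longrightarrow> \<exists>c u. (\<forall>i. u i \<in> N) \<and> h = (\<Sum>g\<in>G. scale (c g) g) + (\<Sum>i\<in>UNIV. D i (u i))"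
    and n: "x \<noteq> y" "D x n \<in> N" "D y n \<in> N" "\<And>s. Poly_Mapping.lookup s 0 \<noteq> 0 \<Longrightarrow> act s n \<notin> N"
  shows "\<exists>m c. card G = Suc m \<and> (\<forall>k. card (X k) \<le> m * card {g :: nat^'i. total_degree g \<le> k + c})"
proof -
  obtain s where s0: "Poly_Mapping.lookup s 0 \<noteq> 0" and s: "\<And>w. w \<in> W \<Longrightarrow> \<exists>r. act s w = (\<Sum>g\<in>G. act (r g) g)"
    using nakayama[OF W G(3)] by blast
  have sN: "\<exists>r. act s h = (\<Sum>g\<in>G. act (r g) g)" if h: "h \<in> N" for h
  proof -
    obtain q where q: "h = (\<Sum>w\<in>W. act (q w) w)" using W(3)[OF h] by blast
    obtain r where r: "\<And>w. w \<in> W \<Longrightarrow> act s w = (\<Sum>g\<in>G. act (r w g) g)" using s by metis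
    have "act s h = (\<Sum>w\<in>W. act (q w) (act s w))"
      unfolding q by (simp add: act_sum_right act_commute[of s])
    also have "\<dots> = (\<Sum>w\<in>W. \<Sum>g\<in>G. act (q w * r w g) g)"
      by (intro sum.cong refl) (simp add: r act_sum_right act_mult)
    also have "\<dots> = (\<Sum>g\<in>G. act (\<Sum>w\<in>W. q w * r w g) g)"
      by (subst sum.swap) (simp add: act_sum_left)
    finally show ?thesis by (rule exI[where x = "\<lambda>g. \<Sum>w\<in>W. q w * r w g"])
  qed
  have "\<exists>rho. (\<Sum>g\<in>G. act (rho g) g) = 0 \<and> (\<exists>g\<in>G. rho g \<noteq> 0)"
  proof (rule ccontr)
    assume "\<not> ?thesis"
    then have indep: "rho g = 0" if "(\<Sum>g\<in>G. act (rho g) g) = 0" "g \<in> G" for rho g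
      using that by blast
    obtain r1 where r1: "act s (D x n) = (\<Sum>g\<in>G. act (r1 g) g)" using sN[OF n(2)] by blast
    obtain r2 where r2: "act s (D y n) = (\<Sum>g\<in>G. act (r2 g) g)" using sN[OF n(3)] by blast
    \<comment> \<open>Both sides are \<open>s\<close> applied to \<open>D x (D y n)\<close>;
      independence then compares their coordinates one by one.\<close>
    have "act (var y) (act s (D x n)) = act (var x) (act s (D y n))"
      by (metis act_commute act_var)
    then have "(\<Sum>g\<in>G. act (var y * r1 g - var x * r2 g) g) = 0"
      unfolding r1 r2 by (simp add: act_sum_right act_mult act_diff_left sum_subtractf)
    then have eq: "var y * r1 g = var x * r2 g" if "g \<in> G" for g
      using indep that by force
    have "\<exists>q. r1 g = var x * q" if g: "g \<in> G" for g
    proof -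
      define q where "q = (\<Sum>k \<in> Poly_Mapping.keys (r1 g). Poly_Mapping.single (k - axis x 1) (Poly_Mapping.lookup (r1 g) k))"
      have shift: "Poly_Mapping.lookup (var i * r) (k + axis i 1) = Poly_Mapping.lookup r k"
        "k $ i = 0 \<Longrightarrow> Poly_Mapping.lookup (var i * r) k = 0" for i r and k :: "nat^'i"
      proof (induction r rule: pm_induct)
        case (add P Q)
        { case 1 then show ?case using add by (simp add: distrib_left lookup_add) }
        { case 2 then show ?case using add by (simp add: distrib_left lookup_add) }
      next
        case (single l e)
        { case 1 then show ?case by (simp add: mult_single lookup_single add.commute) }
        { case 2 then show ?case by (auto simp: mult_single lookup_single when_def axis_def vec_eq_iff) }
      qed
      \<comment> \<open>Coprimality of the two variables in terms of exponents: a monomial of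
        \<open>r1 g\<close> without x would survive in \<open>var y * r1 g\<close>, all of whose
        monomials contain x.\<close>
      have pos: "k $ x > 0" if "k \<in> Poly_Mapping.keys (r1 g)" for k
      proof (rule ccontr)
        assume "\<not> k $ x > 0"
        then have "(k + axis y 1) $ x = 0" using n(1) by (simp add: axis_def)
        then have "Poly_Mapping.lookup (var y * r1 g) (k + axis y 1) = 0"
          unfolding eq[OF g] by (rule shift)
        then show False using that by (simp only: shift in_keys_iff)
      qed
      have "var x * q = (\<Sum>k \<in> Poly_Mapping.keys (r1 g). Poly_Mapping.single k (Poly_Mapping.lookup (r1 g) k))"
        unfolding q_def sum_distrib_left
      proof (intro sum.cong refl)
        fix k assume "k \<in> Poly_Mapping.keys (r1 g)"
        then have "axis x 1 + (k - axis x 1) = k"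
          using pos[of k] by (auto simp: vec_eq_iff axis_def)
        then show "var x * Poly_Mapping.single (k - axis x 1) (Poly_Mapping.lookup (r1 g) k)
            = Poly_Mapping.single k (Poly_Mapping.lookup (r1 g) k)"
          by (simp add: mult_single)
      qed
      then show ?thesis using pm_decompose[of "r1 g"] by metis
    qed
    then obtain q where q: "\<And>g. g \<in> G \<Longrightarrow> r1 g = var x * q g" by metis
    have "act (var x) (act s n) = act s (D x n)"
      by (metis act_commute act_var)
    also have "\<dots> = (\<Sum>g\<in>G. act (var x * q g) g)"
      unfolding r1 by (intro sum.cong refl) (simp add: q)
    also have "\<dots> = act (var x) (\<Sum>g\<in>G. act (q g) g)"
      by (simp only: act_sum_right act_mult)
    finally have "act (var x) (act s n) = act (var x) (\<Sum>g\<in>G. act (q g) g)" .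
    \<comment> \<open>Absence of torsion now cancels the variable.\<close>
    then have "act (var x) (act s n - (\<Sum>g\<in>G. act (q g) g)) = 0" by (simp add: act_diff_right)
    moreover have "var x \<noteq> 0" by (metis lookup_single_eq lookup_zero zero_neq_one)
    ultimately have "act s n = (\<Sum>g\<in>G. act (q g) g)" using torsion by fastforce
    also have "\<dots> \<in> N" using G(2) N by (intro subspace_sum act_closed) auto
    finally show False using n(4) s0 by blast
  qed
  then obtain rho g0 where rho: "(\<Sum>g\<in>G. act (rho g) g) = 0" and g0: "g0 \<in> G" "rho g0 \<noteq> 0" by blast
  have rel: "act (rho g0) g0 = - (\<Sum>g\<in>G - {g0}. act (rho g) g)"
    using rho G(1) g0(1) by (simp add: sum.remove[of G g0] eq_neg_iff_add_eq_0)
  have s_nz: "s \<noteq> 0" using s0 by auto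
  have inj: "h = 0" if "act (rho g0 * s) h = 0" for h
    using that torsion g0(2) s_nz unfolding act_mult by metis
  have "\<exists>c. \<forall>k. card (X k) \<le> card (G - {g0}) * card {g :: nat^'i. total_degree g \<le> k + c}"
  proof (rule growth_bound[OF W(1) _ X inj])
    fix w assume "w \<in> W"
    then obtain r where r: "act s w = (\<Sum>g\<in>G. act (r g) g)" using s by blast
    have "act (rho g0 * s) w = act (r g0) (act (rho g0) g0) + (\<Sum>g\<in>G - {g0}. act (rho g0 * r g) g)"
      unfolding act_mult r using G(1) g0(1)
      by (simp add: sum.remove[of G g0] act_add_right act_sum_right act_mult act_commute[of "r g0"])
    also have "\<dots> = (\<Sum>g\<in>G - {g0}. act (rho g0 * r g - r g0 * rho g) g)"
      unfolding rel by (simp add: act_uminus_right act_sum_right act_mult act_diff_left sum_subtractf)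
    finally show "\<exists>r. act (rho g0 * s) w = (\<Sum>g\<in>G - {g0}. act (r g) g)"
      by (rule exI[where x = "\<lambda>g. rho g0 * r g - r g0 * rho g"])
  qed (use G in auto)
  moreover have "card G = Suc (card (G - {g0}))"
    using G(1) g0(1) by (rule card.remove)
  ultimately show ?thesis by blast
qed

end

section \<open>Operators on Laurent polynomials\<close>

lemma finite_has_max:
  fixes f :: "'a \<Rightarrow> real"
  assumes "finite S" "S \<noteq> {}"
  shows "\<exists>x\<in>S. \<forall>y\<in>S. f y \<le> f x"
proof -
  have "Max (f ` S) \<in> f ` S" using assms by (intro Max_in) auto
  then obtain x where "x \<in> S" "f x = Max (f ` S)" by auto
  then show ?thesis using assms by (metis Max_ge finite_imageI imageI)
qed

lemma (in vector_space) exists_functional: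
  assumes "x \<notin> span S"
  obtains f where "Vector_Spaces.linear scale (*) f" "f x = 1" "\<And>y. y \<in> S \<Longrightarrow> f y = 0"
proof -
  interpret p: vector_space_pair scale "(*) :: 'a \<Rightarrow> 'a \<Rightarrow> 'a"
    by unfold_locales (simp_all add: algebra_simps)
  obtain B where B: "B \<subseteq> S" "independent B" "S \<subseteq> span B"
    using maximal_independent_subset[of S] by blast
  have "x \<notin> span B" using assms span_mono[OF B(1)] by blast
  then have "independent (insert x B)" using B(2) by (rule independent_insertI)
  then obtain f where f: "Vector_Spaces.linear scale (*) f" "\<forall>y\<in>insert x B. f y = (if y = x then 1 else 0)"
    using p.linear_independent_extend[of _ "\<lambda>y. if y = x then 1 else 0"] by blast
  have fB: "f y = 0" if "y \<in> B" for y
    using f(2) that \<open>x \<notin> span B\<close> span_base[of x B] by auto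
  interpret f: Vector_Spaces.linear scale "(*)" f by (rule f)
  have "f y = 0" if "y \<in> S" for y
    using B(3) that fB f.eq_0_on_span by blast
  then show ?thesis using f by (intro that[of f]) auto
qed

text \<open>The coefficients are indexed by \<open>I\<close> and not by the image, so that
  coinciding vectors \<open>f i\<close> can be kept apart.\<close>

lemma (in vector_space) span_image_finite:
  assumes "finite I" "x \<in> span (f ` I)"
  obtains c where "x = (\<Sum>i\<in>I. scale (c i) (f i))"
proof -
  have "subspace (range (\<lambda>c. \<Sum>i\<in>I. scale (c i) (f i)))"
  proof (rule subspaceI)
    show "0 \<in> range (\<lambda>c. \<Sum>i\<in>I. scale (c i) (f i))"
      by (rule range_eqI[where x = "\<lambda>_. 0"]) simp
  next
    fix x y assume "x \<in> range (\<lambda>c. \<Sum>i\<in>I. scale (c i) (f i))" "y \<in> range (\<lambda>c. \<Sum>i\<in>I. scale (c i) (f i))"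
    then obtain c e where "x = (\<Sum>i\<in>I. scale (c i) (f i))" "y = (\<Sum>i\<in>I. scale (e i) (f i))" by auto
    then have "x + y = (\<Sum>i\<in>I. scale (c i + e i) (f i))" by (simp add: scale_left_distrib sum.distrib)
    then show "x + y \<in> range (\<lambda>c. \<Sum>i\<in>I. scale (c i) (f i))" by (rule range_eqI[where x = "\<lambda>i. c i + e i"])
  next
    fix x b assume "x \<in> range (\<lambda>c. \<Sum>i\<in>I. scale (c i) (f i))"
    then obtain c where "x = (\<Sum>i\<in>I. scale (c i) (f i))" by auto
    then have "scale b x = (\<Sum>i\<in>I. scale (b * c i) (f i))" by (simp add: scale_sum_right)
    then show "scale b x \<in> range (\<lambda>c. \<Sum>i\<in>I. scale (c i) (f i))" by (rule range_eqI[where x = "\<lambda>i. b * c i"])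
  qed
  moreover have "f ` I \<subseteq> range (\<lambda>c. \<Sum>i\<in>I. scale (c i) (f i))"
  proof clarify
    fix j assume "j \<in> I"
    then have "f j = (\<Sum>i\<in>I. scale (if i = j then 1 else 0) (f i))"
      using assms(1) by (simp add: if_distrib[where f = "\<lambda>c. scale c _"] cong: if_cong)
    then show "f j \<in> range (\<lambda>c. \<Sum>i\<in>I. scale (c i) (f i))"
      by (rule range_eqI[where x = "\<lambda>i. if i = j then 1 else 0"])
  qed
  ultimately have "span (f ` I) \<subseteq> range (\<lambda>c. \<Sum>i\<in>I. scale (c i) (f i))"
    by (intro span_minimal)
  then show ?thesis using assms(2) that by blast
qed

section \<open>Laurent polynomials as a complex vector space\<close>

definition pm_scale :: "complex \<Rightarrow> ('k::comm_monoid_add \<Rightarrow>\<^sub>0 complex) \<Rightarrow> ('k \<Rightarrow>\<^sub>0 complex)" where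
  "pm_scale c h = Poly_Mapping.single 0 c * h"

lemma vector_space_pm_scale: "vector_space pm_scale"
  by unfold_locales
    (simp_all add: pm_scale_def distrib_left distrib_right single_add mult.assoc[symmetric] mult_single)

lemma pm_scale_single: "pm_scale c (Poly_Mapping.single k e) = Poly_Mapping.single k (c * e)"
  by (simp add: pm_scale_def mult_single)

lemma lookup_pm_scale [simp]: "Poly_Mapping.lookup (pm_scale c h) k = c * Poly_Mapping.lookup h k"
  by (induction h rule: pm_induct)
    (simp_all add: pm_scale_def distrib_left lookup_add mult_single lookup_single mult_when)

interpretation pm: vector_space pm_scale
  by (rule vector_space_pm_scale)

lemma pm_decompose_scale:
  "h = (\<Sum>k \<in> Poly_Mapping.keys h. pm_scale (Poly_Mapping.lookup h k) (Poly_Mapping.single k 1))"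
  using pm_decompose[of h] by (simp add: pm_scale_single)

text \<open>The operators \<open>\<Sum>\<^sub>k l(a\<^sub>k) p\<^sub>k t^{a\<^sub>k} + l(\<theta>) - l(\<beta>)\<close> on Laurent polynomials, where \<open>a\<^sub>k\<close> is the
  \<open>k\<close>-th column of \<open>A\<close> and \<open>\<theta> t^a = a t^a\<close>: the functionals that they annihilate are the Taylor
  coefficients at \<open>p\<close> of the solutions of the hypergeometric system.\<close>

definition gkz_symbol :: "int^'n^'d \<Rightarrow> complex^'n \<Rightarrow> (int^'d \<Rightarrow> complex) \<Rightarrow> int^'d \<Rightarrow> (int^'d \<Rightarrow>\<^sub>0 complex)" where
  "gkz_symbol A p l a = (\<Sum>k\<in>UNIV. Poly_Mapping.single (a + column k A) (l (column k A) * p $ k))"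

definition gkz_op ::
  "int^'n^'d \<Rightarrow> complex^'n \<Rightarrow> (int^'d \<Rightarrow> complex) \<Rightarrow> complex \<Rightarrow> (int^'d \<Rightarrow>\<^sub>0 complex) \<Rightarrow> (int^'d \<Rightarrow>\<^sub>0 complex)" where
  "gkz_op A p l b = pm_lin (\<lambda>a. gkz_symbol A p l a + Poly_Mapping.single a (l a - b))"

lemma gkz_op_single:
  "gkz_op A p l b (Poly_Mapping.single a c) = pm_scale c (gkz_symbol A p l a + Poly_Mapping.single a (l a - b))"
  by (simp add: gkz_op_def pm_lin_single pm_scale_def)

lemma gkz_op_single_1:
  "gkz_op A p l b (Poly_Mapping.single a 1) = gkz_symbol A p l a + pm_scale (l a - b) (Poly_Mapping.single a 1)"
  by (simp add: gkz_op_single pm_scale_single)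

lemma gkz_op_add: "gkz_op A p l b (x + y) = gkz_op A p l b x + gkz_op A p l b y"
  by (simp add: gkz_op_def pm_lin_add)

lemma gkz_op_scale: "gkz_op A p l b (pm_scale c x) = pm_scale c (gkz_op A p l b x)"
  by (simp add: gkz_op_def pm_scale_def pm_lin_scale)

lemma gkz_op_sum: "gkz_op A p l b (sum f S) = (\<Sum>s\<in>S. gkz_op A p l b (f s))"
  by (simp add: gkz_op_def pm_lin_sum)

lemma lookup_gkz_op:
  "Poly_Mapping.lookup (gkz_op A p l b h) x
    = (\<Sum>k\<in>UNIV. l (column k A) * p $ k * Poly_Mapping.lookup h (x - column k A)) + (l x - b) * Poly_Mapping.lookup h x"
proof (induction h rule: pm_induct)
  case (add P Q)
  then show ?case by (simp add: gkz_op_add lookup_add algebra_simps sum.distrib)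
next
  case (single a c)
  have "(a + column k A = x) = (a = x - column k A)" for k by auto
  then show ?case
    by (simp add: gkz_op_single gkz_symbol_def pm.scale_right_distrib pm.scale_sum_right pm_scale_single lookup_add lookup_sum
        lookup_single when_def algebra_simps if_distrib cong: if_cong)
qed

text \<open>Moving \<open>l(\<theta>)\<close> past
  \<open>l'(a\<^sub>k) p\<^sub>k t^{a\<^sub>k}\<close> costs
  \<open>l(a\<^sub>k) l'(a\<^sub>k) p\<^sub>k t^{a\<^sub>k}\<close>, which is symmetric in
  \<open>l\<close> and \<open>l'\<close>; the two corrections cancel.\<close>

lemma gkz_op_commute:
  fixes A :: "int^'n^'d"
  assumes l: "\<And>x y. l (x + y) = l x + l y" and l': "\<And>x y. l' (x + y) = l' x + l' y"
  shows "gkz_op A p l b (gkz_op A p l' b' h) = gkz_op A p l' b' (gkz_op A p l b h)"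
proof (induction h rule: pm_induct)
  case (add P Q)
  then show ?case by (simp add: gkz_op_add)
next
  case (single a c)
  let ?s = "Poly_Mapping.single :: int^'d \<Rightarrow> complex \<Rightarrow> _"
  have expand: "gkz_op A p l b (gkz_op A p l' b' (?s a 1)) =
     (\<Sum>k\<in>UNIV. \<Sum>j\<in>UNIV. ?s (a + column k A + column j A) (l' (column k A) * p $ k * (l (column j A) * p $ j)))
   + (\<Sum>k\<in>UNIV. ?s (a + column k A) (p $ k * (l' (column k A) * (l a + l (column k A) - b) + l (column k A) * (l' a - b'))))
   + ?s a ((l' a - b') * (l a - b))"
    if "\<And>x y. l (x + y) = l x + l y" for l l' b b'
  proof -
    have "gkz_op A p l b (gkz_op A p l' b' (?s a 1)) =
      (\<Sum>k\<in>UNIV. (\<Sum>j\<in>UNIV. ?s (a + column k A + column j A) (l' (column k A) * p $ k * (l (column j A) * p $ j)))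
         + ?s (a + column k A) (l' (column k A) * p $ k * (l a + l (column k A) - b)))
      + ((\<Sum>k\<in>UNIV. ?s (a + column k A) ((l' a - b') * (l (column k A) * p $ k))) + ?s a ((l' a - b') * (l a - b)))"
      by (simp add: gkz_op_single gkz_symbol_def gkz_op_add gkz_op_sum gkz_op_scale that
          pm.scale_right_distrib pm.scale_sum_right pm_scale_single)
    also have "\<dots> = (\<Sum>k\<in>UNIV. \<Sum>j\<in>UNIV. ?s (a + column k A + column j A) (l' (column k A) * p $ k * (l (column j A) * p $ j)))
        + (\<Sum>k\<in>UNIV. ?s (a + column k A) (l' (column k A) * p $ k * (l a + l (column k A) - b)) + ?s (a + column k A) ((l' a - b') * (l (column k A) * p $ k)))
        + ?s a ((l' a - b') * (l a - b))"
      by (simp add: sum.distrib ac_simps)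
    also have "(\<lambda>k. ?s (a + column k A) (l' (column k A) * p $ k * (l a + l (column k A) - b)) + ?s (a + column k A) ((l' a - b') * (l (column k A) * p $ k)))
       = (\<lambda>k. ?s (a + column k A) (p $ k * (l' (column k A) * (l a + l (column k A) - b) + l (column k A) * (l' a - b'))))"
      by (simp add: single_add[symmetric] algebra_simps)
    finally show ?thesis .
  qed
  have "gkz_op A p l b (gkz_op A p l' b' (?s a 1)) = gkz_op A p l' b' (gkz_op A p l b (?s a 1))"
    unfolding expand[OF l] expand[OF l']
    by (subst sum.swap) (simp add: algebra_simps)
  moreover have "?s a c = pm_scale c (?s a 1)" by (simp add: pm_scale_single)
  ultimately show ?case by (simp only: gkz_op_scale)
qed

text \<open>The forms \<open>l i\<close> are dual to the columns \<open>e i\<close>. This makes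
  \<open>op i\<close> ignore the shifts by the other basis columns, so that for a suitable weight
  its leading term is the shift by the column \<open>e i\<close>.\<close>

locale gkz_operators =
  fixes A :: "int^'n^'d" and p :: "complex^'n" and l :: "'d \<Rightarrow> int^'d \<Rightarrow> complex" and lb :: "'d \<Rightarrow> complex"
    and e :: "'d \<Rightarrow> 'n"
  assumes l_add: "\<And>i x y. l i (x + y) = l i x + l i y"
    and l_dual: "\<And>i j. l i (column (e j) A) = (if i = j then 1 else 0)"
begin

abbreviation op :: "'d \<Rightarrow> (int^'d \<Rightarrow>\<^sub>0 complex) \<Rightarrow> (int^'d \<Rightarrow>\<^sub>0 complex)" where
  "op i \<equiv> gkz_op A p (l i) (lb i)"

sublocale ops: commuting_operators pm_scale op
  by unfold_locales (simp_all add: gkz_op_add gkz_op_scale gkz_op_commute l_add)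

definition basis_comb :: "nat^'d \<Rightarrow> int^'d" where
  "basis_comb g = (\<chi> m. \<Sum>i\<in>UNIV. int (g $ i) * A $ m $ e i)"

lemma basis_comb_add_axis: "basis_comb (g + axis j 1) = basis_comb g + column (e j) A"
  by (simp add: basis_comb_def vec_eq_iff axis_def column_def distrib_right sum.distrib
      if_distrib[where f = int] if_distrib[where f = "\<lambda>x. x * _"] cong: if_cong)

lemma basis_comb_0 [simp]: "basis_comb 0 = 0"
  by (simp add: basis_comb_def vec_eq_iff)

lemma l_basis_comb: "l i (basis_comb g) = of_nat (g $ i)"
proof (induction g rule: nat_vec_induct)
  case zero
  show ?case using l_add[of i 0 0] by simp
next
  case (add_axis u j)
  then show ?case by (simp only: basis_comb_add_axis l_add l_dual) (simp add: axis_def)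
qed

lemma inj_basis_comb: "inj basis_comb"
  by (rule injI) (metis l_basis_comb of_nat_eq_iff vec_eq_iff)

text \<open>Leading terms for the weight \<open>Lam\<close>: each \<open>op i\<close> moves the
  leading exponent by the column \<open>e i\<close>, the heaviest one that occurs in it. Different
  monomials of \<open>r\<close> move the leading exponent of \<open>h\<close> to places of different
  weight, so the heaviest of them cannot cancel. Equal columns contribute to the same term, which is
  why the sums in \<open>nz\<close> have to be nonzero.\<close>

lemma act_eq_0_imp:
  fixes Lam :: "int^'d \<Rightarrow> real"
  assumes add: "\<And>x y. Lam (x + y) = Lam x + Lam y" and inj: "inj Lam"
    and pos: "\<And>k. Lam (column k A) > 0"
    and less: "\<And>i k. l i (column k A) \<noteq> 0 \<Longrightarrow> column k A \<noteq> column (e i) A \<Longrightarrow> Lam (column k A) < Lam (column (e i) A)"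
    and nz: "\<And>k. (\<Sum>k' | column k' A = column k A. p $ k') \<noteq> 0"
    and act: "ops.act r h = 0"
  shows "r = 0 \<or> h = 0"
proof (rule ccontr)
  assume "\<not> ?thesis"
  then have r: "Poly_Mapping.keys r \<noteq> {}" and h: "Poly_Mapping.keys h \<noteq> {}" by auto
  have diff: "Lam (x - y) = Lam x - Lam y" for x y using add[of "x - y" y] by simp
  define lead where "lead h x \<longleftrightarrow> Poly_Mapping.lookup h x \<noteq> 0 \<and> (\<forall>y. Poly_Mapping.lookup h y \<noteq> 0 \<longrightarrow> Lam y \<le> Lam x)"
    for h :: "int^'d \<Rightarrow>\<^sub>0 complex" and x
  have lead_op: "lead (op i h) (x + column (e i) A)" if "lead h x" for h x i
  proof -
    let ?c = "column (e i) A"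
    have hy: "Poly_Mapping.lookup h y = 0" if "Lam y > Lam x" for y
      using \<open>lead h x\<close> that by (auto simp: lead_def not_le[symmetric])
    have "l i (column k A) * p $ k * Poly_Mapping.lookup h (x + ?c - column k A)
        = (if column k A = ?c then p $ k * Poly_Mapping.lookup h x else 0)" for k
    proof (cases "column k A = ?c \<or> l i (column k A) = 0")
      case True
      then show ?thesis using l_dual[of i i] by auto
    next
      case False
      then have "Lam (x + ?c - column k A) > Lam x" using less[of i k] by (simp add: add diff)
      then show ?thesis using hy False by auto
    qed
    \<comment> \<open>The diagonal part of the operator does not raise the weight, while columns
      have positive weight; so it cannot reach the new leading exponent.\<close>
    moreover have "Poly_Mapping.lookup h (x + ?c) = 0" using pos[of "e i"] by (intro hy) (simp add: add)
    ultimately have "Poly_Mapping.lookup (op i h) (x + ?c) = (\<Sum>k | column k A = ?c. p $ k) * Poly_Mapping.lookup h x"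
      unfolding lookup_gkz_op by (simp add: sum_distrib_right sum.If_cases)
    then have "Poly_Mapping.lookup (op i h) (x + ?c) \<noteq> 0"
      using nz[of "e i"] \<open>lead h x\<close> by (simp add: lead_def)
    moreover have "Lam y \<le> Lam (x + ?c)" if "Poly_Mapping.lookup (op i h) y \<noteq> 0" for y
    proof (cases "Poly_Mapping.lookup h y = 0")
      case True
      then have "(\<Sum>k\<in>UNIV. l i (column k A) * p $ k * Poly_Mapping.lookup h (y - column k A)) \<noteq> 0"
        using that by (simp add: lookup_gkz_op)
      then obtain k where "l i (column k A) * p $ k * Poly_Mapping.lookup h (y - column k A) \<noteq> 0"
        by (meson sum.not_neutral_contains_not_neutral)
      then have "l i (column k A) \<noteq> 0" "Lam (y - column k A) \<le> Lam x"
        using \<open>lead h x\<close> by (auto simp: lead_def)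
      then show ?thesis using less[of i k] by (cases "column k A = ?c") (auto simp: add diff)
    next
      case False
      then have "Lam y \<le> Lam x" using \<open>lead h x\<close> by (auto simp: lead_def)
      then show ?thesis using pos[of "e i"] by (simp add: add)
    qed
    ultimately show ?thesis by (simp add: lead_def)
  qed
  obtain x where "x \<in> Poly_Mapping.keys h" "\<And>y. y \<in> Poly_Mapping.keys h \<Longrightarrow> Lam y \<le> Lam x"
    using finite_has_max[OF finite_keys h] by blast
  then have x: "lead h x" by (simp add: lead_def in_keys_iff)
  have lead_mon: "lead (ops.mon g h) (x + basis_comb g)" for g
    by (induction g rule: nat_vec_induct)
      (simp_all only: ops.mon_0 ops.mon_add_axis basis_comb_0 add_0_right basis_comb_add_axis add.assoc[symmetric] x lead_op)
  obtain g where g: "g \<in> Poly_Mapping.keys r" "\<And>g'. g' \<in> Poly_Mapping.keys r \<Longrightarrow> Lam (basis_comb g') \<le> Lam (basis_comb g)"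
    using finite_has_max[OF finite_keys r, of "\<lambda>g. Lam (basis_comb g)"] by blast
  have "Poly_Mapping.lookup (ops.mon g' h) (x + basis_comb g) = 0" if "g' \<in> Poly_Mapping.keys r" "g' \<noteq> g" for g'
  proof -
    have "Lam (basis_comb g') \<noteq> Lam (basis_comb g)"
      using that(2) inj inj_basis_comb by (auto simp: inj_eq)
    then have "Lam (x + basis_comb g') < Lam (x + basis_comb g)"
      using g(2)[OF that(1)] by (simp add: add)
    then show ?thesis using lead_mon[of g'] by (auto simp: lead_def not_le[symmetric])
  qed
  then have "Poly_Mapping.lookup (ops.act r h) (x + basis_comb g)
      = (\<Sum>g' \<in> Poly_Mapping.keys r. if g' = g then Poly_Mapping.lookup r g * Poly_Mapping.lookup (ops.mon g h) (x + basis_comb g) else 0)"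
    unfolding ops.act_def lookup_sum by (intro sum.cong) auto
  also have "\<dots> \<noteq> 0" using g(1) lead_mon[of g] by (simp add: lead_def in_keys_iff)
  finally show False using act by simp
qed

end

section \<open>Nondegenerate coefficients\<close>

definition cmb :: "int^'n^'d \<Rightarrow> nat^'n \<Rightarrow> int^'d" where
  "cmb A u = (\<chi> i. \<Sum>j\<in>UNIV. A $ i $ j * int (u $ j))"

lemma cmb_0 [simp]: "cmb A 0 = 0"
  by (simp add: cmb_def vec_eq_iff)

lemma cmb_add: "cmb A (u + w) = cmb A u + cmb A w"
  by (simp add: cmb_def vec_eq_iff algebra_simps sum.distrib)

lemma cmb_axis: "cmb A (axis j 1) = column j A"
  by (simp add: cmb_def vec_eq_iff axis_def column_def if_distrib cong: if_cong)

lemma cmb_add_axis: "cmb A (u + axis j 1) = cmb A u + column j A"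
  by (simp only: cmb_add cmb_axis)

lemma cmb_nth_degree:
  assumes "\<And>j. A $ r $ j = 1"
  shows "cmb A u $ r = int (total_degree u)"
  using assms by (simp add: cmb_def total_degree_def)

text \<open>The dual form of the statement that the \<open>d\<close> linear forms
  \<open>\<Sum>\<^sub>j A\<^sub>i\<^sub>j p\<^sub>j t^{a\<^sub>j}\<close>, times the monomials of
  degree \<open>k\<close>, span everything of degree \<open>k + 1\<close> in the semigroup ring:
  they are a system of parameters. Stated as a linear system for \<open>phi\<close> with
  coefficients depending on \<open>p\<close>, the condition is open.\<close>

definition nondegenerate :: "int^'n^'d \<Rightarrow> nat \<Rightarrow> complex^'n \<Rightarrow> bool" where
  "nondegenerate A k p \<longleftrightarrow> (\<forall>phi. (\<forall>u i. total_degree u = k \<longrightarrow>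
       (\<Sum>j\<in>UNIV. of_int (A $ i $ j) * p $ j * phi (cmb A u + column j A)) = 0) \<longrightarrow>
     (\<forall>u. total_degree u = Suc k \<longrightarrow> phi (cmb A u) = 0))"

lemma clear_denominators:
  fixes c :: "'a \<Rightarrow> rat"
  assumes "finite I"
  shows "\<exists>m>0. \<forall>i\<in>I. \<exists>z. of_int m * c i = of_int z"
  using assms
proof (induction I rule: finite_induct)
  case empty
  show ?case by (intro exI[of _ 1]) simp
next
  case (insert a I)
  then obtain m where m: "m > 0" "\<forall>i\<in>I. \<exists>z. of_int m * c i = of_int z" by blast
  obtain x y where c: "c a = Fract x y" "y > 0" by (cases "c a") auto
  have "\<exists>z. of_int (m * y) * c i = of_int z" if i: "i \<in> insert a I" for i
  proof (cases "i = a")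
    case True
    then have "of_int (m * y) * c i = of_int (m * x)" using c by (simp add: Fract_of_int_quotient)
    then show ?thesis ..
  next
    case False
    then obtain z where "of_int m * c i = of_int z" using m i by blast
    then have "of_int (m * y) * c i = of_int (y * z)" by (simp add: mult.commute mult.left_commute)
    then show ?thesis ..
  qed
  then show ?case using m(1) c(2) by (intro exI[of _ "m * y"]) simp
qed

text \<open>Over the rationals column \<open>j\<close> either lies in the span of the other columns
  of \<open>S\<close>, and clearing denominators turns this into an integer exchange of exponents,
  or a functional separates it from them.\<close>

lemma column_relation_or_functional:
  fixes A :: "int^'n^'d"
  assumes "j \<in> S"
  shows "(\<exists>w :: int^'n. w \<noteq> 0 \<and> A *v w = 0 \<and> (\<forall>i. i \<notin> S \<longrightarrow> w $ i = 0))
    \<or> (\<exists>l :: 'd \<Rightarrow> rat. (\<Sum>m\<in>UNIV. l m * of_int (A $ m $ j)) = 1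
         \<and> (\<forall>i\<in>S - {j}. (\<Sum>m\<in>UNIV. l m * of_int (A $ m $ i)) = 0))"
proof -
  define col :: "'n \<Rightarrow> rat^'d" where "col i = (\<chi> m. of_int (A $ m $ i))" for i
  show ?thesis
  proof (cases "col j \<in> vec.span (col ` (S - {j}))")
    case True
    then obtain c where c: "col j = (\<Sum>i\<in>S - {j}. c i *s col i)"
      using vec.span_image_finite[of "S - {j}" "col j" col] by auto
    obtain m where m: "m > 0" "\<forall>i\<in>S - {j}. \<exists>z. of_int m * c i = of_int z"
      using clear_denominators[of "S - {j}" c] by auto
    then obtain z where z: "\<And>i. i \<in> S - {j} \<Longrightarrow> of_int m * c i = of_int (z i)" by metis
    define w :: "int^'n" where "w = (\<chi> i. if i = j then m else if i \<in> S then - z i else 0)"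
    have "(\<Sum>i\<in>UNIV. A $ k $ i * w $ i) = 0" for k
    proof -
      have "(of_int (\<Sum>i\<in>UNIV. A $ k $ i * w $ i) :: rat) = (\<Sum>i\<in>S. of_int (A $ k $ i) * of_int (w $ i))"
        using assms by (simp, intro sum.mono_neutral_right) (auto simp: w_def)
      also have "\<dots> = of_int m * of_int (A $ k $ j) + (\<Sum>i\<in>S - {j}. of_int (A $ k $ i) * of_int (w $ i))"
        using assms by (subst sum.remove[of _ j]) (auto simp: w_def)
      also have "(\<Sum>i\<in>S - {j}. of_int (A $ k $ i) * of_int (w $ i)) = (\<Sum>i\<in>S - {j}. - (of_int m * (c i * of_int (A $ k $ i))))"
        by (intro sum.cong refl) (simp add: w_def z[symmetric])
      also have "\<dots> = - (of_int m * col j $ k)"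
        unfolding c by (simp add: sum_negf sum_distrib_left col_def)
      finally have "(of_int (\<Sum>i\<in>UNIV. A $ k $ i * w $ i) :: rat) = 0" by (simp add: col_def)
      then show ?thesis by (simp only: of_int_eq_0_iff)
    qed
    then have "A *v w = 0" by (simp add: vec_eq_iff matrix_vector_mult_def)
    moreover have "w $ j \<noteq> 0" "\<forall>i. i \<notin> S \<longrightarrow> w $ i = 0" using m(1) assms by (auto simp: w_def)
    ultimately show ?thesis by (intro disjI1 exI[of _ w]) auto
  next
    case False
    then obtain f where f: "Vector_Spaces.linear (*s) (*) f" "f (col j) = 1" "\<And>y. y \<in> col ` (S - {j}) \<Longrightarrow> f y = 0"
      using vec.exists_functional by blast
    interpret f: Vector_Spaces.linear "(*s)" "(*)" f by (rule f)
    have fx: "f x = (\<Sum>m\<in>UNIV. f (axis m 1) * x $ m)" for x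
    proof -
      have "f x = f (\<Sum>m\<in>UNIV. x $ m *s axis m 1)" by (simp add: basis_expansion)
      then show ?thesis by (simp add: f.sum f.scale mult.commute)
    qed
    have fcol: "f (col i) = (\<Sum>m\<in>UNIV. f (axis m 1) * of_int (A $ m $ i))" for i
      by (subst fx) (simp add: col_def)
    have "\<forall>i\<in>S - {j}. f (col i) = 0" by (intro ballI f(3) imageI)
    then show ?thesis using f(2) unfolding fcol
      by (intro disjI2 exI[of _ "\<lambda>m. f (axis m 1)"] conjI)
  qed
qed

text \<open>A weight that is good for \<open>W\<close> stays good when it is multiplied by a number
  larger than all the entries at \<open>j\<close> and then increased by 1 at \<open>j\<close>.
  Choosing \<open>j\<close> with \<open>w $ j \<noteq> 0\<close> repairs its value on the new
  vector.\<close>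

lemma exists_separating_weight:
  fixes W :: "(int^'n) set"
  assumes "finite W" "0 \<notin> W"
  shows "\<exists>om :: nat^'n. \<forall>w\<in>W. (\<Sum>j\<in>UNIV. int (om $ j) * w $ j) \<noteq> 0"
  using assms
proof (induction W rule: finite_induct)
  case (insert w W)
  then obtain om :: "nat^'n" where om: "\<forall>w\<in>W. (\<Sum>j\<in>UNIV. int (om $ j) * w $ j) \<noteq> 0" by auto
  obtain j where j: "w $ j \<noteq> 0" using insert.prems by (metis insertI1 vec_eq_iff zero_index)
  show ?case
  proof (cases "(\<Sum>j\<in>UNIV. int (om $ j) * w $ j) = 0")
    case False
    then show ?thesis using om by blast
  next
    case True
    define m where "m = (\<Sum>w'\<in>W. nat \<bar>w' $ j\<bar>) + 1"
    define om' :: "nat^'n" where "om' = (\<chi> i. m * om $ i + (if i = j then 1 else 0))"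
    have dot: "(\<Sum>i\<in>UNIV. int (om' $ i) * x $ i) = int m * (\<Sum>i\<in>UNIV. int (om $ i) * x $ i) + x $ j" for x :: "int^'n"
    proof -
      have "int (om' $ i) * x $ i = int m * (int (om $ i) * x $ i) + (if i = j then x $ i else 0)" for i
        by (simp add: om'_def algebra_simps)
      then show ?thesis by (simp add: sum.distrib sum_distrib_left)
    qed
    have "(\<Sum>i\<in>UNIV. int (om' $ i) * x $ i) \<noteq> 0" if x: "x \<in> W" for x
    proof
      assume "(\<Sum>i\<in>UNIV. int (om' $ i) * x $ i) = 0"
      then have "\<bar>x $ j\<bar> = int m * \<bar>\<Sum>i\<in>UNIV. int (om $ i) * x $ i\<bar>"
        unfolding dot by (metis abs_minus_cancel abs_mult abs_of_nat add_eq_0_iff)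
      moreover have "nat \<bar>x $ j\<bar> \<le> (\<Sum>w'\<in>W. nat \<bar>w' $ j\<bar>)"
        using insert.hyps x by (intro member_le_sum) auto
      then have "\<bar>x $ j\<bar> < int m" unfolding m_def by linarith
      moreover have "0 < \<bar>\<Sum>i\<in>UNIV. int (om $ i) * x $ i\<bar>" using om x by simp
      then have "1 \<le> \<bar>\<Sum>i\<in>UNIV. int (om $ i) * x $ i\<bar>" by linarith
      ultimately show False
        by (metis linorder_not_less mult.right_neutral mult_left_mono of_nat_0_le_iff)
    qed
    moreover have "(\<Sum>i\<in>UNIV. int (om' $ i) * w $ i) \<noteq> 0" unfolding dot True using j by simp
    ultimately show ?thesis by blast
  qed
qed simp

text \<open>The point \<open>p = \<tau>^\<omega>\<close> for a generic weight \<open>\<omega>\<close> and small \<open>\<tau>\<close> degenerates the toric ideal to a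
  monomial ideal whose standard monomials are supported, up to bounded exponents, on linearly
  independent columns.  Dually, \<open>\<psi> u = \<tau>^(\<omega>\<cdot>u) \<phi> (A u)\<close> is small whenever the columns on which \<open>u\<close>
  is large are dependent, and otherwise the linear equations move \<open>u\<close> towards such exponents.\<close>

lemma exists_nondegenerate:
  fixes A :: "int^'n^'d"
  assumes row: "\<And>j. A $ r $ j = 1"
  shows "\<exists>k (p :: real^'n). (\<forall>j. p $ j > 0) \<and> nondegenerate A k (\<chi> j. of_real (p $ j))"
proof -
  \<comment> \<open>One relation is fixed for every dependent set of columns, and the weight
    \<open>om\<close> is nonzero on all of them; so each relation has a heavier and a lighter
    side.\<close>
  define dep where "dep S w \<longleftrightarrow> w \<noteq> 0 \<and> A *v w = 0 \<and> (\<forall>i. i \<notin> S \<longrightarrow> w $ i = 0)" for S and w :: "int^'n"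
  define wf where "wf S = (SOME w. dep S w)" for S
  have wf: "dep S (wf S)" if "\<exists>w. dep S w" for S using someI_ex[OF that] by (simp add: wf_def)
  have "\<exists>om :: nat^'n. \<forall>w\<in>wf ` {S. \<exists>w. dep S w}. (\<Sum>j\<in>UNIV. int (om $ j) * w $ j) \<noteq> 0"
  proof (intro exists_separating_weight notI)
    assume "0 \<in> wf ` {S. \<exists>w. dep S w}"
    then obtain S where "wf S = 0" "\<exists>w. dep S w" by fastforce
    then show False using wf[of S] unfolding dep_def by blast
  qed simp
  then obtain om :: "nat^'n" where om: "\<And>S. \<exists>w. dep S w \<Longrightarrow> (\<Sum>j\<in>UNIV. int (om $ j) * wf S $ j) \<noteq> 0" by auto
  \<comment> \<open>Exponents of size at least \<open>M\<close> on \<open>S\<close> absorb the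
    relation \<open>wf S\<close> without becoming negative.\<close>
  define M where "M = (\<Sum>S\<in>UNIV. \<Sum>j\<in>UNIV. nat \<bar>wf S $ j\<bar>)"
  have M: "\<bar>wf S $ j\<bar> \<le> int M" for S j
  proof -
    have "nat \<bar>wf S $ j\<bar> \<le> (\<Sum>j\<in>UNIV. nat \<bar>wf S $ j\<bar>)" by (intro member_le_sum) auto
    also have "\<dots> \<le> M" unfolding M_def by (rule member_le_sum[of S UNIV "\<lambda>S. \<Sum>j\<in>UNIV. nat \<bar>wf S $ j\<bar>"]) auto
    finally show ?thesis by linarith
  qed
  define fl where "fl S j l \<longleftrightarrow> (\<Sum>m\<in>UNIV. l m * of_int (A $ m $ j)) = 1
         \<and> (\<forall>i\<in>S - {j}. (\<Sum>m\<in>UNIV. l m * of_int (A $ m $ i)) = 0)" for S j and l :: "'d \<Rightarrow> rat"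
  define lf where "lf S j = (SOME l. fl S j l)" for S j
  have lf: "fl S j (lf S j)" if "\<nexists>w. dep S w" "j \<in> S" for S j
  proof -
    have "\<exists>l. fl S j l" using column_relation_or_functional[OF that(2), of A] that(1) by (auto simp: dep_def fl_def)
    then show ?thesis unfolding lf_def by (rule someI_ex)
  qed
  define cf :: "'n set \<Rightarrow> 'n \<Rightarrow> 'n \<Rightarrow> complex" where "cf S j i = of_rat (\<Sum>m\<in>UNIV. lf S j m * of_int (A $ m $ i))" for S j i
  define C where "C = (\<Sum>S\<in>UNIV. \<Sum>j\<in>UNIV. \<Sum>i\<in>UNIV. norm (cf S j i)) + 1"
  have C1: "C \<ge> 1" by (simp add: C_def sum_nonneg)
  have C: "(\<Sum>i\<in>UNIV. norm (cf S j i)) \<le> C" for S j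
  proof -
    have "(\<Sum>i\<in>UNIV. norm (cf S j i)) \<le> (\<Sum>j\<in>UNIV. \<Sum>i\<in>UNIV. norm (cf S j i))"
      by (rule member_le_sum[of j UNIV "\<lambda>j. \<Sum>i\<in>UNIV. norm (cf S j i)"]) (auto simp: sum_nonneg)
    also have "\<dots> \<le> (\<Sum>S\<in>UNIV. \<Sum>j\<in>UNIV. \<Sum>i\<in>UNIV. norm (cf S j i))"
      by (rule member_le_sum[of S UNIV "\<lambda>S. \<Sum>j\<in>UNIV. \<Sum>i\<in>UNIV. norm (cf S j i)"]) (auto simp: sum_nonneg)
    finally show ?thesis by (simp add: C_def)
  qed
  \<comment> \<open>In degree \<open>k + 1\<close> some exponent exceeds \<open>M\<close>, which
    starts the reduction. The same number bounds the defect \<open>t\<close> introduced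
    below.\<close>
  define k where "k = CARD('n) * M"
  \<comment> \<open>A replacement of columns costs a factor \<open>C\<close> and happens at most
    \<open>k\<close> times; the factor \<open>tau\<close> gained by the final exchange must still
    win, here with total factor 1/2.\<close>
  define tau where "tau = 1 / (2 * C ^ k)"
  have tau: "tau > 0" "tau \<le> 1" "C ^ k * tau = 1 / 2"
  proof -
    have "C ^ k \<ge> 1" using C1 by (rule one_le_power)
    then have "2 * C ^ k \<ge> 1" "C ^ k > 0" by linarith+
    then show "tau > 0" "tau \<le> 1" "C ^ k * tau = 1 / 2" using C1 by (auto simp: tau_def)
  qed
  define dot where "dot u = (\<Sum>j\<in>UNIV. om $ j * u $ j)" for u :: "nat^'n"
  define p :: "real^'n" where "p = (\<chi> j. tau ^ (om $ j))"
  have dot_add: "dot (u + axis j 1) = dot u + om $ j" for u j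
  proof -
    have "om $ i * (u + axis j 1) $ i = om $ i * u $ i + (if i = j then om $ i else 0)" for i
      by (simp add: axis_def algebra_simps)
    then show ?thesis by (simp only: dot_def sum.distrib) simp
  qed
  have "phi (cmb A u) = 0"
    if phi: "\<And>u i. total_degree u = k \<Longrightarrow> (\<Sum>j\<in>UNIV. of_int (A $ i $ j) * of_real (p $ j) * phi (cmb A u + column j A)) = 0"
      and u: "total_degree u = Suc k" for phi :: "int^'d \<Rightarrow> complex" and u
  proof -
    define psi where "psi u = of_real (tau ^ dot u) * phi (cmb A u)" for u
    define U where "U = {u :: nat^'n. total_degree u = Suc k}"
    have fU: "finite U" unfolding U_def by (rule finite_subset[OF _ finite_total_degree_le[of "Suc k"]]) auto
    obtain u0 where u0: "u0 \<in> U" "\<And>w. w \<in> U \<Longrightarrow> norm (psi w) \<le> norm (psi u0)"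
      using finite_has_max[OF fU, of "\<lambda>u. norm (psi u)"] u by (auto simp: U_def)
    define m where "m = norm (psi u0)"
    have m0: "m \<ge> 0" by (simp add: m_def)
    have step: "(\<Sum>j\<in>UNIV. of_int (A $ i $ j) * psi (w + axis j 1)) = 0" if "total_degree w = k" for w i
    proof -
      have "(\<Sum>j\<in>UNIV. of_int (A $ i $ j) * psi (w + axis j 1))
         = of_real (tau ^ dot w) * (\<Sum>j\<in>UNIV. of_int (A $ i $ j) * of_real (p $ j) * phi (cmb A w + column j A))"
        unfolding psi_def cmb_add_axis dot_add by (simp add: p_def sum_distrib_left power_add ac_simps)
      then show ?thesis using phi[OF that] by simp
    qed
    \<comment> \<open>The defect below the level \<open>M\<close> is the measure of the reduction: a
      replacement takes one unit from an exponent above \<open>M\<close> and gives it to one below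
      \<open>M\<close>.\<close>
    define t where "t u = (\<Sum>j\<in>UNIV. M - u $ j)" for u :: "nat^'n"
    have "norm (psi w) \<le> C ^ t w * (tau * m)" if "w \<in> U" for w
      using that
    proof (induction "t w" arbitrary: w rule: less_induct)
      case less
      define S where "S = {j. w $ j \<ge> M}"
      show ?case
      proof (cases "\<exists>z. dep S z")
        case True
        obtain z where z: "dep S z" "(\<Sum>j\<in>UNIV. int (om $ j) * z $ j) > 0" "\<And>j. \<bar>z $ j\<bar> \<le> int M"
        proof (cases "(\<Sum>j\<in>UNIV. int (om $ j) * wf S $ j) > 0")
          case True
          then show ?thesis using wf[OF \<open>\<exists>z. dep S z\<close>] M by (intro that[of "wf S"])
        next
          case False
          have "A *v (- wf S) = - (A *v wf S)" by (simp add: vec_eq_iff matrix_vector_mult_def sum_negf)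
          then show ?thesis using wf[OF \<open>\<exists>z. dep S z\<close>] M False om[OF \<open>\<exists>z. dep S z\<close>]
            by (intro that[of "- wf S"]) (auto simp: dep_def sum_negf)
        qed
        \<comment> \<open>Moving along the relation keeps the degree \<open>cmb A w\<close> and
          lowers the weight, so \<open>psi w\<close> is \<open>psi w'\<close> times at least one
          factor \<open>tau\<close>.\<close>
        define w' :: "nat^'n" where "w' = (\<chi> j. nat (int (w $ j) - z $ j))"
        have w': "int (w' $ j) = int (w $ j) - z $ j" for j
        proof (cases "j \<in> S")
          case True
          then show ?thesis using z(3)[of j] by (auto simp: w'_def S_def)
        next
          case False
          then show ?thesis using z(1) by (auto simp: w'_def dep_def)
        qed
        have Az: "(\<Sum>j\<in>UNIV. A $ i $ j * z $ j) = 0" for i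
          using z(1) by (simp add: dep_def vec_eq_iff matrix_vector_mult_def)
        have cmb_eq: "cmb A w' = cmb A w"
          by (simp add: cmb_def vec_eq_iff w' right_diff_distrib sum_subtractf Az)
        then have "w' \<in> U" using less.prems cmb_nth_degree[OF row] unfolding U_def
          by (metis mem_Collect_eq of_nat_eq_iff)
        have "int (dot w) = int (dot w') + (\<Sum>j\<in>UNIV. int (om $ j) * z $ j)"
          by (simp add: dot_def w' right_diff_distrib sum_subtractf)
        then have "dot w \<ge> Suc (dot w')" using z(2) by linarith
        then obtain q where q: "dot w = Suc (dot w') + q" using le_Suc_ex by blast
        have "norm (psi w) = (tau * tau ^ q) * norm (psi w')"
          unfolding psi_def cmb_eq q using tau by (simp add: norm_mult norm_power power_add)
        also have "\<dots> \<le> (tau * 1) * m"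
          using tau u0(2)[OF \<open>w' \<in> U\<close>] unfolding m_def
          by (intro mult_mono mult_left_mono power_le_one) auto
        also have "\<dots> \<le> C ^ t w * (tau * m)"
          using mult_right_mono[OF one_le_power[OF C1, of "t w"], of "tau * m"] tau m0 by simp
        finally show ?thesis .
      next
        case False
        have "\<exists>j. w $ j > M"
        proof (rule ccontr)
          assume "\<nexists>j. w $ j > M"
          then have "total_degree w \<le> (\<Sum>j\<in>(UNIV :: 'n set). M)" unfolding total_degree_def by (intro sum_mono) (simp add: not_less)
          then show False using less.prems by (simp add: U_def k_def)
        qed
        then obtain j where j: "w $ j > M" ..
        then obtain v where v: "w = v + axis j 1" using nat_vec_decompose[of w j] by auto
        have dv: "total_degree v = k" using less.prems v by (simp add: U_def)
        have "j \<in> S" using j by (simp add: S_def)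
        then have fl: "fl S j (lf S j)" using lf False by blast
        have "cf S j i = of_rat (\<Sum>m\<in>UNIV. lf S j m * of_int (A $ m $ i))" for i by (simp add: cf_def)
        then have cf: "cf S j j = 1" "\<And>i. i \<in> S - {j} \<Longrightarrow> cf S j i = 0"
          using fl by (simp_all add: fl_def)
        \<comment> \<open>Here the columns in \<open>S\<close> are independent. The form that is 1
          on column \<open>j\<close> and 0 on the rest of \<open>S\<close> combines the equations
          into one that expresses \<open>psi w\<close> by columns outside \<open>S\<close>.\<close>
        have "(\<Sum>i\<in>UNIV. cf S j i * psi (v + axis i 1)) = (\<Sum>m\<in>UNIV. of_rat (lf S j m) * (\<Sum>i\<in>UNIV. of_int (A $ m $ i) * psi (v + axis i 1)))"
          by (simp add: cf_def of_rat_sum of_rat_mult sum_distrib_left sum_distrib_right mult.assoc) (rule sum.swap)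
        then have "(\<Sum>i\<in>UNIV. cf S j i * psi (v + axis i 1)) = 0" by (simp only: step[OF dv] mult_zero_right sum.neutral_const)
        then have "psi w = - (\<Sum>i\<in>UNIV - {j}. cf S j i * psi (v + axis i 1))"
          using cf(1) by (simp only: sum.remove[of UNIV j] finite_class.finite_UNIV UNIV_I v mult_1 eq_neg_iff_add_eq_0)
        also have "(\<Sum>i\<in>UNIV - {j}. cf S j i * psi (v + axis i 1)) = (\<Sum>i\<in>- S. cf S j i * psi (v + axis i 1))"
          using cf(2) \<open>j \<in> S\<close> by (intro sum.mono_neutral_right) auto
        finally have "norm (psi w) \<le> (\<Sum>i\<in>- S. norm (cf S j i * psi (v + axis i 1)))"
          by (simp only: norm_minus_cancel norm_sum)
        also have "\<dots> \<le> (\<Sum>i\<in>- S. norm (cf S j i) * (C ^ (t w - 1) * (tau * m)))"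
        proof (rule sum_mono)
          fix i assume "i \<in> - S"
          then have i: "w $ i < M" "i \<noteq> j" using j by (auto simp: S_def)
          have "t w = (\<Sum>x\<in>UNIV. (M - (v + axis i 1) $ x) + (if x = i then 1 else 0))"
            unfolding t_def
          proof (intro sum.cong refl)
            fix x show "M - w $ x = (M - (v + axis i 1) $ x) + (if x = i then 1 else 0)"
              using i j v by (auto simp: axis_def)
          qed
          also have "\<dots> = t (v + axis i 1) + 1" by (simp add: t_def sum.distrib)
          finally have t: "t w = Suc (t (v + axis i 1))" by simp
          have "norm (psi (v + axis i 1)) \<le> C ^ (t w - 1) * (tau * m)"
            using less.hyps[of "v + axis i 1"] t dv by (simp add: U_def)
          then show "norm (cf S j i * psi (v + axis i 1)) \<le> norm (cf S j i) * (C ^ (t w - 1) * (tau * m))"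
            by (simp only: norm_mult mult_left_mono norm_ge_zero)
        qed
        also have "\<dots> = (\<Sum>i\<in>- S. norm (cf S j i)) * (C ^ (t w - 1) * (tau * m))"
          by (simp add: sum_distrib_right)
        also have "\<dots> \<le> C ^ t w * (tau * m)"
        proof (cases "S = UNIV")
          case True
          then show ?thesis using C1 tau m0 by simp
        next
          case False
          then obtain i where "w $ i < M" unfolding S_def by (metis (mono_tags, lifting) UNIV_eq_I mem_Collect_eq not_le)
          then have "t w \<noteq> 0" by (auto simp: t_def intro: exI[of _ i])
          then have "C ^ t w = C * C ^ (t w - 1)" by (metis power_eq_if)
          moreover have "(\<Sum>i\<in>- S. norm (cf S j i)) \<le> C"
            using C[of S j] sum_mono2[of UNIV "- S" "\<lambda>i. norm (cf S j i)"] by simp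
          ultimately show ?thesis
            using C1 tau m0 by (simp add: mult.assoc) (intro mult_right_mono, auto)
        qed
        finally show ?thesis .
      qed
    qed
    \<comment> \<open>At the maximum itself the bound reads \<open>m \<le> m / 2\<close>.\<close>
    from this[OF u0(1)] have "m \<le> C ^ t u0 * (tau * m)" by (simp add: m_def)
    also have "\<dots> \<le> C ^ k * (tau * m)"
    proof (intro mult_right_mono power_increasing)
      have "t u0 \<le> (\<Sum>j\<in>(UNIV :: 'n set). M)" unfolding t_def by (intro sum_mono) simp
      then show "t u0 \<le> k" by (simp add: k_def)
    qed (use C1 tau m0 in auto)
    also have "\<dots> = m / 2" using tau(3) by (simp add: mult.assoc[symmetric])
    finally have "m = 0" using m0 by simp
    then have "psi u = 0" using u0(2)[of u] u by (simp add: m_def U_def)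
    then show ?thesis using tau(1) by (simp add: psi_def)
  qed
  then have "nondegenerate A k (\<chi> j. of_real (p $ j))" by (auto simp: nondegenerate_def)
  moreover have "\<forall>j. p $ j > 0" using tau(1) by (simp add: p_def)
  ultimately show ?thesis by blast
qed

section \<open>Nondegeneracy as a Zariski open condition\<close>

lemma polynomial_Cn_sum:
  "(\<And>i. i \<in> I \<Longrightarrow> polynomial_Cn (f i)) \<Longrightarrow> polynomial_Cn (\<lambda>x. \<Sum>i\<in>I. f i x)"
  by (induction I rule: infinite_finite_induct) (auto intro: polynomial_Cn.intros)

lemma polynomial_Cn_prod:
  "(\<And>i. i \<in> I \<Longrightarrow> polynomial_Cn (f i)) \<Longrightarrow> polynomial_Cn (\<lambda>x. \<Prod>i\<in>I. f i x)"
  by (induction I rule: infinite_finite_induct) (auto intro: polynomial_Cn.intros)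

text \<open>Fraction-free Gaussian elimination, one unknown at a time, with pivots that are nonzero
  at \<open>p0\<close>; \<open>q\<close> is the product of the pivots. The induction runs over the
  unknowns, so \<open>E\<close> may be infinite.\<close>

lemma generic_trivial_kernel:
  fixes E :: "('x \<Rightarrow> complex^'n \<Rightarrow> complex) set"
  assumes "finite X"
    and "\<And>c x. c \<in> E \<Longrightarrow> x \<in> X \<Longrightarrow> polynomial_Cn (c x)"
    and "\<And>phi. (\<And>c. c \<in> E \<Longrightarrow> (\<Sum>x\<in>X. c x p0 * phi x) = 0) \<Longrightarrow> \<forall>x\<in>X. phi x = 0"
  shows "\<exists>q. polynomial_Cn q \<and> q p0 \<noteq> 0 \<and>
    (\<forall>p phi. q p \<noteq> 0 \<longrightarrow> (\<forall>c\<in>E. (\<Sum>x\<in>X. c x p * phi x) = 0) \<longrightarrow> (\<forall>x\<in>X. phi x = 0))"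
  using assms
proof (induction X arbitrary: E rule: finite_induct)
  case empty
  then show ?case by (intro exI[of _ "\<lambda>_. 1"]) (auto intro: polynomial_Cn.intros)
next
  case (insert y X)
  \<comment> \<open>Otherwise the indicator of \<open>y\<close> would solve the system at
    \<open>p0\<close>.\<close>
  have "\<exists>c\<in>E. c y p0 \<noteq> 0"
  proof (rule ccontr)
    assume "\<not> ?thesis"
    then have "c \<in> E \<Longrightarrow> (\<Sum>x\<in>insert y X. c x p0 * (if x = y then 1 else 0)) = 0" for c
      using insert.hyps by (auto simp: if_distrib cong: if_cong)
    then have "\<forall>x\<in>insert y X. (if x = y then 1 else 0) = (0 :: complex)" by (rule insert.prems(2))
    then show False by simp
  qed
  then obtain c0 where c0: "c0 \<in> E" "c0 y p0 \<noteq> 0" by blast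
  define el where "el c = (\<lambda>x p. c0 y p * c x p - c y p * c0 x p)" for c :: "'x \<Rightarrow> complex^'n \<Rightarrow> complex"
  have sum_el: "(\<Sum>x\<in>X. el c x p * phi x)
      = c0 y p * (\<Sum>x\<in>insert y X. c x p * phi x) - c y p * (\<Sum>x\<in>insert y X. c0 x p * phi x)" for c p phi
    using insert.hyps by (simp add: el_def algebra_simps sum_distrib_left sum_subtractf)
  have "\<exists>q. polynomial_Cn q \<and> q p0 \<noteq> 0 \<and>
    (\<forall>p phi. q p \<noteq> 0 \<longrightarrow> (\<forall>c\<in>el ` E. (\<Sum>x\<in>X. c x p * phi x) = 0) \<longrightarrow> (\<forall>x\<in>X. phi x = 0))"
  proof (rule insert.IH)
    fix c x assume "c \<in> el ` E" "x \<in> X"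
    then obtain c' where c': "c' \<in> E" "c = el c'" by auto
    have "polynomial_Cn (\<lambda>p. c0 y p * c' x p + (- 1) * (c' y p * c0 x p))"
      using insert.prems(1) c0 c' \<open>x \<in> X\<close> by (intro polynomial_Cn.intros) auto
    then show "polynomial_Cn (c x)" by (simp add: c' el_def)
  next
    fix phi assume phi: "\<And>c. c \<in> el ` E \<Longrightarrow> (\<Sum>x\<in>X. c x p0 * phi x) = 0"
    \<comment> \<open>The value at \<open>y\<close> is chosen so that the pivot equation
      \<open>c0\<close> holds.\<close>
    define phi' where "phi' x = (if x = y then - (\<Sum>x\<in>X. c0 x p0 * phi x) / c0 y p0 else phi x)" for x
    have X': "(\<Sum>x\<in>X. c x p0 * phi' x) = (\<Sum>x\<in>X. c x p0 * phi x)" for c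
      using insert.hyps by (intro sum.cong) (auto simp: phi'_def)
    have c0': "(\<Sum>x\<in>insert y X. c0 x p0 * phi' x) = 0"
      using insert.hyps c0(2) by (simp add: X' ) (simp add: phi'_def)
    have "(\<Sum>x\<in>insert y X. c x p0 * phi' x) = 0" if "c \<in> E" for c
    proof -
      have "0 = (\<Sum>x\<in>X. el c x p0 * phi' x)" using phi[of "el c"] that by (simp add: X')
      then show ?thesis unfolding sum_el c0' using c0(2) by simp
    qed
    then have "\<forall>x\<in>insert y X. phi' x = 0" by (rule insert.prems(2))
    then show "\<forall>x\<in>X. phi x = 0" using insert.hyps by (metis insertI2 phi'_def)
  qed
  then obtain q where q: "polynomial_Cn q" "q p0 \<noteq> 0"
    "\<And>p phi. q p \<noteq> 0 \<Longrightarrow> (\<forall>c\<in>el ` E. (\<Sum>x\<in>X. c x p * phi x) = 0) \<Longrightarrow> \<forall>x\<in>X. phi x = 0" by blast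
  show ?case
  proof (intro exI[of _ "\<lambda>p. q p * c0 y p"] conjI allI impI)
    show "polynomial_Cn (\<lambda>p. q p * c0 y p)"
      using q(1) insert.prems(1) c0 by (intro polynomial_Cn.intros) auto
    show "q p0 * c0 y p0 \<noteq> 0" using q c0 by simp
    fix p phi assume nz: "q p * c0 y p \<noteq> 0" and sol: "\<forall>c\<in>E. (\<Sum>x\<in>insert y X. c x p * phi x) = 0"
    have X: "\<forall>x\<in>X. phi x = 0" using nz sol c0(1) by (intro q(3)) (auto simp: sum_el simp del: sum.insert)
    moreover have "c0 y p * phi y + (\<Sum>x\<in>X. c0 x p * phi x) = 0"
      using sol c0(1) insert.hyps by (metis sum.insert)
    ultimately show "\<forall>x\<in>insert y X. phi x = 0" using nz by simp
  qed
qed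

text \<open>The unknowns are the finitely many values of \<open>phi\<close> in degree
  \<open>k + 1\<close>. Equal columns lead to the same unknown, so \<open>cf\<close> adds up their
  coefficients.\<close>

lemma nondegenerate_generic:
  fixes A :: "int^'n^'d"
  assumes "nondegenerate A k p0"
  shows "\<exists>q. polynomial_Cn q \<and> q p0 \<noteq> 0 \<and> (\<forall>p. q p \<noteq> 0 \<longrightarrow> nondegenerate A k p)"
proof -
  define X where "X = cmb A ` {u. total_degree u = Suc k}"
  have fX: "finite X" unfolding X_def
    by (intro finite_imageI finite_subset[OF _ finite_total_degree_le[of "Suc k"]]) auto
  define cf where "cf u i = (\<lambda>x (p :: complex^'n). \<Sum>j\<in>UNIV. (if cmb A u + column j A = x then of_int (A $ i $ j) else 0) * p $ j)" for u i
  define E where "E = {cf u i | u i. total_degree u = k}"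
  have sum: "(\<Sum>x\<in>X. cf u i x p * phi x) = (\<Sum>j\<in>UNIV. of_int (A $ i $ j) * p $ j * phi (cmb A u + column j A))"
    if "total_degree u = k" for u i p phi
  proof -
    have X: "cmb A u + column j A \<in> X" for j
      unfolding X_def using that by (intro image_eqI[of _ _ "u + axis j 1"]) (simp_all only: cmb_add_axis, simp)
    have "(\<Sum>x\<in>X. cf u i x p * phi x)
        = (\<Sum>j\<in>UNIV. \<Sum>x\<in>X. if cmb A u + column j A = x then of_int (A $ i $ j) * p $ j * phi x else 0)"
      unfolding cf_def sum_distrib_right by (subst sum.swap) (intro sum.cong refl, auto)
    also have "\<dots> = (\<Sum>j\<in>UNIV. of_int (A $ i $ j) * p $ j * phi (cmb A u + column j A))"
      using X fX by simp
    finally show ?thesis .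
  qed
  have iff: "nondegenerate A k p \<longleftrightarrow> (\<forall>phi. (\<forall>c\<in>E. (\<Sum>x\<in>X. c x p * phi x) = 0) \<longrightarrow> (\<forall>x\<in>X. phi x = 0))" for p
  proof -
    have "(\<forall>c\<in>E. (\<Sum>x\<in>X. c x p * phi x) = 0) \<longleftrightarrow> (\<forall>u i. total_degree u = k \<longrightarrow>
       (\<Sum>j\<in>UNIV. of_int (A $ i $ j) * p $ j * phi (cmb A u + column j A)) = 0)" for phi
      unfolding E_def using sum by fastforce
    then show ?thesis unfolding nondegenerate_def by (simp add: X_def)
  qed
  have "\<exists>q. polynomial_Cn q \<and> q p0 \<noteq> 0 \<and>
    (\<forall>p phi. q p \<noteq> 0 \<longrightarrow> (\<forall>c\<in>E. (\<Sum>x\<in>X. c x p * phi x) = 0) \<longrightarrow> (\<forall>x\<in>X. phi x = 0))"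
  proof (rule generic_trivial_kernel[OF fX])
    show "polynomial_Cn (c x)" if "c \<in> E" for c x
      using that unfolding E_def cf_def by (auto intro!: polynomial_Cn_sum polynomial_Cn.intros)
    show "\<forall>x\<in>X. phi x = 0" if "\<And>c. c \<in> E \<Longrightarrow> (\<Sum>x\<in>X. c x p0 * phi x) = 0" for phi
      using assms that unfolding iff by blast
  qed
  then show ?thesis unfolding iff by blast
qed

section \<open>The semigroup module\<close>

lemma nat_vec_split:
  fixes u :: "nat^'n"
  assumes "q \<le> total_degree u"
  obtains v w where "u = v + w" "total_degree v = q"
proof -
  have "\<exists>v w. u = v + w \<and> total_degree v = q" using assms
  proof (induction u rule: nat_vec_induct)
    case zero
    then show ?case by (intro exI[of _ 0]) simp
  next
    case (add_axis u j)
    show ?case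
    proof (cases "q \<le> total_degree u")
      case True
      then obtain v w where "u = v + w" "total_degree v = q" using add_axis.IH by blast
      then show ?thesis by (intro exI[of _ v] exI[of _ "w + axis j 1"]) (simp add: add.assoc)
    next
      case False
      then have "q = total_degree (u + axis j 1)" using add_axis.prems by simp
      then show ?thesis by (intro exI[of _ "u + axis j 1"] exI[of _ 0]) simp
    qed
  qed
  then show ?thesis using that by blast
qed

lemma single_1_eq_iff: "Poly_Mapping.single a 1 = Poly_Mapping.single b (1 :: complex) \<longleftrightarrow> a = b"
  by (metis lookup_single_eq lookup_single_not_eq zero_neq_one)

lemma independent_monomials:
  "pm.independent ((\<lambda>a. Poly_Mapping.single a 1) ` S)"
  unfolding pm.independent_explicit_finite_subsets
proof (intro allI impI ballI)
  fix T u v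
  assume T: "T \<subseteq> (\<lambda>a. Poly_Mapping.single a 1) ` S" and fin: "finite T"
    and sum: "(\<Sum>v\<in>T. pm_scale (u v) v) = 0" and v: "v \<in> T"
  obtain a where a: "v = Poly_Mapping.single a 1" using T v by blast
  have "0 = (\<Sum>w\<in>T. u w * Poly_Mapping.lookup w a)"
    using arg_cong[OF sum, of "\<lambda>h. Poly_Mapping.lookup h a"] by (simp add: lookup_sum)
  also have "\<dots> = (\<Sum>w\<in>T. if w = v then u v else 0)"
  proof (intro sum.cong refl)
    fix w assume "w \<in> T"
    then obtain b where "w = Poly_Mapping.single b 1" using T by blast
    then show "u w * Poly_Mapping.lookup w a = (if w = v then u v else 0)"
      by (auto simp: a lookup_single when_def single_1_eq_iff)
  qed
  finally show "u v = 0" using fin v by simp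
qed

lemma gkz_symbol_shift:
  "Poly_Mapping.single b 1 * gkz_symbol A p l a = gkz_symbol A p l (a + b)"
  by (simp add: gkz_symbol_def sum_distrib_left mult_single ac_simps)

text \<open>By \<open>l_coordinates\<close> the forms \<open>l j\<close> span all linear forms, so
  that conditions can be transferred between the operators and the rows of \<open>A\<close>, in
  terms of which nondegeneracy is stated.\<close>

locale gkz_module = gkz_operators A p l lb e
  for A :: "int^'n^'d" and p l lb e +
  fixes k :: nat
  assumes nondeg: "nondegenerate A k p"
    and l_coordinates: "\<And>i a. of_int (a $ i) = (\<Sum>j\<in>UNIV. of_int (A $ i $ e j) * l j a)"
begin

abbreviation t :: "int^'d \<Rightarrow> (int^'d \<Rightarrow>\<^sub>0 complex)" where
  "t a \<equiv> Poly_Mapping.single a 1"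

definition N :: "(int^'d \<Rightarrow>\<^sub>0 complex) set" where
  "N = {h. Poly_Mapping.keys h \<subseteq> range (cmb A)}"

definition W :: "(int^'d \<Rightarrow>\<^sub>0 complex) set" where
  "W = (\<lambda>u. t (cmb A u)) ` {u. total_degree u \<le> k}"

definition gen :: "nat \<Rightarrow> (int^'d \<Rightarrow>\<^sub>0 complex) set" where
  "gen m = pm.span {ops.mon g w | g w. total_degree g \<le> m \<and> w \<in> W}"

lemma subspace_N: "pm.subspace N"
proof (rule pm.subspaceI)
  show "0 \<in> N" by (simp add: N_def)
  show "x + y \<in> N" if "x \<in> N" "y \<in> N" for x y
    using that keys_add[of x y] by (auto simp: N_def)
  show "pm_scale c x \<in> N" if "x \<in> N" for c x
    using that by (auto simp: N_def in_keys_iff)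
qed

lemma t_cmb_N: "t (cmb A u) \<in> N"
  by (simp add: N_def)

lemma N_subset_span: "N \<subseteq> pm.span (range (\<lambda>u. t (cmb A u)))"
proof
  fix h assume h: "h \<in> N"
  have "(\<Sum>a \<in> Poly_Mapping.keys h. pm_scale (Poly_Mapping.lookup h a) (t a)) \<in> pm.span (range (\<lambda>u. t (cmb A u)))"
    using h by (intro pm.span_sum pm.span_scale pm.span_base) (auto simp: N_def)
  then show "h \<in> pm.span (range (\<lambda>u. t (cmb A u)))" using pm_decompose_scale[of h] by simp
qed

lemma symbol_N: "gkz_symbol A p f (cmb A u) \<in> N"
proof -
  have "gkz_symbol A p f (cmb A u) = (\<Sum>j\<in>UNIV. pm_scale (f (column j A) * p $ j) (t (cmb A (u + axis j 1))))"
    unfolding cmb_add_axis by (simp add: gkz_symbol_def pm_scale_single)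
  then show ?thesis using subspace_N t_cmb_N by (auto intro!: pm.subspace_sum pm.subspace_scale)
qed

lemma op_N: "h \<in> N \<Longrightarrow> op i h \<in> N"
proof -
  assume h: "h \<in> N"
  have "op i (t a) \<in> N" if a: "a \<in> Poly_Mapping.keys h" for a
  proof -
    obtain u where "a = cmb A u" using h a by (auto simp: N_def)
    then show ?thesis unfolding gkz_op_single_1
      by (simp add: pm.subspace_add[OF subspace_N] pm.subspace_scale[OF subspace_N] t_cmb_N symbol_N)
  qed
  then have "op i (\<Sum>a \<in> Poly_Mapping.keys h. pm_scale (Poly_Mapping.lookup h a) (t a)) \<in> N"
    unfolding gkz_op_sum gkz_op_scale using subspace_N
    by (intro pm.subspace_sum pm.subspace_scale) auto
  then show "op i h \<in> N" using pm_decompose_scale[of h] by simp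
qed

lemma symbol_op: "gkz_symbol A p (l j) a = op j (t a) - pm_scale (l j a - lb j) (t a)"
  by (simp add: gkz_op_single_1)

text \<open>By duality: a functional that kills all these symbols but not the monomial would give a
  \<open>phi\<close> that contradicts \<open>nondegenerate\<close>.\<close>

lemma symbol_relation:
  assumes u: "total_degree u = Suc k"
  shows "\<exists>c. t (cmb A u) = (\<Sum>z \<in> UNIV \<times> {w. total_degree w = k}. pm_scale (c z) (gkz_symbol A p (l (fst z)) (cmb A (snd z))))"
proof -
  let ?I = "(UNIV :: 'd set) \<times> {w :: nat^'n. total_degree w = k}"
  let ?s = "\<lambda>z. gkz_symbol A p (l (fst z)) (cmb A (snd z))"
  have fin: "finite ?I"
    by (intro finite_cartesian_product finite_subset[OF _ finite_total_degree_le[of k]]) auto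
  have "t (cmb A u) \<in> pm.span (?s ` ?I)"
  proof (rule ccontr)
    assume "t (cmb A u) \<notin> pm.span (?s ` ?I)"
    then obtain f where f: "Vector_Spaces.linear pm_scale (*) f" "f (t (cmb A u)) = 1" "\<And>y. y \<in> ?s ` ?I \<Longrightarrow> f y = 0"
      using pm.exists_functional by blast
    interpret f: Vector_Spaces.linear pm_scale "(*)" f by (rule f)
    have fs: "f (gkz_symbol A p g a) = (\<Sum>j\<in>UNIV. g (column j A) * p $ j * f (t (a + column j A)))" for g a
    proof -
      have "gkz_symbol A p g a = (\<Sum>j\<in>UNIV. pm_scale (g (column j A) * p $ j) (t (a + column j A)))"
        by (simp add: gkz_symbol_def pm_scale_single)
      then show ?thesis by (simp add: f.sum f.scale)
    qed
    have "(\<Sum>j\<in>UNIV. of_int (A $ i $ j) * p $ j * f (t (cmb A w + column j A))) = 0" if "total_degree w = k" for w i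
    proof -
      have coord: "of_int (A $ i $ j) = (\<Sum>m\<in>UNIV. of_int (A $ i $ e m) * l m (column j A))" for j
        using l_coordinates[of "column j A" i] by (simp add: column_def)
      have "f (gkz_symbol A p (l m) (cmb A w)) = 0" for m
        by (rule f(3), rule image_eqI[where x = "(m, w)"]) (use \<open>total_degree w = k\<close> in auto)
      then have zero: "(\<Sum>m\<in>UNIV. of_int (A $ i $ e m) * f (gkz_symbol A p (l m) (cmb A w))) = 0" by simp
      have "(\<Sum>j\<in>UNIV. of_int (A $ i $ j) * p $ j * f (t (cmb A w + column j A)))
          = (\<Sum>j\<in>UNIV. \<Sum>m\<in>UNIV. of_int (A $ i $ e m) * (l m (column j A) * p $ j * f (t (cmb A w + column j A))))"
        by (intro sum.cong refl, subst coord) (simp add: sum_distrib_right mult.assoc)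
      also have "\<dots> = (\<Sum>m\<in>UNIV. of_int (A $ i $ e m) * f (gkz_symbol A p (l m) (cmb A w)))"
        by (subst sum.swap) (simp add: fs sum_distrib_left)
      also note zero
      finally show ?thesis .
    qed
    then have "f (t (cmb A u)) = 0"
      by (intro nondeg[unfolded nondegenerate_def, rule_format, of "\<lambda>a. f (t a)"] u)
    then show False using f(2) by simp
  qed
  then obtain c where "t (cmb A u) = (\<Sum>z\<in>?I. pm_scale (c z) (?s z))"
    by (rule pm.span_image_finite[OF fin])
  then show ?thesis by (rule exI[of _ c])
qed

text \<open>Multiplication by a monomial takes symbols to symbols, which fails for the full
  operators. The coefficients do not depend on the shift \<open>v\<close>, and this makes the later
  estimates uniform.\<close>

lemma symbol_relation_shift:
  "\<exists>c. \<forall>u v. total_degree u = Suc k \<longrightarrow> t (cmb A (u + v)) =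
    (\<Sum>z \<in> UNIV \<times> {w. total_degree w = k}. pm_scale (c u z) (gkz_symbol A p (l (fst z)) (cmb A (snd z + v))))"
proof -
  have "\<forall>u. \<exists>c. total_degree u = Suc k \<longrightarrow> t (cmb A u) =
      (\<Sum>z \<in> UNIV \<times> {w. total_degree w = k}. pm_scale (c z) (gkz_symbol A p (l (fst z)) (cmb A (snd z))))"
  proof
    fix u :: "nat^'n"
    show "\<exists>c. total_degree u = Suc k \<longrightarrow> t (cmb A u) =
      (\<Sum>z \<in> UNIV \<times> {w. total_degree w = k}. pm_scale (c z) (gkz_symbol A p (l (fst z)) (cmb A (snd z))))"
    proof (cases "total_degree u = Suc k")
      case True
      from symbol_relation[OF True] show ?thesis by (rule ex_forward) (rule impI)
    qed simp
  qed
  from choice[OF this] obtain c where c: "\<And>u. total_degree u = Suc k \<Longrightarrow> t (cmb A u) =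
      (\<Sum>z \<in> UNIV \<times> {w. total_degree w = k}. pm_scale (c u z) (gkz_symbol A p (l (fst z)) (cmb A (snd z))))"
    by (elim exE) simp
  have "t (cmb A (u + v)) =
    (\<Sum>z \<in> UNIV \<times> {w. total_degree w = k}. pm_scale (c u z) (gkz_symbol A p (l (fst z)) (cmb A (snd z + v))))"
    if "total_degree u = Suc k" for u v
  proof -
    have "t (cmb A (u + v)) = t (cmb A v) * t (cmb A u)" by (simp add: mult_single cmb_add add.commute)
    also have "\<dots> = (\<Sum>z \<in> UNIV \<times> {w. total_degree w = k}. t (cmb A v) * pm_scale (c u z) (gkz_symbol A p (l (fst z)) (cmb A (snd z))))"
      unfolding c[OF that] by (rule sum_distrib_left)
    also have "\<dots> = (\<Sum>z \<in> UNIV \<times> {w. total_degree w = k}. pm_scale (c u z) (gkz_symbol A p (l (fst z)) (cmb A (snd z + v))))"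
      by (simp add: pm_scale_def mult.left_commute[of "t _"] gkz_symbol_shift cmb_add)
    finally show ?thesis .
  qed
  then show ?thesis by blast
qed

section \<open>Degree in the operators against degree in the semigroup\<close>

lemma gen_mono: "m \<le> m' \<Longrightarrow> gen m \<subseteq> gen m'"
  unfolding gen_def by (intro pm.span_mono) (blast intro: order_trans)

lemma op_gen: "h \<in> gen m \<Longrightarrow> op j h \<in> gen (Suc m)"
  unfolding gen_def
proof (induction h rule: pm.span_induct_alt)
  case base
  show ?case using ops.D_scale[of j 0 0] by (simp add: pm.span_zero)
next
  case (step c x y)
  then obtain g w where gw: "x = ops.mon g w" "total_degree g \<le> m" "w \<in> W" by blast
  have "op j x = ops.mon (g + axis j 1) w" by (simp only: gw ops.mon_add_axis)
  then have "op j x \<in> {ops.mon g w | g w. total_degree g \<le> Suc m \<and> w \<in> W}"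
    using gw by (intro CollectI exI[of _ "g + axis j 1"] exI[of _ w]) simp
  then show ?case using step unfolding gkz_op_add gkz_op_scale
    by (intro pm.span_add pm.span_scale) (auto intro: pm.span_base)
qed

text \<open>A symbol is an operator minus a scalar. Beyond degree \<open>k\<close> nondegeneracy
  therefore trades one degree of the monomial for one operator. This is what allows the growth of
  the semigroup to be compared with that of the polynomial ring.\<close>

lemma t_cmb_gen: "t (cmb A u) \<in> gen (total_degree u)"
proof (induction "total_degree u" arbitrary: u rule: less_induct)
  case less
  show ?case
  proof (cases "total_degree u \<le> k")
    case True
    then have "t (cmb A u) \<in> {ops.mon g w | g w. total_degree g \<le> total_degree u \<and> w \<in> W}"
      by (intro CollectI exI[of _ 0] exI[of _ "t (cmb A u)"]) (auto simp: W_def)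
    then show ?thesis unfolding gen_def by (rule pm.span_base)
  next
    case False
    then have "Suc k \<le> total_degree u" by simp
    then obtain v v' where v: "u = v + v'" "total_degree v = Suc k" by (rule nat_vec_split)
    from symbol_relation_shift obtain c where "\<forall>u v. total_degree u = Suc k \<longrightarrow> t (cmb A (u + v)) =
        (\<Sum>z \<in> UNIV \<times> {w. total_degree w = k}. pm_scale (c u z) (gkz_symbol A p (l (fst z)) (cmb A (snd z + v))))" ..
    then have c: "t (cmb A u) = (\<Sum>z \<in> UNIV \<times> {w. total_degree w = k}.
        pm_scale (c v z) (gkz_symbol A p (l (fst z)) (cmb A (snd z + v'))))"
      using v by simp
    have "gkz_symbol A p (l j) (cmb A (w + v')) \<in> gen (total_degree u)" if "total_degree w = k" for j w
    proof -
      have deg: "Suc (total_degree (w + v')) = total_degree u" using v that by simp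
      then have "t (cmb A (w + v')) \<in> gen (total_degree (w + v'))" by (intro less) simp
      then have "op j (t (cmb A (w + v'))) \<in> gen (total_degree u)" "t (cmb A (w + v')) \<in> gen (total_degree u)"
        using op_gen gen_mono[of "total_degree (w + v')" "total_degree u"] deg by (force, force)
      then show ?thesis unfolding symbol_op gen_def by (intro pm.span_diff pm.span_scale)
    qed
    then show ?thesis unfolding c by (auto simp: gen_def intro!: pm.span_sum pm.span_scale)
  qed
qed

lemma finite_W: "finite W"
  unfolding W_def by (intro finite_imageI finite_total_degree_le)

lemma W_N: "W \<subseteq> N"
  using t_cmb_N by (auto simp: W_def)

lemma N_generated:
  assumes "h \<in> N"
  shows "\<exists>q. h = (\<Sum>w\<in>W. ops.act (q w) w)"
proof -
  let ?R = "{h. \<exists>q. h = (\<Sum>w\<in>W. ops.act (q w) w)}"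
  have R: "pm.subspace ?R"
  proof (rule pm.subspaceI)
    show "0 \<in> ?R" by (auto intro!: exI[of _ "\<lambda>_. 0"])
  next
    fix x y assume "x \<in> ?R" "y \<in> ?R"
    then obtain q q' where "x = (\<Sum>w\<in>W. ops.act (q w) w)" "y = (\<Sum>w\<in>W. ops.act (q' w) w)" by blast
    then have "x + y = (\<Sum>w\<in>W. ops.act (q w + q' w) w)" by (simp add: ops.act_add_left sum.distrib)
    then show "x + y \<in> ?R" by (intro CollectI exI[of _ "\<lambda>w. q w + q' w"])
  next
    fix c x assume "x \<in> ?R"
    then obtain q where "x = (\<Sum>w\<in>W. ops.act (q w) w)" by blast
    then have "pm_scale c x = (\<Sum>w\<in>W. ops.act (Poly_Mapping.single 0 c * q w) w)"
      by (simp add: ops.act_mult ops.act_single pm.scale_sum_right)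
    then show "pm_scale c x \<in> ?R" by (intro CollectI exI[of _ "\<lambda>w. Poly_Mapping.single 0 c * q w"])
  qed
  have "ops.mon g w \<in> ?R" if w: "w \<in> W" for g w
  proof -
    have "(\<Sum>w'\<in>W. ops.act (if w' = w then Poly_Mapping.single g 1 else 0) w') = (\<Sum>w'\<in>W. if w' = w then ops.mon g w else 0)"
      by (intro sum.cong refl) (simp add: ops.act_single)
    then show ?thesis using w finite_W by (intro CollectI exI[of _ "\<lambda>w'. if w' = w then Poly_Mapping.single g 1 else 0"]) simp
  qed
  then have "gen m \<subseteq> ?R" for m
    unfolding gen_def using R by (intro pm.span_minimal) auto
  then have "range (\<lambda>u. t (cmb A u)) \<subseteq> ?R" using t_cmb_gen by blast
  then have "pm.span (range (\<lambda>u. t (cmb A u))) \<subseteq> ?R" using R by (intro pm.span_minimal)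
  then show ?thesis using N_subset_span assms by blast
qed

section \<open>Functionals on the fibre at the origin\<close>

definition boundary :: "(int^'d \<Rightarrow>\<^sub>0 complex) set" where
  "boundary = (\<Union>j. op j ` N)"

lemma N_subset_W_boundary: "N \<subseteq> pm.span (W \<union> boundary)"
proof
  fix h assume "h \<in> N"
  then obtain q where q: "h = (\<Sum>w\<in>W. ops.act (q w) w)" using N_generated by blast
  have "ops.mon g w \<in> pm.span (W \<union> boundary)" if w: "w \<in> W" for g w
  proof (cases "g = 0")
    case True
    then show ?thesis using w by (auto intro: pm.span_base)
  next
    case False
    then obtain j where "g $ j > 0" by (metis gr0I vec_eq_iff zero_index)
    then obtain g' where "g = g' + axis j 1" by (rule nat_vec_decompose)
    then have "ops.mon g w = op j (ops.mon g' w)" by (simp only: ops.mon_add_axis)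
    moreover have "ops.mon g' w \<in> N" using w W_N op_N by (intro ops.mon_closed[where N = N]) auto
    ultimately show ?thesis by (intro pm.span_base) (auto simp: boundary_def)
  qed
  then show "h \<in> pm.span (W \<union> boundary)"
    unfolding q ops.act_def by (intro pm.span_sum pm.span_scale) auto
qed

lemma span_boundary: "pm.span boundary \<subseteq> {\<Sum>j\<in>UNIV. op j (u j) | u. \<forall>j. u j \<in> N}"
proof (rule pm.span_minimal)
  let ?R = "{\<Sum>j\<in>UNIV. op j (u j) | u. \<forall>j. u j \<in> N}"
  have op0: "op j 0 = 0" for j using ops.D_scale[of j 0 0] by simp
  show "boundary \<subseteq> ?R"
  proof
    fix x assume "x \<in> boundary"
    then obtain j h where jh: "x = op j h" "h \<in> N" by (auto simp: boundary_def)
    have "(\<Sum>i\<in>UNIV. op i (if i = j then h else 0)) = (\<Sum>i\<in>UNIV. if i = j then op j h else 0)"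
      by (intro sum.cong refl) (simp add: op0)
    then show "x \<in> ?R" using jh pm.subspace_0[OF subspace_N]
      by (intro CollectI exI[of _ "\<lambda>i. if i = j then h else 0"]) auto
  qed
  show "pm.subspace ?R"
  proof (rule pm.subspaceI)
    show "0 \<in> ?R" using pm.subspace_0[OF subspace_N] by (intro CollectI exI[of _ "\<lambda>i. 0"]) (auto simp: op0)
  next
    fix x y assume "x \<in> ?R" "y \<in> ?R"
    then obtain u u' where u: "x = (\<Sum>j\<in>UNIV. op j (u j))" "y = (\<Sum>j\<in>UNIV. op j (u' j))" "\<forall>j. u j \<in> N" "\<forall>j. u' j \<in> N" by blast
    then have "x + y = (\<Sum>j\<in>UNIV. op j (u j + u' j))" by (simp add: gkz_op_add sum.distrib)
    then show "x + y \<in> ?R" using u pm.subspace_add[OF subspace_N] by (intro CollectI exI[of _ "\<lambda>j. u j + u' j"]) auto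
  next
    fix c x assume "x \<in> ?R"
    then obtain u where u: "x = (\<Sum>j\<in>UNIV. op j (u j))" "\<forall>j. u j \<in> N" by blast
    then have "pm_scale c x = (\<Sum>j\<in>UNIV. op j (pm_scale c (u j)))" by (simp add: gkz_op_scale pm.scale_sum_right)
    then show "pm_scale c x \<in> ?R" using u pm.subspace_scale[OF subspace_N] by (intro CollectI exI[of _ "\<lambda>j. pm_scale c (u j)"]) auto
  qed
qed

text \<open>A functional that kills the images of the operators takes the symbol of
  \<open>l j\<close> at \<open>a\<close> to \<open>lb j - l j a\<close> times its value at the
  monomial of \<open>a\<close>, and this scalar is linear in the degree. Descending one degree at a
  time multiplies such scalars, whence the factorial.\<close>

lemma functional_growth:
  assumes f: "Vector_Spaces.linear pm_scale (*) f" and f0: "\<And>j h. h \<in> N \<Longrightarrow> f (op j h) = 0"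
  shows "\<exists>C R. C \<ge> 0 \<and> R \<ge> 1 \<and> (\<forall>u. norm (f (t (cmb A u))) \<le> C * R ^ total_degree u * fact (total_degree u))"
proof -
  interpret f: Vector_Spaces.linear pm_scale "(*)" f by (rule f)
  from symbol_relation_shift obtain c where "\<forall>u v. total_degree u = Suc k \<longrightarrow> t (cmb A (u + v)) =
    (\<Sum>z \<in> UNIV \<times> {w. total_degree w = k}. pm_scale (c u z) (gkz_symbol A p (l (fst z)) (cmb A (snd z + v))))" ..
  then have c: "t (cmb A (u + v)) =
    (\<Sum>z \<in> UNIV \<times> {w. total_degree w = k}. pm_scale (c u z) (gkz_symbol A p (l (fst z)) (cmb A (snd z + v))))"
    if "total_degree u = Suc k" for u v using that by simp
  let ?I = "(UNIV :: 'd set) \<times> {w :: nat^'n. total_degree w = k}"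
  have fin: "finite {u :: nat^'n. total_degree u = m}" for m
    by (rule finite_subset[OF _ finite_total_degree_le[of m]]) auto
  define K where "K = (\<Sum>u | total_degree u = Suc k. \<Sum>z\<in>?I. norm (c u z))"
  have K: "(\<Sum>z\<in>?I. norm (c u z)) \<le> K" if "total_degree u = Suc k" for u
    unfolding K_def using that fin
    by (intro member_le_sum[of u _ "\<lambda>u. \<Sum>z\<in>?I. norm (c u z)"]) (auto simp: sum_nonneg)
  define L where "L = (\<Sum>j\<in>UNIV. \<Sum>i\<in>UNIV. norm (l j (column i A))) + (\<Sum>j\<in>UNIV. norm (lb j))"
  have L0: "L \<ge> 0" by (simp add: L_def sum_nonneg)
  have Lcol: "norm (l j (column i A)) \<le> L" for j i
  proof -
    have "norm (l j (column i A)) \<le> (\<Sum>i\<in>UNIV. norm (l j (column i A)))" by (rule member_le_sum) auto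
    also have "\<dots> \<le> (\<Sum>j\<in>UNIV. \<Sum>i\<in>UNIV. norm (l j (column i A)))"
      by (rule member_le_sum[of j UNIV "\<lambda>j. \<Sum>i\<in>UNIV. norm (l j (column i A))"]) (auto simp: sum_nonneg)
    also have "\<dots> \<le> L" by (simp add: L_def sum_nonneg)
    finally show ?thesis .
  qed
  have Llb: "norm (lb j) \<le> L" for j
  proof -
    have "norm (lb j) \<le> (\<Sum>j\<in>UNIV. norm (lb j))" by (rule member_le_sum) auto
    also have "\<dots> \<le> L" by (simp add: L_def sum_nonneg)
    finally show ?thesis .
  qed
  have Lcmb: "norm (l j (cmb A u)) \<le> L * real (total_degree u)" for j u
  proof (induction u rule: nat_vec_induct)
    case zero
    show ?case using l_add[of j 0 0] by simp
  next
    case (add_axis u i)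
    have "norm (l j (cmb A (u + axis i 1))) \<le> norm (l j (cmb A u)) + norm (l j (column i A))"
      unfolding cmb_add_axis l_add by (rule norm_triangle_ineq)
    also have "\<dots> \<le> L * real (total_degree u) + L" using add_axis Lcol by (intro add_mono)
    also have "\<dots> = L * real (total_degree (u + axis i 1))" by (simp add: algebra_simps)
    finally show ?case .
  qed
  \<comment> \<open>\<open>K\<close> bounds the coefficient sums and \<open>L * (m + 1)\<close> the
    scalar in degree \<open>m\<close>, so one descent costs at most
    \<open>R * (m + 1)\<close>.\<close>
  define R where "R = max 1 (K * L)"
  define C where "C = (\<Sum>u | total_degree u \<le> k. norm (f (t (cmb A u))))"
  have C0: "C \<ge> 0" by (simp add: C_def sum_nonneg)
  have R1: "R \<ge> 1" by (simp add: R_def)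
  have "norm (f (t (cmb A u))) \<le> C * R ^ total_degree u * fact (total_degree u)" for u
  proof (induction "total_degree u" arbitrary: u rule: less_induct)
    case less
    show ?case
    proof (cases "total_degree u \<le> k")
      case True
      then have "norm (f (t (cmb A u))) \<le> C"
        unfolding C_def by (intro member_le_sum[of u _ "\<lambda>u. norm (f (t (cmb A u)))"]) (auto intro: finite_total_degree_le)
      also have "\<dots> \<le> C * (R ^ total_degree u * fact (total_degree u))"
        using mult_left_mono[OF mult_mono[OF one_le_power[OF R1, of "total_degree u"] fact_ge_1[of "total_degree u"]] C0] R1
        by simp
      finally show ?thesis by (simp add: mult.assoc)
    next
      case False
      define m where "m = total_degree u - 1"
      have m: "total_degree u = Suc m" using False by (simp add: m_def)
      have "Suc k \<le> total_degree u" using False by simp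
      then obtain v v' where v: "u = v + v'" "total_degree v = Suc k" by (rule nat_vec_split)
      have step: "norm (f (gkz_symbol A p (l j) (cmb A (w + v')))) \<le> (L * (real m + 1)) * (C * R ^ m * fact m)"
        if "total_degree w = k" for j w
      proof -
        have deg: "total_degree (w + v') = m" using v that m by simp
        have "f (gkz_symbol A p (l j) (cmb A (w + v'))) = - (l j (cmb A (w + v')) - lb j) * f (t (cmb A (w + v')))"
          unfolding symbol_op using f0[OF t_cmb_N] by (simp add: f.diff f.scale left_diff_distrib)
        then have "norm (f (gkz_symbol A p (l j) (cmb A (w + v')))) = norm (l j (cmb A (w + v')) - lb j) * norm (f (t (cmb A (w + v'))))"
          by (simp add: norm_mult norm_minus_commute)
        also have "\<dots> \<le> (L * (real m + 1)) * (C * R ^ m * fact m)"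
        proof (rule mult_mono)
          have "norm (l j (cmb A (w + v')) - lb j) \<le> norm (l j (cmb A (w + v'))) + norm (lb j)" by (rule norm_triangle_ineq4)
          also have "\<dots> \<le> L * real m + L" using Lcmb[of j "w + v'"] Llb[of j] deg by (intro add_mono) auto
          finally show "norm (l j (cmb A (w + v')) - lb j) \<le> L * (real m + 1)" by (simp add: algebra_simps)
          show "norm (f (t (cmb A (w + v')))) \<le> C * R ^ m * fact m" using less[of "w + v'"] deg m by simp
        qed (use L0 in auto)
        finally show ?thesis .
      qed
      have "norm (f (t (cmb A u))) = norm (\<Sum>z\<in>?I. c v z * f (gkz_symbol A p (l (fst z)) (cmb A (snd z + v'))))"
        unfolding v(1) c[OF v(2)] by (simp add: f.sum f.scale)
      also have "\<dots> \<le> (\<Sum>z\<in>?I. norm (c v z) * ((L * (real m + 1)) * (C * R ^ m * fact m)))"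
        by (rule sum_norm_le) (use step in \<open>auto simp: norm_mult intro!: mult_left_mono\<close>)
      also have "\<dots> = (\<Sum>z\<in>?I. norm (c v z)) * ((L * (real m + 1)) * (C * R ^ m * fact m))"
        by (rule sum_distrib_right[symmetric])
      also have "\<dots> \<le> K * ((L * (real m + 1)) * (C * R ^ m * fact m))"
        using K[OF v(2)] L0 C0 R1 by (intro mult_right_mono) auto
      also have "\<dots> = (K * L) * ((real m + 1) * (C * R ^ m * fact m))" by (simp add: ac_simps)
      also have "\<dots> \<le> R * ((real m + 1) * (C * R ^ m * fact m))"
        using C0 R1 by (intro mult_right_mono) (auto simp: R_def)
      also have "\<dots> = C * R ^ total_degree u * fact (total_degree u)" by (simp add: m ac_simps)
      finally show ?thesis .
    qed
  qed
  then show ?thesis using C0 R1 by blast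
qed

text \<open>A subset \<open>G\<close> of \<open>W\<close> of least size that spans \<open>N\<close>
  modulo the images of the operators represents a basis of the fibre, and its dual functionals are
  those sought. Since \<open>G\<close> consists of monomials, their independence shows in the values
  at monomials. The growth is measured on the monomials of bounded degree.\<close>

theorem exists_functionals:
  assumes torsion: "\<And>q h. ops.act q h = 0 \<Longrightarrow> q = 0 \<or> h = 0"
    and n: "x \<noteq> y" "op x n \<in> N" "op y n \<in> N" "\<And>s. Poly_Mapping.lookup s 0 \<noteq> 0 \<Longrightarrow> ops.act s n \<notin> N"
  shows "\<exists>m c (f :: nat \<Rightarrow> (int^'d \<Rightarrow>\<^sub>0 complex) \<Rightarrow> complex).
    (\<forall>m'. card (cmb A ` {u. total_degree u \<le> m'}) \<le> m * card {g :: nat^'d. total_degree g \<le> m' + c}) \<and>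
    (\<forall>q<Suc m. Vector_Spaces.linear pm_scale (*) (f q) \<and> (\<forall>j. \<forall>h\<in>N. f q (op j h) = 0)) \<and>
    (\<forall>c. (\<forall>u. (\<Sum>q<Suc m. c q * f q (t (cmb A u))) = 0) \<longrightarrow> (\<forall>q<Suc m. c q = 0))"
proof -
  define P where "P G \<longleftrightarrow> G \<subseteq> W \<and> N \<subseteq> pm.span (G \<union> boundary)" for G
  have "P W" using N_subset_W_boundary by (simp add: P_def)
  then obtain G where G: "P G" and min: "\<And>G'. P G' \<Longrightarrow> card G \<le> card G'"
    using ex_has_least_nat[of P W card] by blast
  have fG: "finite G" using G finite_W by (auto simp: P_def intro: finite_subset)
  have GN: "G \<subseteq> N" using G W_N by (auto simp: P_def)
  have repr: "\<exists>c u. (\<forall>i. u i \<in> N) \<and> h = (\<Sum>g\<in>G. pm_scale (c g) g) + (\<Sum>i\<in>UNIV. op i (u i))" if "h \<in> N" for h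
  proof -
    have "h \<in> pm.span (G \<union> boundary)" using G that by (auto simp: P_def)
    then obtain h1 h2 where h: "h = h1 + h2" "h1 \<in> pm.span G" "h2 \<in> pm.span boundary"
      unfolding pm.span_Un by blast
    obtain c where "h1 = (\<Sum>g\<in>G. pm_scale (c g) g)"
      using pm.span_image_finite[OF fG, of h1 "\<lambda>g. g"] h(2) by auto
    moreover obtain u where "h2 = (\<Sum>i\<in>UNIV. op i (u i))" "\<forall>i. u i \<in> N"
      using span_boundary h(3) by blast
    ultimately show ?thesis using h(1) by blast
  qed
  let ?X = "\<lambda>m. t ` cmb A ` {u. total_degree u \<le> m}"
  have "\<exists>m c. card G = Suc m \<and> (\<forall>k. card (?X k) \<le> m * card {g :: nat^'d. total_degree g \<le> k + c})"
  proof (rule ops.fiber_bound[OF subspace_N op_N torsion finite_W W_N N_generated independent_monomials _ fG GN repr n])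
    fix m
    have "t (cmb A u) \<in> gen m" if "total_degree u \<le> m" for u
      using t_cmb_gen[of u] gen_mono[OF that] by blast
    then show "?X m \<subseteq> pm.span {ops.mon g w | g w. total_degree g \<le> m \<and> w \<in> W}" by (auto simp: gen_def)
  qed auto
  then obtain m c where m: "card G = Suc m" and bound: "\<And>k. card (?X k) \<le> m * card {g :: nat^'d. total_degree g \<le> k + c}"
    by blast
  have "inj t" by (rule injI) (simp add: single_1_eq_iff)
  then have card: "card (?X k) = card (cmb A ` {u. total_degree u \<le> k})" for k
    by (simp add: card_image inj_on_subset)
  have "\<forall>g\<in>G. \<exists>f. Vector_Spaces.linear pm_scale (*) f \<and> (\<forall>j. \<forall>h\<in>N. f (op j h) = 0) \<and> f g = 1 \<and> (\<forall>g'\<in>G - {g}. f g' = 0)"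
  proof
    fix g assume g: "g \<in> G"
    have "g \<notin> pm.span ((G - {g}) \<union> boundary)"
    proof
      assume "g \<in> pm.span ((G - {g}) \<union> boundary)"
      then have "pm.span (insert g ((G - {g}) \<union> boundary)) = pm.span ((G - {g}) \<union> boundary)"
        by (rule pm.span_redundant)
      moreover have "insert g ((G - {g}) \<union> boundary) = G \<union> boundary" using g by blast
      ultimately have "P (G - {g})" using G by (auto simp: P_def)
      then have "card G \<le> card (G - {g})" by (rule min)
      then show False using g fG by (metis card_Diff1_less not_le)
    qed
    then obtain f where f: "Vector_Spaces.linear pm_scale (*) f" "f g = 1" "\<And>y. y \<in> (G - {g}) \<union> boundary \<Longrightarrow> f y = 0"
      using pm.exists_functional by blast
    then show "\<exists>f. Vector_Spaces.linear pm_scale (*) f \<and> (\<forall>j. \<forall>h\<in>N. f (op j h) = 0) \<and> f g = 1 \<and> (\<forall>g'\<in>G - {g}. f g' = 0)"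
      by (intro exI[of _ f]) (auto simp: boundary_def)
  qed
  from bchoice[OF this] obtain F where
    "\<forall>g\<in>G. Vector_Spaces.linear pm_scale (*) (F g) \<and> (\<forall>j. \<forall>h\<in>N. F g (op j h) = 0) \<and> F g g = 1 \<and> (\<forall>g'\<in>G - {g}. F g g' = 0)" ..
  then have F: "\<And>g. g \<in> G \<Longrightarrow> Vector_Spaces.linear pm_scale (*) (F g)"
    "\<And>g j h. g \<in> G \<Longrightarrow> h \<in> N \<Longrightarrow> F g (op j h) = 0" "\<And>g. g \<in> G \<Longrightarrow> F g g = 1"
    "\<And>g g'. g \<in> G \<Longrightarrow> g' \<in> G \<Longrightarrow> g' \<noteq> g \<Longrightarrow> F g g' = 0"
    by auto
  obtain b where b: "bij_betw b {..<Suc m} G"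
    using ex_bij_betw_nat_finite[OF fG] by (auto simp: m atLeast0LessThan)
  have bG: "b q \<in> G" if "q < Suc m" for q using b that by (auto simp: bij_betw_def)
  have indep: "c q = 0" if c: "\<And>u. (\<Sum>q<Suc m. c q * F (b q) (t (cmb A u))) = 0" and q: "q < Suc m" for c q
  proof -
    obtain u where u: "b q = t (cmb A u)" using bG[OF q] G by (auto simp: P_def W_def)
    have "(\<Sum>q'<Suc m. c q' * F (b q') (t (cmb A u))) = (\<Sum>q'<Suc m. if q' = q then c q else 0)"
    proof (intro sum.cong refl)
      fix q' assume "q' \<in> {..<Suc m}"
      then show "c q' * F (b q') (t (cmb A u)) = (if q' = q then c q else 0)"
        using F(3)[OF bG[OF q]] F(4)[OF bG bG[OF q], of q'] b q
        by (auto simp: u[symmetric] bij_betw_def inj_on_def)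
    qed
    then show ?thesis using c[of u] q by (simp split: if_splits)
  qed
  have "\<forall>m'. card (cmb A ` {u. total_degree u \<le> m'}) \<le> m * card {g :: nat^'d. total_degree g \<le> m' + c}"
    using bound unfolding card by blast
  moreover have "\<forall>q<Suc m. Vector_Spaces.linear pm_scale (*) (F (b q)) \<and> (\<forall>j. \<forall>h\<in>N. F (b q) (op j h) = 0)"
    using F(1,2) bG by simp
  moreover have "\<forall>c. (\<forall>u. (\<Sum>q<Suc m. c q * F (b q) (t (cmb A u))) = 0) \<longrightarrow> (\<forall>q<Suc m. c q = 0)"
    using indep by blast
  ultimately show ?thesis
    by (intro exI[of _ m] exI[of _ c] exI[of _ "\<lambda>q. F (b q)"] conjI)
qed

end

section \<open>Lattice points and the normalized volume\<close>

lemma convex_hull_range_coeffs: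
  fixes f :: "'n::finite \<Rightarrow> 'a::real_vector"
  assumes "y \<in> convex hull (range f)"
  obtains c where "\<And>j. c j \<ge> 0" "(\<Sum>j\<in>UNIV. c j) = 1" "y = (\<Sum>j\<in>UNIV. c j *\<^sub>R f j)"
proof -
  let ?S = "{\<Sum>j\<in>UNIV. c j *\<^sub>R f j | c. (\<forall>j. c j \<ge> 0) \<and> (\<Sum>j\<in>UNIV. c j) = (1::real)}"
  have "convex hull (range f) \<subseteq> ?S"
  proof (rule hull_minimal)
    show "range f \<subseteq> ?S"
    proof clarify
      fix i
      have "f i = (\<Sum>j\<in>UNIV. (if j = i then 1 else 0) *\<^sub>R f j)"
        by (simp add: if_distrib[where f = "\<lambda>c. c *\<^sub>R _"] cong: if_cong)
      then show "\<exists>c. f i = (\<Sum>j\<in>UNIV. c j *\<^sub>R f j) \<and> (\<forall>j. c j \<ge> 0) \<and> (\<Sum>j\<in>UNIV. c j) = (1::real)"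
        by (intro exI[of _ "\<lambda>j. if j = i then 1 else 0"]) auto
    qed
    show "convex ?S"
    proof (rule convexI, clarify)
      fix c c' :: "'n \<Rightarrow> real" and u v :: real
      assume *: "0 \<le> u" "0 \<le> v" "u + v = 1" "\<forall>j. 0 \<le> c j" "(\<Sum>j\<in>UNIV. c j) = 1" "\<forall>j. 0 \<le> c' j" "(\<Sum>j\<in>UNIV. c' j) = 1"
      show "\<exists>d. u *\<^sub>R (\<Sum>j\<in>UNIV. c j *\<^sub>R f j) + v *\<^sub>R (\<Sum>j\<in>UNIV. c' j *\<^sub>R f j) = (\<Sum>j\<in>UNIV. d j *\<^sub>R f j)
          \<and> (\<forall>j. d j \<ge> 0) \<and> (\<Sum>j\<in>UNIV. d j) = 1"
        using * by (intro exI[of _ "\<lambda>j. u * c j + v * c' j"])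
          (simp add: scaleR_sum_right scaleR_left_distrib sum.distrib sum_distrib_left[symmetric])
    qed
  qed
  then show ?thesis using assms that by blast
qed

text \<open>Rounding the points of the dilated polytope gives lattice points which, after a shift that does
  not depend on the dilation, lie in the semigroup.  The points with a given rounding form a unit
  cube.\<close>

lemma polytope_measure_le_card:
  fixes A :: "int^'n^'d"
  assumes row: "\<And>j. A $ r $ j = 1" and lattice: "range (\<lambda>u. A *v u) = UNIV"
  defines "V \<equiv> measure (\<Pi>\<^sub>M i\<in>UNIV - {r}. (lborel :: real measure))
       ((\<lambda>p. restrict (vec_nth p) (UNIV - {r})) ` (convex hull (range (\<lambda>j. column j (map_matrix real_of_int A)))))"
  shows "\<exists>c. \<forall>k>0. V * real k ^ (CARD('d) - 1) \<le> real (card (cmb A ` {u. total_degree u = k + c}))"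
proof -
  let ?H = "convex hull (range (\<lambda>j. column j (map_matrix real_of_int A)))"
  let ?I = "UNIV - {r}"
  define b where "b = (\<Sum>i\<in>UNIV. \<Sum>j\<in>UNIV. \<bar>A $ i $ j\<bar>) + 1"
  define Bx where "Bx = {z :: int^'d. \<forall>i. \<bar>z $ i\<bar> \<le> b}"
  have "finite Bx"
  proof (rule finite_subset)
    show "Bx \<subseteq> vec_lambda ` (Pi\<^sub>E UNIV (\<lambda>_. {- b..b}))"
    proof
      fix z assume "z \<in> Bx"
      then have "vec_nth z \<in> Pi\<^sub>E UNIV (\<lambda>_. {- b..b})" by (auto simp: Bx_def abs_le_iff minus_le_iff)
      then show "z \<in> vec_lambda ` (Pi\<^sub>E UNIV (\<lambda>_. {- b..b}))" by (metis image_eqI vec_nth_inverse)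
    qed
    show "finite (vec_lambda ` (Pi\<^sub>E (UNIV :: 'd set) (\<lambda>_. {- b..b})))" by (intro finite_imageI finite_PiE) auto
  qed
  \<comment> \<open>A fixed preimage of every lattice point. Over the finite box \<open>Bx\<close>
    of rounding errors its entries are bounded by \<open>M\<close>, the shift that makes all
    exponents nonnegative.\<close>
  obtain s where s: "\<And>z. A *v s z = z" using lattice by (metis UNIV_I f_inv_into_f)
  define M where "M = (\<Sum>z\<in>Bx. \<Sum>j\<in>UNIV. nat \<bar>s z $ j\<bar>)"
  have M: "\<bar>s z $ j\<bar> \<le> int M" if "z \<in> Bx" for z j
  proof -
    have "nat \<bar>s z $ j\<bar> \<le> (\<Sum>j\<in>UNIV. nat \<bar>s z $ j\<bar>)" by (rule member_le_sum) auto
    also have "\<dots> \<le> M" unfolding M_def using that \<open>finite Bx\<close>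
      by (intro member_le_sum[of z Bx "\<lambda>z. \<Sum>j\<in>UNIV. nat \<bar>s z $ j\<bar>"]) auto
    finally show ?thesis by linarith
  qed
  define c where "c = CARD('n) * M"
  define sh where "sh = cmb A (\<chi> j. M)"
  have "V * real k ^ (CARD('d) - 1) \<le> real (card (cmb A ` {u. total_degree u = k + c}))" if k: "k > 0" for k
  proof -
    define fl :: "real^'d \<Rightarrow> int^'d" where "fl y = (\<chi> i. \<lfloor>real k * y $ i\<rfloor>)" for y
    have mem: "fl y + sh \<in> cmb A ` {u. total_degree u = k + c}" if y: "y \<in> ?H" for y
    proof -
      obtain a where a: "\<And>j. a j \<ge> 0" "(\<Sum>j\<in>UNIV. a j) = 1" "y = (\<Sum>j\<in>UNIV. a j *\<^sub>R column j (map_matrix real_of_int A))"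
        using convex_hull_range_coeffs[OF y] by blast
      have yi: "y $ i = (\<Sum>j\<in>UNIV. a j * of_int (A $ i $ j))" for i
        by (simp add: a(3) column_def map_matrix_def)
      define m where "m j = \<lfloor>real k * a j\<rfloor>" for j
      have m0: "m j \<ge> 0" for j using a(1) by (simp add: m_def)
      \<comment> \<open>The difference between the rounded point and the combination of the columns
        with rounded coefficients. It stays in \<open>Bx\<close> whatever \<open>k\<close> is, since
        each floor moves its argument by less than 1.\<close>
      define w :: "int^'d" where "w = (\<chi> i. fl y $ i - (\<Sum>j\<in>UNIV. A $ i $ j * m j))"
      have "w \<in> Bx"
        unfolding Bx_def
      proof (intro CollectI allI)
        fix i
        have "of_int (w $ i) = (of_int \<lfloor>real k * y $ i\<rfloor> - real k * y $ i) + (\<Sum>j\<in>UNIV. of_int (A $ i $ j) * (real k * a j - of_int (m j)))"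
          by (simp add: w_def fl_def yi sum_distrib_left right_diff_distrib sum_subtractf ac_simps)
        then have "\<bar>real_of_int (w $ i)\<bar> \<le> \<bar>of_int \<lfloor>real k * y $ i\<rfloor> - real k * y $ i\<bar> + \<bar>\<Sum>j\<in>UNIV. of_int (A $ i $ j) * (real k * a j - of_int (m j))\<bar>"
          by (simp only: abs_triangle_ineq)
        also have "\<bar>of_int \<lfloor>real k * y $ i\<rfloor> - real k * y $ i\<bar> \<le> 1"
          by linarith
        also have "\<bar>\<Sum>j\<in>UNIV. of_int (A $ i $ j) * (real k * a j - of_int (m j))\<bar> \<le> (\<Sum>j\<in>UNIV. \<bar>of_int (A $ i $ j) * (real k * a j - of_int (m j))\<bar>)"
          by (rule sum_abs)
        also have "\<dots> \<le> (\<Sum>j\<in>UNIV. of_int \<bar>A $ i $ j\<bar>)"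
        proof (rule sum_mono)
          fix j
          have "\<bar>real k * a j - of_int (m j)\<bar> \<le> 1" unfolding m_def by linarith
          then show "\<bar>of_int (A $ i $ j) * (real k * a j - of_int (m j))\<bar> \<le> of_int \<bar>A $ i $ j\<bar>"
            by (simp add: abs_mult mult_left_le)
        qed
        also have "(\<Sum>j\<in>UNIV. real_of_int \<bar>A $ i $ j\<bar>) \<le> of_int (\<Sum>i\<in>UNIV. \<Sum>j\<in>UNIV. \<bar>A $ i $ j\<bar>)"
          unfolding of_int_sum by (rule member_le_sum[of i UNIV "\<lambda>i. \<Sum>j\<in>UNIV. real_of_int \<bar>A $ i $ j\<bar>"]) (auto simp: sum_nonneg)
        finally show "\<bar>w $ i\<bar> \<le> b" unfolding b_def by linarith
      qed
      define u :: "nat^'n" where "u = (\<chi> j. nat (m j + s w $ j + int M))"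
      have u: "int (u $ j) = m j + s w $ j + int M" for j
        using M[OF \<open>w \<in> Bx\<close>, of j] m0[of j] by (simp add: u_def)
      have sw: "(\<Sum>j\<in>UNIV. A $ i $ j * s w $ j) = w $ i" for i
        using s[of w] by (auto simp: vec_eq_iff matrix_vector_mult_def)
      have eq: "cmb A u = fl y + sh"
        by (simp add: vec_eq_iff cmb_def sh_def u distrib_left sum.distrib sw) (simp add: w_def)
      have "y $ r = 1" using a(2) row by (simp add: yi)
      then have "fl y $ r = int k" by (simp add: fl_def)
      moreover have "sh $ r = int c" using row by (simp add: sh_def cmb_nth_degree[OF row] c_def total_degree_def)
      ultimately have "total_degree u = k + c"
        using cmb_nth_degree[OF row, of u] eq by simp
      then show ?thesis using eq by (metis (mono_tags) image_eqI mem_Collect_eq)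
    qed
    have finC: "finite (cmb A ` {u. total_degree u = k + c})"
      by (intro finite_imageI finite_subset[OF _ finite_total_degree_le[of "k + c"]]) auto
    have inj: "inj_on (\<lambda>z. z + sh) (fl ` ?H)" by simp
    have sub: "(\<lambda>z. z + sh) ` fl ` ?H \<subseteq> cmb A ` {u. total_degree u = k + c}" using mem by blast
    have finZ: "finite (fl ` ?H)" using finite_imageD[OF finite_subset[OF sub finC] inj] .
    have cardZ: "card (fl ` ?H) \<le> card (cmb A ` {u. total_degree u = k + c})"
      using card_inj_on_le[OF inj sub finC] .
    define box where "box z = (\<Pi>\<^sub>E i\<in>?I. {of_int (z $ i) / real k ..< (of_int (z $ i) + 1) / real k})" for z :: "int^'d"
    interpret P: product_sigma_finite "\<lambda>_. lborel :: real measure" ..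
    have box: "emeasure (\<Pi>\<^sub>M i\<in>?I. (lborel :: real measure)) (box z) = ennreal ((1 / real k) ^ (CARD('d) - 1))" for z
    proof -
      have "emeasure (\<Pi>\<^sub>M i\<in>?I. (lborel :: real measure)) (box z)
          = (\<Prod>i\<in>?I. emeasure lborel {of_int (z $ i) / real k ..< (of_int (z $ i) + 1) / real k})"
        unfolding box_def by (rule P.emeasure_PiM) auto
      also have "\<dots> = (\<Prod>i\<in>?I. ennreal (1 / real k))"
        using k by (intro prod.cong refl) (simp add: divide_right_mono diff_divide_distrib[symmetric])
      also have "\<dots> = ennreal ((1 / real k) ^ (CARD('d) - 1))"
        by (simp add: card_Diff_singleton ennreal_power)
      finally show ?thesis .
    qed
    have meas: "box z \<in> sets (\<Pi>\<^sub>M i\<in>?I. (lborel :: real measure))" for z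
      unfolding box_def by (intro sets_PiM_I_finite) auto
    have cover: "(\<lambda>p. restrict (vec_nth p) ?I) ` ?H \<subseteq> (\<Union>z\<in>fl ` ?H. box z)"
    proof clarify
      fix y assume y: "y \<in> ?H"
      have "of_int \<lfloor>real k * y $ i\<rfloor> / real k \<le> y $ i" "y $ i < (of_int \<lfloor>real k * y $ i\<rfloor> + 1) / real k" for i
        using k floor_correct[of "real k * y $ i"] by (auto simp: field_simps)
      then have "restrict (vec_nth y) ?I \<in> box (fl y)" by (auto simp: box_def fl_def)
      then show "restrict (vec_nth y) ?I \<in> (\<Union>z\<in>fl ` ?H. box z)" using y by blast
    qed
    \<comment> \<open>Monotonicity asks for measurability of the larger set, here a finite union of
      boxes.\<close>
    have "emeasure (\<Pi>\<^sub>M i\<in>?I. (lborel :: real measure)) ((\<lambda>p. restrict (vec_nth p) ?I) ` ?H)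
        \<le> emeasure (\<Pi>\<^sub>M i\<in>?I. (lborel :: real measure)) (\<Union>z\<in>fl ` ?H. box z)"
      using cover meas finZ by (intro emeasure_mono sets.finite_UN) auto
    also have "\<dots> \<le> (\<Sum>z\<in>fl ` ?H. emeasure (\<Pi>\<^sub>M i\<in>?I. (lborel :: real measure)) (box z))"
      using finZ meas by (intro emeasure_subadditive_finite) auto
    also have "\<dots> = ennreal (real (card (fl ` ?H)) * (1 / real k) ^ (CARD('d) - 1))"
      unfolding box by (simp add: ennreal_mult ennreal_of_nat_eq_real_of_nat)
    finally have "V \<le> real (card (fl ` ?H)) * (1 / real k) ^ (CARD('d) - 1)"
      unfolding V_def measure_def by (intro enn2real_leI) auto
    then have "V * real k ^ (CARD('d) - 1) \<le> real (card (fl ` ?H))"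
      using k by (simp add: field_simps power_divide)
    then show ?thesis using cardZ by linarith
  qed
  then show ?thesis by blast
qed

text \<open>Stars and bars: the slack \<open>m - total_degree g\<close>, put in front, turns
  \<open>g\<close> into a list with sum exactly \<open>m\<close>.\<close>

lemma card_total_degree_le:
  "real (card {g :: nat^'d. total_degree g \<le> m}) \<le> real (m + CARD('d)) ^ CARD('d) / fact (CARD('d))"
proof -
  let ?d = "CARD('d)"
  let ?f = "\<lambda>g :: nat^'d. (m - total_degree g) # map (vec_nth g) variables"
  have len: "length (variables :: 'd list) = ?d"
    using distinct_card[OF variables_props(1)[where 'n = 'd]] variables_props(2)[where 'n = 'd] by simp
  have "sum_list (map (vec_nth g) variables) = total_degree g" for g :: "nat^'d"
    using sum_list_distinct_conv_sum_set[OF variables_props(1)[where 'n = 'd]]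
    by (simp add: total_degree_def variables_props)
  then have sub: "?f ` {g :: nat^'d. total_degree g \<le> m} \<subseteq> {l. length l = Suc ?d \<and> sum_list l = m}"
    by (auto simp: len)
  have inj: "inj_on ?f {g :: nat^'d. total_degree g \<le> m}"
    by (rule inj_onI) (auto simp: vec_eq_iff variables_props)
  have fin: "finite {l :: nat list. length l = Suc ?d \<and> sum_list l = m}"
  proof (rule finite_subset)
    show "{l :: nat list. length l = Suc ?d \<and> sum_list l = m} \<subseteq> {l. set l \<subseteq> {..m} \<and> length l = Suc ?d}"
      using member_le_sum_list by auto
  qed (rule finite_lists_length_eq, simp)
  have "card {g :: nat^'d. total_degree g \<le> m} \<le> (m + ?d) choose m"
    using card_inj_on_le[OF inj sub fin] card_length_sum_list[of "Suc ?d" m] by simp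
  also have "\<dots> = (m + ?d) choose ?d" using binomial_symmetric[of m "m + ?d"] by simp
  finally have "real (card {g :: nat^'d. total_degree g \<le> m}) \<le> real ((m + ?d) choose ?d)" by simp
  also have "real ((m + ?d) choose ?d) * fact ?d \<le> real (m + ?d) ^ ?d"
    using binomial_fact_pow[of "m + ?d" ?d] by (metis of_nat_fact of_nat_le_iff of_nat_mult of_nat_power)
  then have "real ((m + ?d) choose ?d) \<le> real (m + ?d) ^ ?d / fact ?d"
    by (simp add: pos_le_divide_eq)
  finally show ?thesis .
qed

text \<open>A discrete integral comparison: the difference of consecutive powers with exponent
  \<open>Suc D\<close> is at most \<open>Suc D\<close> times the larger base to the power
  \<open>D\<close>.\<close>

lemma sum_power_ge: "real K ^ Suc D / real (Suc D) \<le> (\<Sum>l=1..K. real l ^ D)"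
proof (induction K)
  case (Suc K)
  have "real (Suc K) ^ Suc D - real K ^ Suc D = (real (Suc K) - real K) * (\<Sum>i<Suc D. real (Suc K) ^ i * real K ^ (D - i))"
    using diff_power_eq_sum[of "real (Suc K)" D "real K"] by simp
  also have "\<dots> \<le> (\<Sum>i<Suc D. real (Suc K) ^ D)"
  proof -
    have "real (Suc K) ^ i * real K ^ (D - i) \<le> real (Suc K) ^ D" if "i < Suc D" for i
    proof -
      have "real (Suc K) ^ i * real K ^ (D - i) \<le> real (Suc K) ^ i * real (Suc K) ^ (D - i)"
        by (intro mult_left_mono power_mono) auto
      also have "\<dots> = real (Suc K) ^ D" using that by (simp add: power_add[symmetric])
      finally show ?thesis .
    qed
    then have "(\<Sum>i<Suc D. real (Suc K) ^ i * real K ^ (D - i)) \<le> (\<Sum>i<Suc D. real (Suc K) ^ D)"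
      by (intro sum_mono) auto
    then show ?thesis by simp
  qed
  finally have "real (Suc K) ^ Suc D \<le> real K ^ Suc D + real (Suc D) * real (Suc K) ^ D" by simp
  then have "real (Suc K) ^ Suc D / real (Suc D) \<le> (real K ^ Suc D + real (Suc D) * real (Suc K) ^ D) / real (Suc D)"
    by (rule divide_right_mono) simp
  also have "\<dots> = real K ^ Suc D / real (Suc D) + real (Suc K) ^ D"
    by (simp add: add_divide_distrib del: of_nat_Suc)
  finally have "real (Suc K) ^ Suc D / real (Suc D) \<le> real K ^ Suc D / real (Suc D) + real (Suc K) ^ D" .
  then show ?case using Suc by simp
qed simp

text \<open>Summing the lattice point bound over the first \<open>K\<close> degrees gives at least
  \<open>V * K^d / d\<close>, while the polynomial ring allows at most
  \<open>m * (K + c')^d / d!\<close>. Letting \<open>K\<close> grow compares the leading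
  coefficients.\<close>

lemma normalized_volume_le:
  fixes A :: "int^'n^'d"
  assumes row: "\<And>j. A $ r $ j = 1" and lattice: "range (\<lambda>u. A *v u) = UNIV"
    and bound: "\<And>k. card (cmb A ` {u. total_degree u \<le> k}) \<le> m * card {g :: nat^'d. total_degree g \<le> k + c}"
  shows "normalized_volume r A \<le> real m"
proof -
  let ?d = "CARD('d)"
  define V where "V = measure (\<Pi>\<^sub>M i\<in>UNIV - {r}. (lborel :: real measure))
       ((\<lambda>p. restrict (vec_nth p) (UNIV - {r})) ` (convex hull (range (\<lambda>j. column j (map_matrix real_of_int A)))))"
  obtain c0 where c0: "\<And>k. k > 0 \<Longrightarrow> V * real k ^ (?d - 1) \<le> real (card (cmb A ` {u. total_degree u = k + c0}))"
    using polytope_measure_le_card[OF row lattice] unfolding V_def by blast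
  have d: "?d = Suc (?d - 1)" by simp
  have V0: "V \<ge> 0" by (simp add: V_def)
  define c' where "c' = c0 + c + ?d"
  have fin: "finite (cmb A ` {u. total_degree u = k})" for k
    by (intro finite_imageI finite_subset[OF _ finite_total_degree_le[of k]]) auto
  have ineq: "fact (?d - 1) * V \<le> real m * (1 + real c' / real K) ^ ?d" if K: "K > 0" for K
  proof -
    have "V * (real K ^ ?d / real ?d) \<le> V * (\<Sum>l=1..K. real l ^ (?d - 1))"
      using sum_power_ge[of K "?d - 1"] d V0 by (intro mult_left_mono) auto
    also have "\<dots> = (\<Sum>l=1..K. V * real l ^ (?d - 1))" by (rule sum_distrib_left)
    also have "\<dots> \<le> (\<Sum>l=1..K. real (card (cmb A ` {u. total_degree u = l + c0})))"
      by (intro sum_mono c0) auto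
    also have "\<dots> = real (card (\<Union>l\<in>{1..K}. cmb A ` {u. total_degree u = l + c0}))"
    proof (subst card_UN_disjoint)
      show "\<forall>i\<in>{1..K}. \<forall>j\<in>{1..K}. i \<noteq> j \<longrightarrow> cmb A ` {u. total_degree u = i + c0} \<inter> cmb A ` {u. total_degree u = j + c0} = {}"
      proof (intro ballI impI equals0I)
        fix i j a assume "i \<noteq> j" "a \<in> cmb A ` {u. total_degree u = i + c0} \<inter> cmb A ` {u. total_degree u = j + c0}"
        then have "a $ r = int (i + c0)" "a $ r = int (j + c0)" by (auto simp del: of_nat_add) (metis cmb_nth_degree[OF row])+
        then show False using \<open>i \<noteq> j\<close> by simp
      qed
    qed (use fin in auto)
    also have "\<dots> \<le> real (card (cmb A ` {u. total_degree u \<le> K + c0}))"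
      unfolding of_nat_le_iff by (rule card_mono) (auto intro: finite_imageI finite_total_degree_le)
    also have "\<dots> \<le> real m * real (card {g :: nat^'d. total_degree g \<le> K + c0 + c})"
      using bound[of "K + c0"] by (metis of_nat_le_iff of_nat_mult)
    also have "\<dots> \<le> real m * (real (K + c0 + c + ?d) ^ ?d / fact ?d)"
      by (intro mult_left_mono card_total_degree_le) auto
    also have "real (K + c0 + c + ?d) = real K * (1 + real c' / real K)"
      using K by (simp add: c'_def field_simps)
    finally have "V * (real K ^ ?d / real ?d) \<le> real m * (real K ^ ?d * (1 + real c' / real K) ^ ?d / fact ?d)"
      by (simp add: power_mult_distrib)
    moreover have "fact ?d = real ?d * fact (?d - 1)" using d by (metis fact_Suc of_nat_Suc)
    moreover have "real ?d > 0" "real K ^ ?d > 0" using K by auto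
    ultimately show ?thesis by (simp add: field_simps)
  qed
  have "(\<lambda>K. real m * (1 + real c' / real K) ^ ?d) \<longlonglongrightarrow> real m * (1 + 0) ^ ?d"
    by (intro tendsto_intros lim_const_over_n)
  then have "fact (?d - 1) * V \<le> real m * (1 + 0) ^ ?d"
    by (rule LIMSEQ_le_const) (intro exI[of _ 1] allI impI ineq, simp)
  then show ?thesis by (simp add: normalized_volume_def V_def)
qed

section \<open>Multivariate Taylor series\<close>

text \<open>With divided powers the Taylor coefficients are the derivatives at the centre, and
  differentiation is a shift of the index.\<close>

definition divided_power :: "('a::real_normed_field)^'n \<Rightarrow> nat^'n \<Rightarrow> 'a" where
  "divided_power y u = (\<Prod>j\<in>UNIV. y $ j ^ (u $ j) / fact (u $ j))"

lemma divided_power_add_axis: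
  "of_nat (Suc (v $ j)) * divided_power y (v + axis j 1) = y $ j * divided_power y v"
proof -
  have "divided_power y (v + axis j 1)
      = (y $ j ^ Suc (v $ j) / fact (Suc (v $ j))) * (\<Prod>i\<in>UNIV - {j}. y $ i ^ (v $ i) / fact (v $ i))"
    unfolding divided_power_def by (subst prod.remove[of UNIV j]) (auto simp: axis_def intro!: prod.cong)
  moreover have "divided_power y v = (y $ j ^ (v $ j) / fact (v $ j)) * (\<Prod>i\<in>UNIV - {j}. y $ i ^ (v $ i) / fact (v $ i))"
    unfolding divided_power_def by (rule prod.remove) auto
  ultimately show ?thesis by (simp del: of_nat_Suc)
qed

lemma norm_divided_power: "norm (divided_power y u) = divided_power (\<chi> j. norm (y $ j)) u"
  by (simp add: divided_power_def prod_norm[symmetric] norm_divide norm_power)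

lemma finite_total_degree_eq: "finite {u :: nat^'n. total_degree u = m}"
  by (rule finite_subset[OF _ finite_total_degree_le[of m]]) auto

lemma sum_total_degree_Suc:
  fixes G :: "nat^'n \<Rightarrow> 'a::comm_monoid_add"
  shows "(\<Sum>u | total_degree u = Suc m. if u $ j > 0 then G (u - axis j 1) else 0) = (\<Sum>v | total_degree v = m. G v)"
proof -
  have eq: "u - axis j 1 + axis j 1 = u" if "u $ j > 0" for u :: "nat^'n"
    using that by (auto simp: vec_eq_iff axis_def)
  have "(\<Sum>u | total_degree u = Suc m. if u $ j > 0 then G (u - axis j 1) else 0)
      = (\<Sum>u | total_degree u = Suc m \<and> u $ j > 0. G (u - axis j 1))"
    by (simp add: sum.inter_filter[symmetric] finite_total_degree_eq)
  also have "\<dots> = (\<Sum>v | total_degree v = m. G v)"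
  proof (rule sum.reindex_bij_witness[where i = "\<lambda>v. v + axis j 1" and j = "\<lambda>u. u - axis j 1"])
    fix u :: "nat^'n" assume u: "u \<in> {u. total_degree u = Suc m \<and> u $ j > 0}"
    then show "u - axis j 1 + axis j 1 = u" using eq by blast
    then have "total_degree (u - axis j 1) + 1 = total_degree u" by (metis total_degree_add total_degree_axis)
    then show "u - axis j 1 \<in> {v. total_degree v = m}" using u by simp
  next
    fix v :: "nat^'n" assume "v \<in> {v. total_degree v = m}"
    then show "v + axis j 1 \<in> {u. total_degree u = Suc m \<and> u $ j > 0}" by simp
    show "v + axis j 1 - axis j 1 = v" by (simp add: vec_eq_iff)
  qed auto
  finally show ?thesis .
qed

lemma degree_mult_divided_power:
  "of_nat (u $ j) * divided_power y u = (if u $ j > 0 then y $ j * divided_power y (u - axis j 1) else 0)"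
proof (cases "u $ j > 0")
  case True
  then obtain v where v: "u = v + axis j 1" by (rule nat_vec_decompose)
  have "v + axis j 1 - axis j 1 = v" by (simp add: vec_eq_iff)
  then show ?thesis using divided_power_add_axis[of v j y] True by (simp add: v axis_def)
qed simp

text \<open>Induction by Euler's identity: the factor \<open>Suc m\<close> is split into the
  \<open>u $ j\<close>, each of which lowers one exponent.\<close>

lemma multinomial:
  fixes y :: "real^'n"
  shows "(\<Sum>u | total_degree u = m. divided_power y u) = (\<Sum>j\<in>UNIV. y $ j) ^ m / fact m"
proof (induction m)
  case 0
  have "{u :: nat^'n. u = 0} = {0}" by simp
  then show ?case by (simp add: divided_power_def)
next
  case (Suc m)
  have "real (Suc m) * (\<Sum>u | total_degree u = Suc m. divided_power y u)
      = (\<Sum>u | total_degree u = Suc m. \<Sum>j\<in>UNIV. real (u $ j) * divided_power y u)"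
    by (simp add: sum_distrib_left sum_distrib_right[symmetric] total_degree_def flip: of_nat_sum)
  also have "\<dots> = (\<Sum>j\<in>UNIV. \<Sum>u | total_degree u = Suc m. if u $ j > 0 then y $ j * divided_power y (u - axis j 1) else 0)"
    unfolding degree_mult_divided_power by (rule sum.swap)
  also have "\<dots> = (\<Sum>j\<in>UNIV. \<Sum>v | total_degree v = m. y $ j * divided_power y v)"
    by (subst sum_total_degree_Suc) simp
  also have "\<dots> = (\<Sum>j\<in>UNIV. y $ j) * (\<Sum>v | total_degree v = m. divided_power y v)"
    by (simp add: sum_distrib_left sum_distrib_right) (subst sum.swap, simp)
  finally show ?case unfolding Suc by (simp add: field_simps del: of_nat_Suc)
qed

lemma has_derivative_divided_power:
  fixes p :: "complex^'n"
  shows "((\<lambda>x. divided_power (x - p) u) has_derivative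
    (\<lambda>h. \<Sum>j\<in>UNIV. h $ j * (if u $ j > 0 then divided_power (x - p) (u - axis j 1) else 0))) (at x)"
proof -
  let ?y = "x - p"
  have "((\<lambda>x. \<Prod>j\<in>UNIV. (x - p) $ j ^ (u $ j) / fact (u $ j)) has_derivative
      (\<lambda>h. \<Sum>j\<in>UNIV. (of_nat (u $ j) * (h $ j * (?y $ j) ^ (u $ j - 1)) / fact (u $ j)) * (\<Prod>i\<in>UNIV - {j}. ?y $ i ^ (u $ i) / fact (u $ i)))) (at x)"
    by (rule has_derivative_prod) (auto intro!: derivative_eq_intros bounded_linear.has_derivative[OF bounded_linear_vec_nth] simp: algebra_simps)
  moreover have "(of_nat (u $ j) * (h $ j * (?y $ j) ^ (u $ j - 1)) / fact (u $ j)) * (\<Prod>i\<in>UNIV - {j}. ?y $ i ^ (u $ i) / fact (u $ i))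
      = h $ j * (if u $ j > 0 then divided_power ?y (u - axis j 1) else 0)" for h j
  proof (cases "u $ j > 0")
    case True
    then obtain v where v: "u = v + axis j 1" by (rule nat_vec_decompose)
    have v': "v + axis j 1 - axis j 1 = v" by (simp add: vec_eq_iff)
    have "divided_power ?y v = (?y $ j ^ (v $ j) / fact (v $ j)) * (\<Prod>i\<in>UNIV - {j}. ?y $ i ^ (v $ i) / fact (v $ i))"
      unfolding divided_power_def by (rule prod.remove) auto
    moreover have "(\<Prod>i\<in>UNIV - {j}. ?y $ i ^ (u $ i) / fact (u $ i)) = (\<Prod>i\<in>UNIV - {j}. ?y $ i ^ (v $ i) / fact (v $ i))"
      by (intro prod.cong) (auto simp: v axis_def)
    moreover have "u $ j = Suc (v $ j)" by (simp add: v axis_def)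
    moreover have "u - axis j 1 = v" unfolding v by (rule v')
    ultimately show ?thesis using True by (simp add: field_simps del: of_nat_Suc)
  qed simp
  ultimately show ?thesis unfolding divided_power_def by simp
qed

section \<open>Convergence and termwise differentiation\<close>

definition homogeneous_part :: "complex^'n \<Rightarrow> (nat^'n \<Rightarrow> complex) \<Rightarrow> nat \<Rightarrow> complex^'n \<Rightarrow> complex" where
  "homogeneous_part p F m x = (\<Sum>u | total_degree u = m. F u * divided_power (x - p) u)"

definition taylor :: "complex^'n \<Rightarrow> (nat^'n \<Rightarrow> complex) \<Rightarrow> complex^'n \<Rightarrow> complex" where
  "taylor p F x = suminf (\<lambda>m. homogeneous_part p F m x)"

text \<open>The l1 ball fits the multinomial theorem: if the coefficients of degree \<open>m\<close>
  are at most \<open>C R^m m!\<close>, the part of degree \<open>m\<close> is at most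
  \<open>C (R s)^m\<close>, where \<open>s\<close> is the l1 distance to \<open>p\<close>.\<close>

definition taylor_domain :: "complex^'n \<Rightarrow> real \<Rightarrow> (complex^'n) set" where
  "taylor_domain p rho = {x. (\<Sum>j\<in>UNIV. norm (x $ j - p $ j)) < rho}"

text \<open>Asking for a bound at every \<open>R' > R\<close> instead of \<open>R\<close> itself
  makes the class closed under differentiation, with the same domain.\<close>

definition taylor_growth :: "real \<Rightarrow> (nat^'n \<Rightarrow> complex) \<Rightarrow> bool" where
  "taylor_growth R F \<longleftrightarrow> (\<forall>R'>R. \<exists>C. \<forall>u. norm (F u) \<le> C * R' ^ total_degree u * fact (total_degree u))"

lemma taylor_growth_shift:
  assumes F: "taylor_growth R F" and R: "R > 0"
  shows "taylor_growth R (\<lambda>u. F (u + axis j 1))"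
  unfolding taylor_growth_def
proof (intro allI impI)
  fix R' assume "R' > R"
  \<comment> \<open>The gap between \<open>R''\<close> and \<open>R'\<close> absorbs the factor that
    comes from the factorial of the shifted index.\<close>
  define R'' where "R'' = (R + R') / 2"
  have R'': "R < R''" "R'' < R'" "R'' > 0" using \<open>R' > R\<close> R by (simp_all add: R''_def)
  obtain C where C: "\<And>u. norm (F u) \<le> C * R'' ^ total_degree u * fact (total_degree u)"
    using F R''(1) unfolding taylor_growth_def by blast
  have C0: "C \<ge> 0" using C[of 0] by (simp add: order_trans[OF norm_ge_zero])
  have "(\<lambda>n. real n * (R'' / R') ^ n) \<longlonglongrightarrow> 0"
    using R'' by (intro powser_times_n_limit_0) simp
  then have "Bseq (\<lambda>n. real n * (R'' / R') ^ n)" by (metis convergentI convergent_imp_Bseq)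
  then obtain B where B: "\<And>n. norm (real n * (R'' / R') ^ n) \<le> B" by (auto simp: Bseq_def)
  have "norm (F (u + axis j 1)) \<le> (C * B * R') * R' ^ total_degree u * fact (total_degree u)" for u
  proof -
    let ?n = "total_degree u"
    have "R'' ^ Suc ?n * fact (Suc ?n) = (real (Suc ?n) * (R'' / R') ^ Suc ?n) * (R' ^ Suc ?n * fact ?n)"
      using R'' by (simp add: power_divide)
    also have "\<dots> \<le> B * (R' ^ Suc ?n * fact ?n)"
      using B[of "Suc ?n"] R'' by (intro mult_right_mono) auto
    finally have "C * (R'' ^ Suc ?n * fact (Suc ?n)) \<le> C * (B * (R' ^ Suc ?n * fact ?n))"
      using C0 by (rule mult_left_mono)
    moreover have "norm (F (u + axis j 1)) \<le> C * (R'' ^ Suc ?n * fact (Suc ?n))" using C[of "u + axis j 1"] by (simp add: mult.assoc)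
    ultimately show ?thesis by (simp add: ac_simps)
  qed
  then show "\<exists>C. \<forall>u. norm (F (u + axis j 1)) \<le> C * R' ^ total_degree u * fact (total_degree u)" by blast
qed

lemma open_taylor_domain: "open (taylor_domain p rho)"
  unfolding taylor_domain_def by (intro open_Collect_less continuous_intros)

lemma convex_taylor_domain:
  fixes p :: "complex^'n"
  shows "convex (taylor_domain p rho)"
proof (rule convexI)
  fix x y :: "complex^'n" and u v :: real
  assume x: "x \<in> taylor_domain p rho" and y: "y \<in> taylor_domain p rho" and uv: "0 \<le> u" "0 \<le> v" "u + v = 1"
  have "(\<Sum>j\<in>UNIV. norm ((u *\<^sub>R x + v *\<^sub>R y) $ j - p $ j)) \<le> (\<Sum>j\<in>UNIV. u * norm (x $ j - p $ j) + v * norm (y $ j - p $ j))"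
  proof (rule sum_mono)
    fix j
    have "(u *\<^sub>R x + v *\<^sub>R y) $ j - (u + v) *\<^sub>R p $ j = u *\<^sub>R (x $ j - p $ j) + v *\<^sub>R (y $ j - p $ j)"
      by (simp add: scaleR_right_diff_distrib scaleR_left_distrib)
    then have "(u *\<^sub>R x + v *\<^sub>R y) $ j - p $ j = u *\<^sub>R (x $ j - p $ j) + v *\<^sub>R (y $ j - p $ j)"
      by (simp add: uv)
    then show "norm ((u *\<^sub>R x + v *\<^sub>R y) $ j - p $ j) \<le> u * norm (x $ j - p $ j) + v * norm (y $ j - p $ j)"
      using uv by (metis norm_triangle_le norm_scaleR abs_of_nonneg order_refl)
  qed
  also have "\<dots> = u * (\<Sum>j\<in>UNIV. norm (x $ j - p $ j)) + v * (\<Sum>j\<in>UNIV. norm (y $ j - p $ j))"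
    by (simp add: sum.distrib sum_distrib_left)
  also have "\<dots> < rho"
    using x y uv unfolding taylor_domain_def by (intro convex_bound_lt) auto
  finally show "u *\<^sub>R x + v *\<^sub>R y \<in> taylor_domain p rho" by (simp add: taylor_domain_def)
qed

lemma norm_homogeneous_part_le:
  fixes p :: "complex^'n"
  assumes "\<And>u. norm (F u) \<le> C * R ^ total_degree u * fact (total_degree u)"
  shows "norm (homogeneous_part p F m x) \<le> C * (R * (\<Sum>j\<in>UNIV. norm (x $ j - p $ j))) ^ m"
proof -
  have "norm (homogeneous_part p F m x) \<le> (\<Sum>u | total_degree u = m. (C * R ^ m * fact m) * divided_power (\<chi> j. norm (x $ j - p $ j)) u)"
    unfolding homogeneous_part_def
  proof (rule sum_norm_le)
    fix u :: "nat^'n" assume "u \<in> {u. total_degree u = m}"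
    then have "norm (F u) \<le> C * R ^ m * fact m" using assms[of u] by simp
    then show "norm (F u * divided_power (x - p) u) \<le> (C * R ^ m * fact m) * divided_power (\<chi> j. norm (x $ j - p $ j)) u"
      unfolding norm_mult norm_divided_power
      by (simp add: mult_right_mono divided_power_def prod_nonneg)
  qed
  also have "\<dots> = C * (R * (\<Sum>j\<in>UNIV. norm (x $ j - p $ j))) ^ m"
    by (simp add: sum_distrib_left[symmetric] multinomial power_mult_distrib)
  finally show ?thesis .
qed

lemma has_derivative_homogeneous_part:
  fixes p :: "complex^'n"
  shows "(homogeneous_part p F m has_derivative
     (\<lambda>h. case m of 0 \<Rightarrow> 0 | Suc m' \<Rightarrow> \<Sum>j\<in>UNIV. h $ j * homogeneous_part p (\<lambda>u. F (u + axis j 1)) m' x)) (at x)"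
proof -
  have "(homogeneous_part p F m has_derivative
      (\<lambda>h. \<Sum>u | total_degree u = m. F u * (\<Sum>j\<in>UNIV. h $ j * (if u $ j > 0 then divided_power (x - p) (u - axis j 1) else 0)))) (at x)"
    unfolding homogeneous_part_def[abs_def]
    by (intro has_derivative_sum has_derivative_mult_right has_derivative_divided_power)
  moreover have "(\<Sum>u | total_degree u = m. F u * (\<Sum>j\<in>UNIV. h $ j * (if u $ j > 0 then divided_power (x - p) (u - axis j 1) else 0)))
     = (case m of 0 \<Rightarrow> 0 | Suc m' \<Rightarrow> \<Sum>j\<in>UNIV. h $ j * homogeneous_part p (\<lambda>u. F (u + axis j 1)) m' x)" for h
  proof (cases m)
    case 0
    then show ?thesis by simp
  next
    case (Suc m')
    have eq: "u - axis j 1 + axis j 1 = u" if "u $ j > 0" for u :: "nat^'n" and j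
      using that by (auto simp: vec_eq_iff axis_def)
    have "(\<Sum>u | total_degree u = m. F u * (\<Sum>j\<in>UNIV. h $ j * (if u $ j > 0 then divided_power (x - p) (u - axis j 1) else 0)))
      = (\<Sum>u | total_degree u = m. \<Sum>j\<in>UNIV. if u $ j > 0 then (\<lambda>v. h $ j * (F (v + axis j 1) * divided_power (x - p) v)) (u - axis j 1) else 0)"
      unfolding sum_distrib_left by (intro sum.cong refl) (auto simp: eq simp del: One_nat_def)
    also have "\<dots> = (\<Sum>j\<in>UNIV. \<Sum>u | total_degree u = Suc m'. if u $ j > 0 then (\<lambda>v. h $ j * (F (v + axis j 1) * divided_power (x - p) v)) (u - axis j 1) else 0)"
      unfolding Suc by (rule sum.swap)
    also have "\<dots> = (\<Sum>j\<in>UNIV. \<Sum>v | total_degree v = m'. h $ j * (F (v + axis j 1) * divided_power (x - p) v))"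
      by (subst sum_total_degree_Suc) simp
    finally show ?thesis by (simp add: Suc homogeneous_part_def sum_distrib_left)
  qed
  ultimately show ?thesis by simp
qed

lemma taylor_convergence:
  fixes p :: "complex^'n"
  assumes F: "taylor_growth R F" and R: "R > 0" and rho: "R * rho < 1"
  shows "uniform_limit (taylor_domain p rho) (\<lambda>n x. \<Sum>m<n. homogeneous_part p F m x) (taylor p F) sequentially"
    and "x \<in> taylor_domain p rho \<Longrightarrow> (\<lambda>m. homogeneous_part p F m x) sums taylor p F x"
proof -
  show *: "uniform_limit (taylor_domain p rho) (\<lambda>n x. \<Sum>m<n. homogeneous_part p F m x) (taylor p F) sequentially"
  proof (cases "rho > 0")
    case True
    \<comment> \<open>Between \<open>R\<close> and \<open>1 / rho\<close>: the growth bound applies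
      to \<open>R'\<close>, and the ratio \<open>R' * rho\<close> of the majorising geometric series
      is still below 1.\<close>
    define R' where "R' = (R + 1 / rho) / 2"
    have R': "R < R'" "R' * rho < 1" using rho True by (simp_all add: R'_def field_simps)
    obtain C where C: "\<And>u. norm (F u) \<le> C * R' ^ total_degree u * fact (total_degree u)"
      using F R'(1) unfolding taylor_growth_def by blast
    have C0: "C \<ge> 0" using C[of 0] by (simp add: order_trans[OF norm_ge_zero])
    have "norm (homogeneous_part p F m x) \<le> C * (R' * rho) ^ m" if "x \<in> taylor_domain p rho" for m x
    proof -
      have "norm (homogeneous_part p F m x) \<le> C * (R' * (\<Sum>j\<in>UNIV. norm (x $ j - p $ j))) ^ m"
        by (rule norm_homogeneous_part_le[OF C])
      also have "\<dots> \<le> C * (R' * rho) ^ m"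
        using that R R' C0 by (intro mult_left_mono power_mono) (auto simp: taylor_domain_def sum_nonneg)
      finally show ?thesis .
    qed
    moreover have "summable (\<lambda>m. C * (R' * rho) ^ m)"
      using R R' True by (intro summable_mult summable_geometric) simp
    ultimately show ?thesis unfolding taylor_def[abs_def] by (rule Weierstrass_m_test)
  next
    case False
    have "(\<Sum>j\<in>UNIV. norm (x $ j - p $ j)) \<ge> 0" for x by (simp add: sum_nonneg)
    then have "taylor_domain p rho = {}" using False by (force simp: taylor_domain_def not_less intro: order_trans)
    then show ?thesis by (simp add: uniform_limit_iff)
  qed
  show "(\<lambda>m. homogeneous_part p F m x) sums taylor p F x" if "x \<in> taylor_domain p rho"
    using tendsto_uniform_limitI[OF * that] by (simp add: sums_def)
qed

text \<open>Termwise differentiation on a slightly smaller ball that still contains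
  \<open>x\<close>; there the series of derivatives converges uniformly, being made of Taylor series
  with shifted coefficients.\<close>

theorem has_derivative_taylor:
  fixes p :: "complex^'n"
  assumes F: "taylor_growth R F" and R: "R > 0" and x: "x \<in> taylor_domain p (1 / R)"
  shows "(taylor p F has_derivative (\<lambda>h. \<Sum>j\<in>UNIV. h $ j * taylor p (\<lambda>u. F (u + axis j 1)) x)) (at x)"
proof -
  let ?s = "\<Sum>j\<in>UNIV. norm (x $ j - p $ j)"
  define rho where "rho = (?s + 1 / R) / 2"
  have "?s < 1 / R" using x by (simp add: taylor_domain_def)
  then have "?s < rho" "rho < 1 / R" by (simp_all add: rho_def)
  then have xr: "x \<in> taylor_domain p rho" and rho: "R * rho < 1"
    using R by (simp_all add: taylor_domain_def field_simps)
  let ?S = "taylor_domain p rho"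
  let ?f' = "\<lambda>m x h. case m of 0 \<Rightarrow> 0 | Suc m' \<Rightarrow> \<Sum>j\<in>UNIV. h $ j * homogeneous_part p (\<lambda>u. F (u + axis j 1)) m' x"
  let ?g' = "\<lambda>x h. \<Sum>j\<in>UNIV. h $ j * taylor p (\<lambda>u. F (u + axis j 1)) x"
  have "\<exists>g. \<forall>x\<in>?S. (\<lambda>m. homogeneous_part p F m x) sums (g x) \<and> (g has_derivative ?g' x) (at x within ?S)"
  proof (rule has_derivative_series[where f = "homogeneous_part p F" and f' = ?f' and S = ?S, OF convex_taylor_domain _ _ xr taylor_convergence(2)[OF F R rho xr]])
    show "(homogeneous_part p F m has_derivative ?f' m y) (at y within ?S)" for m y
      by (rule has_derivative_at_withinI[OF has_derivative_homogeneous_part])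
    fix e :: real assume e: "e > 0"
    define d where "d = e / real CARD('n)"
    have d: "d > 0" using e by (simp add: d_def)
    have "\<forall>\<^sub>F n in sequentially. \<forall>j\<in>UNIV. \<forall>y\<in>?S. dist (\<Sum>m<n. homogeneous_part p (\<lambda>u. F (u + axis j 1)) m y) (taylor p (\<lambda>u. F (u + axis j 1)) y) < d"
      using taylor_convergence(1)[OF taylor_growth_shift[OF F R] R rho] d
      by (intro eventually_ball_finite) (auto simp: uniform_limit_iff)
    \<comment> \<open>The part of degree \<open>m\<close> differentiates to parts of degree
      \<open>m - 1\<close>, so \<open>Suc n\<close> terms of one series are compared with
      \<open>n\<close> terms of the other.\<close>
    then have "\<forall>\<^sub>F n in sequentially. \<forall>y\<in>?S. \<forall>h. norm ((\<Sum>m<Suc n. ?f' m y h) - ?g' y h) \<le> e * norm h"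
    proof eventually_elim
      case (elim n)
      show ?case
      proof (intro ballI allI)
        fix y h assume y: "y \<in> ?S"
        have "(\<Sum>m<Suc n. ?f' m y h) = (\<Sum>m<n. \<Sum>j\<in>UNIV. h $ j * homogeneous_part p (\<lambda>u. F (u + axis j 1)) m y)"
          by (subst sum.lessThan_Suc_shift) simp
        also have "\<dots> = (\<Sum>j\<in>UNIV. h $ j * (\<Sum>m<n. homogeneous_part p (\<lambda>u. F (u + axis j 1)) m y))"
          by (subst sum.swap) (simp add: sum_distrib_left)
        finally have "(\<Sum>m<Suc n. ?f' m y h) - ?g' y h
            = (\<Sum>j\<in>UNIV. h $ j * ((\<Sum>m<n. homogeneous_part p (\<lambda>u. F (u + axis j 1)) m y) - taylor p (\<lambda>u. F (u + axis j 1)) y))"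
          by (simp add: right_diff_distrib sum_subtractf)
        also have "norm \<dots> \<le> (\<Sum>j\<in>(UNIV :: 'n set). norm h * d)"
        proof (rule sum_norm_le)
          fix j :: 'n
          have "norm ((\<Sum>m<n. homogeneous_part p (\<lambda>u. F (u + axis j 1)) m y) - taylor p (\<lambda>u. F (u + axis j 1)) y) \<le> d"
            using elim y by (auto simp: dist_norm less_imp_le)
          then show "norm (h $ j * ((\<Sum>m<n. homogeneous_part p (\<lambda>u. F (u + axis j 1)) m y) - taylor p (\<lambda>u. F (u + axis j 1)) y)) \<le> norm h * d"
            unfolding norm_mult using Finite_Cartesian_Product.norm_nth_le[of h j] by (intro mult_mono) auto
        qed
        also have "\<dots> = e * norm h" by (simp add: d_def)
        finally show "norm ((\<Sum>m<Suc n. ?f' m y h) - ?g' y h) \<le> e * norm h" .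
      qed
    qed
    then show "\<forall>\<^sub>F n in sequentially. \<forall>y\<in>?S. \<forall>h. norm ((\<Sum>m<n. ?f' m y h) - ?g' y h) \<le> e * norm h"
      by (subst (asm) eventually_sequentially_Suc)
  qed
  then obtain g where g: "\<And>y. y \<in> ?S \<Longrightarrow> (\<lambda>m. homogeneous_part p F m y) sums g y"
    "\<And>y. y \<in> ?S \<Longrightarrow> (g has_derivative ?g' y) (at y within ?S)" by blast
  have eq: "g y = taylor p F y" if "y \<in> ?S" for y
    using g(1)[OF that] by (simp add: taylor_def sums_iff)
  have "(g has_derivative ?g' x) (at x)"
    using g(2)[OF xr] xr by (simp add: at_within_open[OF _ open_taylor_domain])
  then show ?thesis
    by (rule has_derivative_transform_within_open[OF _ open_taylor_domain xr eq])
qed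

section \<open>The action of the Weyl algebra\<close>

lemma bounded_linear_axis: "bounded_linear (axis j :: complex \<Rightarrow> complex^'n)"
proof -
  have "linear (axis j :: complex \<Rightarrow> complex^'n)"
    by (rule linearI) (auto simp: vec_eq_iff axis_def)
  then show ?thesis by (simp add: linear_conv_bounded_linear)
qed

lemma tendsto_add_axis: "((\<lambda>t. x + axis j t) \<longlongrightarrow> x) (nhds 0)" for x :: "complex^'n"
proof -
  have "((\<lambda>t. x + axis j t) \<longlongrightarrow> x + axis j 0) (nhds 0)"
    by (intro tendsto_add tendsto_const bounded_linear.tendsto[OF bounded_linear_axis] filterlim_ident)
  then show ?thesis by (simp add: axis_def vec_eq_iff zero_vec_def[symmetric])
qed

lemma eventually_add_axis:
  fixes x :: "complex^'n"
  assumes "open U" "x \<in> U"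
  shows "\<forall>\<^sub>F t in nhds 0. x + axis j t \<in> U"
  using tendsto_add_axis[of x j] assms by (simp add: tendsto_def)

lemma partial_deriv_cong:
  assumes "open U" "x \<in> U" "\<And>y. y \<in> U \<Longrightarrow> g y = h y"
  shows "partial_deriv j g x = partial_deriv j h x"
  unfolding partial_deriv_def
  by (rule deriv_cong_ev[OF _ refl]) (rule eventually_mono[OF eventually_add_axis[OF assms(1,2)] assms(3)])

lemma taylor_growth_add:
  assumes "taylor_growth R F" "R > 0"
  shows "taylor_growth R (\<lambda>v. F (v + w))"
proof (induction w rule: nat_vec_induct)
  case (add_axis w j)
  have "taylor_growth R (\<lambda>v. F (v + axis j 1 + w))"
    using taylor_growth_shift[OF add_axis assms(2), of j] by simp
  then show ?case by (simp add: ac_simps)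
qed (use assms in simp)

lemma has_field_derivative_taylor:
  fixes p :: "complex^'n"
  assumes "taylor_growth R F" "R > 0" "x \<in> taylor_domain p (1 / R)"
  shows "((\<lambda>t. taylor p F (x + axis j t)) has_field_derivative taylor p (\<lambda>u. F (u + axis j 1)) x) (at 0)"
proof -
  have x0: "x + axis j 0 = x" by (simp add: vec_eq_iff axis_def)
  have "((\<lambda>t. x + axis j t) has_derivative axis j) (at 0)"
    by (auto intro!: derivative_eq_intros bounded_linear.has_derivative[OF bounded_linear_axis])
  moreover have "(taylor p F has_derivative (\<lambda>h. \<Sum>i\<in>UNIV. h $ i * taylor p (\<lambda>u. F (u + axis i 1)) x)) (at (x + axis j 0))"
    unfolding x0 by (rule has_derivative_taylor[OF assms])
  ultimately have "((\<lambda>t. taylor p F (x + axis j t)) has_derivative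
      (\<lambda>t. \<Sum>i\<in>UNIV. axis j t $ i * taylor p (\<lambda>u. F (u + axis i 1)) x)) (at 0)"
    by (rule has_derivative_compose)
  moreover have "(\<lambda>t. \<Sum>i\<in>UNIV. axis j t $ i * taylor p (\<lambda>u. F (u + axis i 1)) x) = (*) (taylor p (\<lambda>u. F (u + axis j 1)) x)"
    by (rule ext) (simp add: axis_def if_distrib[where f = "\<lambda>z. z * _"] mult.commute cong: if_cong)
  ultimately show ?thesis by (simp add: has_field_derivative_def)
qed

lemma partial_deriv_taylor:
  fixes p :: "complex^'n"
  assumes "taylor_growth R F" "R > 0" "x \<in> taylor_domain p (1 / R)"
  shows "partial_deriv j (taylor p F) x = taylor p (\<lambda>u. F (u + axis j 1)) x"
  unfolding partial_deriv_def by (rule DERIV_imp_deriv) (rule has_field_derivative_taylor[OF assms])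

lemma partial_deriv_power_taylor:
  fixes p :: "complex^'n"
  assumes F: "taylor_growth R F" and R: "R > 0" and x: "x \<in> taylor_domain p (1 / R)"
  shows "partial_deriv_power b (taylor p F) x = taylor p (\<lambda>u. F (u + b)) x"
proof -
  let ?U = "taylor_domain p (1 / R)"
  have pow: "(partial_deriv j ^^ k) g x = taylor p (\<lambda>u. G (u + axis j k)) x"
    if "taylor_growth R G" "\<And>x. x \<in> ?U \<Longrightarrow> g x = taylor p G x" "x \<in> ?U" for j k g G x
    using that(3)
  proof (induction k arbitrary: x)
    case 0
    have ax: "axis j 0 = (0 :: nat^'n)" by (simp add: axis_def vec_eq_iff)
    show ?case unfolding ax using that(2) 0 by simp
  next
    case (Suc k)
    have "(partial_deriv j ^^ Suc k) g x = partial_deriv j (taylor p (\<lambda>u. G (u + axis j k))) x"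
      using partial_deriv_cong[OF open_taylor_domain Suc.prems Suc.IH] by simp
    also have "\<dots> = taylor p (\<lambda>u. G (u + axis j 1 + axis j k)) x"
      by (rule partial_deriv_taylor[OF taylor_growth_add[OF that(1) R] R Suc.prems])
    also have "(\<lambda>u. G (u + axis j 1 + axis j k)) = (\<lambda>u. G (u + axis j (Suc k)))"
      by (rule ext, rule arg_cong[of _ _ G]) (simp add: vec_eq_iff axis_def)
    finally show ?case .
  qed
  \<comment> \<open>The part of \<open>b\<close> that belongs to the variables already processed; it
    is the invariant of the fold.\<close>
  define mask where "mask xs = (\<chi> i. if i \<in> set xs then b $ i else 0)" for xs :: "'n list"
  have fold: "foldr (\<lambda>j. partial_deriv j ^^ (b $ j)) xs (taylor p F) x = taylor p (\<lambda>u. F (u + mask xs)) x"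
    if "distinct xs" "x \<in> ?U" for xs x
    using that
  proof (induction xs arbitrary: x)
    case Nil
    have "mask [] = 0" by (simp add: mask_def vec_eq_iff)
    then show ?case by simp
  next
    case (Cons j xs)
    have "foldr (\<lambda>j. partial_deriv j ^^ (b $ j)) (j # xs) (taylor p F) x
        = (partial_deriv j ^^ (b $ j)) (foldr (\<lambda>j. partial_deriv j ^^ (b $ j)) xs (taylor p F)) x" by simp
    also have "\<dots> = taylor p (\<lambda>u. F (u + axis j (b $ j) + mask xs)) x"
      using Cons by (intro pow[OF taylor_growth_add[OF F R]]) auto
    also have "(\<lambda>u. F (u + axis j (b $ j) + mask xs)) = (\<lambda>u. F (u + mask (j # xs)))"
      using Cons.prems by (intro ext arg_cong[of _ _ F]) (auto simp: vec_eq_iff axis_def mask_def)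
    finally show ?case .
  qed
  have "mask variables = b" by (simp add: mask_def variables_props vec_eq_iff)
  then show ?thesis using fold[OF variables_props(1) x] by (simp only: partial_deriv_power_def)
qed

section \<open>Differential operators applied to Taylor series\<close>

lemma weyl_apply_add: "weyl_apply (P + Q) f x = weyl_apply P f x + weyl_apply Q f x"
  unfolding weyl_apply_def plus_weyl_def weyl.sel
  by (simp add: case_prod_unfold) (rule setsum_keys_plus_distrib, simp_all add: algebra_simps)

lemma weyl_apply_single:
  "weyl_apply (Weyl (Poly_Mapping.single (a, b) c)) f x = c * (\<Prod>j\<in>UNIV. (x $ j) ^ (a $ j)) * partial_deriv_power b f x"
  by (cases "c = 0") (simp_all add: weyl_apply_def)

lemma weyl_apply_0: "weyl_apply 0 f x = 0"
  by (simp add: weyl_apply_def zero_weyl_def)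

lemma weyl_apply_uminus: "weyl_apply (- P) f x = - weyl_apply P f x"
  using weyl_apply_add[of "- P" P f x] by (simp add: weyl_apply_0 eq_neg_iff_add_eq_0)

lemma weyl_apply_diff: "weyl_apply (P - Q) f x = weyl_apply P f x - weyl_apply Q f x"
  using weyl_apply_add[of P "- Q" f x] by (simp add: weyl_apply_uminus)

lemma weyl_apply_sum: "weyl_apply (sum P S) f x = (\<Sum>s\<in>S. weyl_apply (P s) f x)"
  by (induction S rule: infinite_finite_induct) (simp_all add: weyl_apply_0 weyl_apply_add)

lemma weyl_induct [case_names add single]:
  assumes "\<And>P Q. R P \<Longrightarrow> R Q \<Longrightarrow> R (P + Q)" "\<And>a b c. R (Weyl (Poly_Mapping.single (a, b) c))"
  shows "R P"
proof -
  have "R (Weyl Z)" for Z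
  proof (induction Z rule: pm_induct)
    case (add Z Z')
    then show ?case using assms(1)[of "Weyl Z" "Weyl Z'"] by (simp add: plus_weyl_def)
  next
    case (single k c)
    then show ?case using assms(2) by (cases k) simp
  qed
  then show ?thesis by (metis weyl.collapse)
qed

lemma weyl_apply_const_mult: "weyl_apply (weyl_const c * P) f x = c * weyl_apply P f x"
proof (induction P rule: weyl_induct)
  case (add P Q)
  then show ?case by (simp add: distrib_left weyl_apply_add)
next
  case (single a b e)
  show ?case
    by (simp add: weyl_const_def weyl_mult_single weyl_mult_basis_comm mult_single weyl_apply_single)
qed

lemma weyl_apply_x_mult: "weyl_apply (weyl_x j * P) f x = x $ j * weyl_apply P f x"
proof (induction P rule: weyl_induct)
  case (add P Q)
  then show ?case by (simp add: distrib_left weyl_apply_add)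
next
  case (single a b e)
  have "(\<Prod>i\<in>UNIV. x $ i ^ (axis j 1 $ i + a $ i)) = x $ j * (\<Prod>i\<in>UNIV. x $ i ^ (a $ i))"
    by (simp add: power_add prod.distrib axis_def if_distrib[where f = "\<lambda>k. _ ^ k"] prod.delta cong: if_cong)
  then show ?case
    by (simp add: weyl_x_def weyl_mult_single weyl_mult_basis_comm mult_single weyl_apply_single)
qed

text \<open>Only \<open>k = 0\<close> and \<open>k = axis j 1\<close> occur in the Leibniz sum, the
  latter exactly if the variable \<open>j\<close> divides the monomial.\<close>

lemma weyl_mult_basis_d:
  "weyl_mult_basis (0, axis j 1) (a, b) = Poly_Mapping.single (a, b + axis j 1) 1
     + (if a $ j > 0 then Poly_Mapping.single (a - axis j 1, b) (of_nat (a $ j)) else 0)"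
proof -
  have zero: "x - 0 = x" for x :: "nat^'a" by (simp add: vec_eq_iff)
  have ne: "(0 :: nat^'a) \<noteq> axis j 1" by (simp add: vec_eq_iff axis_def)
  have set: "{k. k \<le> axis j 1 \<and> k \<le> a} = (if a $ j > 0 then {0, axis j 1} else {0})"
  proof (intro equalityI subsetI)
    fix k :: "nat^'a" assume "k \<in> {k. k \<le> axis j 1 \<and> k \<le> a}"
    then have le: "k $ i \<le> axis j 1 $ i" "k $ i \<le> a $ i" for i by (auto simp: less_eq_vec_def)
    have k: "k = axis j (k $ j)"
      unfolding vec_eq_iff
    proof
      fix i show "k $ i = axis j (k $ j) $ i" using le(1)[of i] by (auto simp: axis_def split: if_splits)
    qed
    have "k $ j = 0 \<or> k $ j = 1" using le(1)[of j] by (auto simp: axis_def)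
    moreover have "axis j (0::nat) = 0" by (simp add: axis_def vec_eq_iff)
    ultimately show "k \<in> (if a $ j > 0 then {0, axis j 1} else {0})" using k le(2)[of j] by auto
  next
    fix k :: "nat^'a" assume "k \<in> (if a $ j > 0 then {0, axis j 1} else {0})"
    then show "k \<in> {k. k \<le> axis j 1 \<and> k \<le> a}" by (auto simp: less_eq_vec_def axis_def split: if_splits)
  qed
  have prod: "(\<Prod>i\<in>UNIV. (axis j 1 $ i choose axis j 1 $ i) * (a $ i choose axis j 1 $ i) * fact (axis j 1 $ i)) = a $ j"
  proof -
    have "(\<Prod>i\<in>UNIV. (axis j 1 $ i choose axis j 1 $ i) * (a $ i choose axis j 1 $ i) * fact (axis j 1 $ i)) = (\<Prod>i\<in>UNIV. if i = j then a $ j else 1)"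
      by (intro prod.cong refl) (simp add: axis_def)
    then show ?thesis by simp
  qed
  show ?thesis
  proof (cases "a $ j > 0")
    case True
    then have "weyl_mult_basis (0, axis j 1) (a, b) = (\<Sum>k \<in> {0, axis j 1}. Poly_Mapping.single (0 + a - k, axis j 1 + b - k)
       (of_nat (\<Prod>i\<in>UNIV. (axis j 1 $ i choose k $ i) * (a $ i choose k $ i) * fact (k $ i))))"
      unfolding weyl_mult_basis_def prod.case set by simp
    also have "\<dots> = Poly_Mapping.single (a, axis j 1 + b) 1 + Poly_Mapping.single (a - axis j 1, axis j 1 + b - axis j 1) (of_nat (a $ j))"
      using ne by (simp only: sum.insert sum.empty finite.intros insert_iff empty_iff simp_thms prod) (simp add: zero)
    also have "axis j 1 + b - axis j 1 = b" by (simp add: vec_eq_iff)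
    finally show ?thesis using True by (simp add: add.commute)
  next
    case False
    then have "weyl_mult_basis (0, axis j 1) (a, b) = (\<Sum>k \<in> {0}. Poly_Mapping.single (0 + a - k, axis j 1 + b - k)
       (of_nat (\<Prod>i\<in>UNIV. (axis j 1 $ i choose k $ i) * (a $ i choose k $ i) * fact (k $ i))))"
      unfolding weyl_mult_basis_def prod.case set by simp
    then show ?thesis using False by (simp add: zero add.commute)
  qed
qed

lemma has_field_derivative_monomial:
  fixes x :: "complex^'n"
  shows "((\<lambda>t. \<Prod>i\<in>UNIV. (x + axis j t) $ i ^ (a $ i)) has_field_derivative
     (if a $ j > 0 then of_nat (a $ j) * (\<Prod>i\<in>UNIV. x $ i ^ ((a - axis j 1) $ i)) else 0)) (at 0)"
proof -
  let ?c = "\<Prod>i\<in>UNIV - {j}. x $ i ^ (a $ i)"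
  have "(\<lambda>t. \<Prod>i\<in>UNIV. (x + axis j t) $ i ^ (a $ i)) = (\<lambda>t. (x $ j + t) ^ (a $ j) * ?c)"
    by (rule ext, subst prod.remove[of UNIV j]) (auto simp: axis_def intro!: prod.cong)
  moreover have "((\<lambda>t. (x $ j + t) ^ (a $ j) * ?c) has_field_derivative (of_nat (a $ j) * (x $ j) ^ (a $ j - 1) * ?c)) (at 0)"
    by (auto intro!: derivative_eq_intros)
  moreover have "of_nat (a $ j) * (x $ j) ^ (a $ j - 1) * ?c
      = (if a $ j > 0 then of_nat (a $ j) * (\<Prod>i\<in>UNIV. x $ i ^ ((a - axis j 1) $ i)) else 0)"
  proof -
    have "(\<Prod>i\<in>UNIV. x $ i ^ ((a - axis j 1) $ i)) = (x $ j) ^ (a $ j - 1) * ?c"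
      by (subst prod.remove[of UNIV j]) (auto simp: axis_def intro!: prod.cong)
    then show ?thesis by simp
  qed
  ultimately show ?thesis by simp
qed

text \<open>On the domain the derivatives of the series are again Taylor series, with shifted
  coefficients, so the product rule for a monomial times a series matches the two terms of
  \<open>weyl_mult_basis_d\<close>.\<close>

lemma has_field_derivative_weyl_apply:
  fixes p :: "complex^'n"
  assumes F: "taylor_growth R F" and R: "R > 0" and x: "x \<in> taylor_domain p (1 / R)"
  shows "((\<lambda>t. weyl_apply Q (taylor p F) (x + axis j t)) has_field_derivative weyl_apply (weyl_d j * Q) (taylor p F) x) (at 0)"
proof (induction Q rule: weyl_induct)
  case (add P Q)
  then show ?case by (simp add: distrib_left weyl_apply_add DERIV_add)
next
  case (single a b c)
  let ?U = "taylor_domain p (1 / R)"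
  let ?m = "\<lambda>x :: complex^'n. \<Prod>i\<in>UNIV. x $ i ^ (a $ i)"
  let ?T = "\<lambda>b. taylor p (\<lambda>u. F (u + b))"
  let ?m' = "if a $ j > 0 then of_nat (a $ j) * (\<Prod>i\<in>UNIV. x $ i ^ ((a - axis j 1) $ i)) else 0"
  have x0: "x + axis j 0 = x" by (simp add: vec_eq_iff axis_def)
  have "((\<lambda>t. ?T b (x + axis j t)) has_field_derivative taylor p (\<lambda>u. F (u + axis j 1 + b)) x) (at 0)"
    by (rule has_field_derivative_taylor[OF taylor_growth_add[OF F R] R x])
  then have d: "((\<lambda>t. ?T b (x + axis j t)) has_field_derivative ?T (b + axis j 1) x) (at 0)"
    by (simp add: ac_simps)
  from DERIV_cmult[OF DERIV_mult[OF has_field_derivative_monomial[of x j a] d], of c]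
  have "((\<lambda>t. c * (?m (x + axis j t) * ?T b (x + axis j t))) has_field_derivative
      c * (?m' * ?T b x + ?T (b + axis j 1) x * ?m x)) (at 0)"
    by (simp only: x0)
  then have "((\<lambda>t. weyl_apply (Weyl (Poly_Mapping.single (a, b) c)) (taylor p F) (x + axis j t)) has_field_derivative
      c * (?m' * ?T b x + ?T (b + axis j 1) x * ?m x)) (at 0)"
  proof (rule DERIV_cong_ev[THEN iffD1, rotated -1])
    have "\<forall>\<^sub>F t in nhds 0. x + axis j t \<in> ?U" by (rule eventually_add_axis[OF open_taylor_domain x])
    then show "\<forall>\<^sub>F t in nhds 0. c * (?m (x + axis j t) * ?T b (x + axis j t))
        = weyl_apply (Weyl (Poly_Mapping.single (a, b) c)) (taylor p F) (x + axis j t)"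
      by eventually_elim (simp add: weyl_apply_single partial_deriv_power_taylor[OF F R] mult.assoc)
  qed simp_all
  moreover have "weyl_apply (weyl_d j * Weyl (Poly_Mapping.single (a, b) c)) (taylor p F) x = c * (?m' * ?T b x + ?T (b + axis j 1) x * ?m x)"
  proof -
    have "weyl_d j * Weyl (Poly_Mapping.single (a, b) c) = Weyl (Poly_Mapping.single (a, b + axis j 1) c)
      + (if a $ j > 0 then Weyl (Poly_Mapping.single (a - axis j 1, b) (c * of_nat (a $ j))) else 0)"
      unfolding weyl_d_def weyl_mult_single weyl_mult_basis_d
      by (simp add: distrib_left mult_single plus_weyl_def zero_weyl_def flip: zero_prod_def)
    then show ?thesis
      by (simp add: weyl_apply_add weyl_apply_0 weyl_apply_single partial_deriv_power_taylor[OF F R x] algebra_simps)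
  qed
  ultimately show ?case by simp
qed

text \<open>The operators that kill the function on the whole domain form a left ideal. It suffices
  to multiply by constants, \<open>weyl_x j\<close> and \<open>weyl_d j\<close>, and for the last it
  matters that the function vanishes on an open set and not just at one point.\<close>

lemma weyl_apply_left_ideal:
  fixes p :: "complex^'n"
  assumes F: "taylor_growth R F" and R: "R > 0"
    and gens: "\<And>P x. P \<in> G \<Longrightarrow> x \<in> taylor_domain p (1 / R) \<Longrightarrow> weyl_apply P (taylor p F) x = 0"
    and P: "P \<in> left_ideal_generated G" and x: "x \<in> taylor_domain p (1 / R)"
  shows "weyl_apply P (taylor p F) x = 0"
proof -
  let ?U = "taylor_domain p (1 / R)"
  define I where "I = {P. \<forall>x\<in>?U. weyl_apply P (taylor p F) x = 0}"
  have add: "P + Q \<in> I" if "P \<in> I" "Q \<in> I" for P Q using that by (simp add: I_def weyl_apply_add)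
  have const: "weyl_const c * Q \<in> I" if "Q \<in> I" for c Q using that by (simp add: I_def weyl_apply_const_mult)
  have xm: "weyl_x j * Q \<in> I" if "Q \<in> I" for j Q using that by (simp add: I_def weyl_apply_x_mult)
  have dm: "weyl_d j * Q \<in> I" if Q: "Q \<in> I" for j Q
    unfolding I_def
  proof (intro CollectI ballI)
    fix x assume x: "x \<in> ?U"
    have "((\<lambda>t. 0) has_field_derivative weyl_apply (weyl_d j * Q) (taylor p F) x) (at 0)"
    proof (rule DERIV_cong_ev[THEN iffD1, rotated -1])
      show "((\<lambda>t. weyl_apply Q (taylor p F) (x + axis j t)) has_field_derivative weyl_apply (weyl_d j * Q) (taylor p F) x) (at 0)"
        by (rule has_field_derivative_weyl_apply[OF F R x])
      have "\<forall>\<^sub>F t in nhds 0. x + axis j t \<in> ?U" by (rule eventually_add_axis[OF open_taylor_domain x])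
      then show "\<forall>\<^sub>F t in nhds 0. weyl_apply Q (taylor p F) (x + axis j t) = 0"
        by eventually_elim (use Q in \<open>auto simp: I_def\<close>)
    qed simp_all
    then show "weyl_apply (weyl_d j * Q) (taylor p F) x = 0" using DERIV_unique DERIV_const by blast
  qed
  have mult: "P * Q \<in> I" if Q: "Q \<in> I" for P Q
  proof (induction P rule: weyl_induct)
    case (add P P')
    then show ?case by (simp add: distrib_right \<open>\<And>P Q. P \<in> I \<Longrightarrow> Q \<in> I \<Longrightarrow> P + Q \<in> I\<close>)
  next
    case (single a b c)
    show ?case
    proof (induction a rule: nat_vec_induct)
      case zero
      show ?case
      proof (induction b rule: nat_vec_induct)
        case zero
        show ?case using const[OF Q, of c] by (simp add: weyl_const_def)
      next
        case (add_axis b j)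
        have "Weyl (Poly_Mapping.single (0, b + axis j 1) c) = weyl_d j * Weyl (Poly_Mapping.single (0, b) c)"
          by (simp add: weyl_d_def weyl_mult_single weyl_mult_basis_comm mult_single add.commute)
        then show ?case using dm[OF add_axis] by (simp only: mult.assoc)
      qed
    next
      case (add_axis a j)
      have "Weyl (Poly_Mapping.single (a + axis j 1, b) c) = weyl_x j * Weyl (Poly_Mapping.single (a, b) c)"
        by (simp add: weyl_x_def weyl_mult_single weyl_mult_basis_comm mult_single add.commute)
      then show ?case using xm[OF add_axis] by (simp only: mult.assoc)
    qed
  qed
  have "left_ideal_generated G \<subseteq> I"
    unfolding left_ideal_generated_def
    using gens add mult by (intro Inter_lower) (auto simp: I_def weyl_apply_0)
  then show ?thesis using P x by (auto simp: I_def)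
qed

text \<open>The value at \<open>p\<close> is \<open>F 0\<close>, and differentiation passes to the
  shifted coefficients; hence the induction with \<open>F\<close> arbitrary.\<close>

lemma taylor_eq_0_imp:
  fixes p :: "complex^'n"
  assumes "taylor_growth R F" and R: "R > 0" and "\<forall>\<^sub>F x in nhds p. taylor p F x = 0"
  shows "F u = 0"
  using assms(1,3)
proof (induction u arbitrary: F rule: nat_vec_induct)
  case zero
  have "homogeneous_part p F m p = (if m = 0 then F 0 else 0)" for m
  proof (cases m)
    case 0
    have "{u :: nat^'n. u = 0} = {0}" by simp
    then show ?thesis using 0 by (simp add: homogeneous_part_def divided_power_def)
  next
    case (Suc m')
    have "divided_power (0 :: complex^'n) u = 0" if "total_degree u = m" for u
    proof -
      have "u \<noteq> 0" using that Suc by auto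
      then obtain j where "u $ j > 0" by (metis gr0I vec_eq_iff zero_index)
      then show ?thesis unfolding divided_power_def by (intro prod_zero) (auto intro!: bexI[of _ j])
    qed
    then show ?thesis using Suc by (simp add: homogeneous_part_def)
  qed
  then have "taylor p F p = F 0"
    unfolding taylor_def by (subst suminf_finite[of "{0}"]) auto
  then show ?case using eventually_nhds_x_imp_x[OF zero(2)] by simp
next
  case (add_axis u j)
  let ?U = "taylor_domain p (1 / R)"
  obtain V where V: "open V" "p \<in> V" "\<And>x. x \<in> V \<Longrightarrow> taylor p F x = 0"
    using add_axis.prems(2) unfolding eventually_nhds by blast
  have pU: "p \<in> ?U" using R by (simp add: taylor_domain_def)
  have "taylor p (\<lambda>v. F (v + axis j 1)) x = 0" if "x \<in> V \<inter> ?U" for x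
  proof -
    have "taylor p (\<lambda>v. F (v + axis j 1)) x = partial_deriv j (taylor p F) x"
      using that by (intro partial_deriv_taylor[OF add_axis.prems(1) R, symmetric]) auto
    also have "\<dots> = partial_deriv j (\<lambda>x. 0) x"
      using V that by (intro partial_deriv_cong[of V]) auto
    finally show ?thesis by (simp add: partial_deriv_def)
  qed
  then have "\<forall>\<^sub>F x in nhds p. taylor p (\<lambda>v. F (v + axis j 1)) x = 0"
    unfolding eventually_nhds using V pU by (intro exI[of _ "V \<inter> ?U"]) (auto intro: open_Int open_taylor_domain)
  then show ?case
    using add_axis.IH[of "\<lambda>v. F (v + axis j 1)"] taylor_growth_shift[OF add_axis.prems(1) R] by simp
qed

section \<open>Solutions with prescribed Taylor coefficients\<close>

lemma taylor_sums:
  fixes p :: "complex^'n"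
  assumes F: "taylor_growth R F" and R: "R > 0" and x: "x \<in> taylor_domain p (1 / R)"
  shows "(\<lambda>m. homogeneous_part p F m x) sums taylor p F x"
proof -
  let ?s = "\<Sum>j\<in>UNIV. norm (x $ j - p $ j)"
  define rho where "rho = (?s + 1 / R) / 2"
  have "?s < 1 / R" using x by (simp add: taylor_domain_def)
  then have "?s < rho" "rho < 1 / R" by (simp_all add: rho_def)
  then have xr: "x \<in> taylor_domain p rho" and rho: "R * rho < 1"
    using R by (simp_all add: taylor_domain_def field_simps)
  show ?thesis by (rule taylor_convergence(2)[OF F R rho xr])
qed

text \<open>Multiplying a divided power by \<open>x $ j - p $ j\<close> raises its index at
  \<open>j\<close> and produces the new exponent as a factor, which undoes the shift made by the
  derivative.\<close>

lemma euler_taylor: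
  fixes p :: "complex^'n"
  assumes F: "taylor_growth R F" and R: "R > 0" and x: "x \<in> taylor_domain p (1 / R)"
  shows "(\<lambda>m. homogeneous_part p (\<lambda>u. of_nat (u $ j) * F u) m x) sums ((x $ j - p $ j) * taylor p (\<lambda>u. F (u + axis j 1)) x)"
proof -
  have "homogeneous_part p (\<lambda>u. of_nat (u $ j) * F u) (Suc m) x = (x $ j - p $ j) * homogeneous_part p (\<lambda>u. F (u + axis j 1)) m x" for m
  proof -
    have eq: "u - axis j 1 + axis j 1 = u" if "u $ j > 0" for u :: "nat^'n"
      using that by (auto simp: vec_eq_iff axis_def)
    have "homogeneous_part p (\<lambda>u. of_nat (u $ j) * F u) (Suc m) x
        = (\<Sum>u | total_degree u = Suc m. F u * (of_nat (u $ j) * divided_power (x - p) u))"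
      by (simp add: homogeneous_part_def ac_simps)
    also have "\<dots> = (\<Sum>u | total_degree u = Suc m. if u $ j > 0 then (\<lambda>v. F (v + axis j 1) * ((x $ j - p $ j) * divided_power (x - p) v)) (u - axis j 1) else 0)"
      unfolding degree_mult_divided_power by (intro sum.cong refl) (auto simp: eq simp del: One_nat_def)
    also have "\<dots> = (\<Sum>v | total_degree v = m. F (v + axis j 1) * ((x $ j - p $ j) * divided_power (x - p) v))"
      by (rule sum_total_degree_Suc)
    finally show ?thesis by (simp add: homogeneous_part_def sum_distrib_left ac_simps)
  qed
  moreover have "homogeneous_part p (\<lambda>u. of_nat (u $ j) * F u) 0 x = 0"
    by (simp add: homogeneous_part_def)
  moreover have "(\<lambda>m. (x $ j - p $ j) * homogeneous_part p (\<lambda>u. F (u + axis j 1)) m x) sums ((x $ j - p $ j) * taylor p (\<lambda>u. F (u + axis j 1)) x)"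
    by (intro sums_mult taylor_sums[OF taylor_growth_shift[OF F R] R x])
  ultimately show ?thesis using sums_Suc_iff[of "\<lambda>m. homogeneous_part p (\<lambda>u. of_nat (u $ j) * F u) m x"] by simp
qed

text \<open>Writing \<open>x $ j\<close> as \<open>p $ j\<close> plus \<open>x $ j - p $ j\<close>
  splits the Euler operator into a shift of the coefficients and a weighting by the exponent;
  \<open>rec\<close> is the resulting identity of coefficients.\<close>

lemma taylor_homogeneity:
  fixes p :: "complex^'n"
  assumes F: "taylor_growth R F" and R: "R > 0" and x: "x \<in> taylor_domain p (1 / R)"
    and rec: "\<And>u. (\<Sum>j\<in>UNIV. a j * (p $ j * F (u + axis j 1) + of_nat (u $ j) * F u)) = b * F u"
  shows "(\<Sum>j\<in>UNIV. a j * (x $ j * taylor p (\<lambda>u. F (u + axis j 1)) x)) = b * taylor p F x"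
proof -
  let ?h = "\<lambda>F m. homogeneous_part p F m x"
  have "(\<lambda>m. \<Sum>j\<in>UNIV. a j * (p $ j * ?h (\<lambda>u. F (u + axis j 1)) m + ?h (\<lambda>u. of_nat (u $ j) * F u) m)) sums
     (\<Sum>j\<in>UNIV. a j * (p $ j * taylor p (\<lambda>u. F (u + axis j 1)) x + (x $ j - p $ j) * taylor p (\<lambda>u. F (u + axis j 1)) x))"
    by (intro sums_sum sums_mult sums_add taylor_sums[OF taylor_growth_shift[OF F R] R x] euler_taylor[OF F R x])
  moreover have "(\<Sum>j\<in>UNIV. a j * (p $ j * ?h (\<lambda>u. F (u + axis j 1)) m + ?h (\<lambda>u. of_nat (u $ j) * F u) m)) = b * ?h F m" for m
  proof -
    have "(\<Sum>j\<in>UNIV. a j * (p $ j * ?h (\<lambda>u. F (u + axis j 1)) m + ?h (\<lambda>u. of_nat (u $ j) * F u) m))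
      = (\<Sum>j\<in>UNIV. \<Sum>u | total_degree u = m. a j * (p $ j * F (u + axis j 1) + of_nat (u $ j) * F u) * divided_power (x - p) u)"
      unfolding homogeneous_part_def sum_distrib_left sum.distrib[symmetric]
      by (intro sum.cong refl) (simp add: algebra_simps)
    also have "\<dots> = (\<Sum>u | total_degree u = m. b * F u * divided_power (x - p) u)"
      by (subst sum.swap) (simp only: sum_distrib_right[symmetric] rec)
    finally show ?thesis by (simp add: homogeneous_part_def sum_distrib_left mult.assoc)
  qed
  ultimately have "(\<lambda>m. b * ?h F m) sums (\<Sum>j\<in>UNIV. a j * (x $ j * taylor p (\<lambda>u. F (u + axis j 1)) x))"
    by (simp add: algebra_simps)
  moreover have "(\<lambda>m. b * ?h F m) sums (b * taylor p F x)" by (intro sums_mult taylor_sums[OF F R x])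
  ultimately show ?thesis by (rule sums_unique2)
qed

text \<open>Coefficients that depend on \<open>u\<close> only through \<open>cmb A u\<close> are
  what the toric operators ask for; \<open>rec\<close> takes care of the homogeneities.\<close>

lemma gkz_solution:
  fixes A :: "int^'n^'d" and p :: "complex^'n"
  assumes growth: "taylor_growth R (\<lambda>u. phi (cmb A u))" and R: "R > 0"
    and rec: "\<And>u i. (\<Sum>k\<in>UNIV. of_int (A $ i $ k) * p $ k * phi (cmb A u + column k A))
       + (of_int (cmb A u $ i) - \<beta> $ i) * phi (cmb A u) = 0"
  shows "solution_near (hypergeometric_ideal A \<beta>) p (taylor p (\<lambda>u. phi (cmb A u)))"
proof -
  let ?F = "\<lambda>u. phi (cmb A u)" and ?U = "taylor_domain p (1 / R)"
  have "holomorphic_Cn (taylor p ?F) ?U"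
    unfolding holomorphic_Cn_def
  proof (intro conjI ballI)
    fix x assume "x \<in> ?U"
    then have "(taylor p ?F has_derivative (\<lambda>h. \<Sum>j\<in>UNIV. h $ j * taylor p (\<lambda>u. ?F (u + axis j 1)) x)) (at x)"
      by (rule has_derivative_taylor[OF growth R])
    then show "\<exists>f'. (taylor p ?F has_derivative f') (at x) \<and> (\<forall>c v. f' (c *s v) = c * f' v)"
      by (intro exI conjI) (auto simp: sum_distrib_left mult.assoc)
  qed (rule open_taylor_domain)
  moreover have "weyl_apply P (taylor p ?F) x = 0" if P: "P \<in> hypergeometric_ideal A \<beta>" and x: "x \<in> ?U" for P x
  proof (rule weyl_apply_left_ideal[OF growth R _ P[unfolded hypergeometric_ideal_def] x])
    fix Q x
    assume Q: "Q \<in> {weyl_d_power u - weyl_d_power u' | u u'.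
         \<forall>i. (\<Sum>j\<in>UNIV. A $ i $ j * int (u $ j)) = (\<Sum>j\<in>UNIV. A $ i $ j * int (u' $ j))} \<union>
      {(\<Sum>j\<in>UNIV. weyl_const (of_int (A $ i $ j)) * (weyl_x j * weyl_d j)) - weyl_const (\<beta> $ i) | i. True}"
      and x: "x \<in> ?U"
    have pd: "weyl_apply (Weyl (Poly_Mapping.single (0, b) c)) (taylor p ?F) x = c * taylor p (\<lambda>u. ?F (u + b)) x" for b c
      by (simp add: weyl_apply_single partial_deriv_power_taylor[OF growth R x])
    from Q show "weyl_apply Q (taylor p ?F) x = 0"
    proof
      assume "Q \<in> {weyl_d_power u - weyl_d_power u' | u u'.
         \<forall>i. (\<Sum>j\<in>UNIV. A $ i $ j * int (u $ j)) = (\<Sum>j\<in>UNIV. A $ i $ j * int (u' $ j))}"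
      then obtain u u' where Q: "Q = weyl_d_power u - weyl_d_power u'" and "cmb A u = cmb A u'"
        by (auto simp: cmb_def)
      then have "(\<lambda>w. ?F (w + u)) = (\<lambda>w. ?F (w + u'))" by (simp add: cmb_add)
      then show ?thesis by (simp add: Q weyl_apply_diff weyl_d_power_def pd)
    next
      assume "Q \<in> {(\<Sum>j\<in>UNIV. weyl_const (of_int (A $ i $ j)) * (weyl_x j * weyl_d j)) - weyl_const (\<beta> $ i) | i. True}"
      then obtain i where Q: "Q = (\<Sum>j\<in>UNIV. weyl_const (of_int (A $ i $ j)) * (weyl_x j * weyl_d j)) - weyl_const (\<beta> $ i)" by blast
      have "(\<Sum>j\<in>UNIV. of_int (A $ i $ j) * (x $ j * taylor p (\<lambda>u. ?F (u + axis j 1)) x)) = \<beta> $ i * taylor p ?F x"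
      proof (rule taylor_homogeneity[OF growth R x])
        fix u
        have "of_int (cmb A u $ i) = (\<Sum>j\<in>UNIV. of_int (A $ i $ j) * (of_nat (u $ j) :: complex))"
          by (simp add: cmb_def)
        then have "(\<Sum>j\<in>UNIV. of_int (A $ i $ j) * (p $ j * ?F (u + axis j 1) + of_nat (u $ j) * ?F u))
          = (\<Sum>k\<in>UNIV. of_int (A $ i $ k) * p $ k * phi (cmb A u + column k A)) + of_int (cmb A u $ i) * phi (cmb A u)"
          unfolding cmb_add_axis by (simp add: distrib_left sum.distrib sum_distrib_right mult.assoc)
        then show "(\<Sum>j\<in>UNIV. of_int (A $ i $ j) * (p $ j * ?F (u + axis j 1) + of_nat (u $ j) * ?F u)) = \<beta> $ i * ?F u"
          using rec[of i u] by (simp add: left_diff_distrib add_diff_eq)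
      qed
      moreover have "weyl_apply (weyl_d j) (taylor p ?F) x = taylor p (\<lambda>u. ?F (u + axis j 1)) x" for j
        unfolding weyl_d_def pd by simp
      moreover have "weyl_apply (weyl_const (\<beta> $ i)) (taylor p ?F) x = \<beta> $ i * taylor p ?F x"
        unfolding weyl_const_def pd by simp
      ultimately show ?thesis
        unfolding Q weyl_apply_diff weyl_apply_sum weyl_apply_const_mult weyl_apply_x_mult by simp
    qed
  qed
  moreover have "p \<in> ?U" using R by (simp add: taylor_domain_def)
  ultimately show ?thesis unfolding solution_near_def by blast
qed

lemma taylor_growthI:
  assumes "\<And>u. norm (F u) \<le> C * R0 ^ total_degree u * fact (total_degree u)" "0 \<le> R0" "R0 \<le> R"
  shows "taylor_growth R F"
  unfolding taylor_growth_def
proof (intro allI impI)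
  fix R' assume "R' > R"
  have C0: "C \<ge> 0" using assms(1)[of 0] by (simp add: order_trans[OF norm_ge_zero])
  have "norm (F u) \<le> C * R' ^ total_degree u * fact (total_degree u)" for u
  proof -
    have "C * R0 ^ total_degree u * fact (total_degree u) \<le> C * R' ^ total_degree u * fact (total_degree u)"
      using assms(2,3) \<open>R' > R\<close> C0 by (intro mult_right_mono mult_left_mono power_mono) auto
    then show ?thesis using assms(1)[of u] by linarith
  qed
  then show "\<exists>C. \<forall>u. norm (F u) \<le> C * R' ^ total_degree u * fact (total_degree u)" by blast
qed

lemma solution_dim_ge:
  fixes A :: "int^'n^'d" and p :: "complex^'n" and phi :: "nat \<Rightarrow> int^'d \<Rightarrow> complex"
  assumes growth: "\<And>q. q < m \<Longrightarrow> \<exists>C R. R \<ge> 1 \<and> (\<forall>u. norm (phi q (cmb A u)) \<le> C * R ^ total_degree u * fact (total_degree u))"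
    and rec: "\<And>q u i. q < m \<Longrightarrow> (\<Sum>k\<in>UNIV. of_int (A $ i $ k) * p $ k * phi q (cmb A u + column k A))
       + (of_int (cmb A u $ i) - \<beta> $ i) * phi q (cmb A u) = 0"
    and indep: "\<And>c q. (\<And>u. (\<Sum>q<m. c q * phi q (cmb A u)) = 0) \<Longrightarrow> q < m \<Longrightarrow> c q = 0"
  shows "enat m \<le> solution_dim (hypergeometric_ideal A \<beta>) p"
proof -
  have "\<forall>q\<in>{..<m}. \<exists>Rq. Rq \<ge> 1 \<and> (\<exists>C. \<forall>u. norm (phi q (cmb A u)) \<le> C * Rq ^ total_degree u * fact (total_degree u))"
  proof
    fix q assume "q \<in> {..<m}"
    then have "q < m" by simp
    then show "\<exists>Rq. Rq \<ge> 1 \<and> (\<exists>C. \<forall>u. norm (phi q (cmb A u)) \<le> C * Rq ^ total_degree u * fact (total_degree u))"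
      using growth[of q] by (elim meta_impE exE conjE) auto
  qed
  from bchoice[OF this] obtain Rq where Rq: "\<forall>q\<in>{..<m}. Rq q \<ge> 1 \<and> (\<exists>C. \<forall>u. norm (phi q (cmb A u)) \<le> C * Rq q ^ total_degree u * fact (total_degree u))" ..
  \<comment> \<open>One radius for all the series; the summand 1 keeps it positive if
    \<open>m = 0\<close>.\<close>
  define R where "R = 1 + (\<Sum>q<m. Rq q)"
  have Rq1: "Rq q \<ge> 1" if "q < m" for q using Rq that by blast
  have R0: "R > 0" unfolding R_def using Rq1 by (intro add_pos_nonneg sum_nonneg) (auto intro: order_trans[OF zero_le_one])
  have le: "Rq q \<le> R" if "q < m" for q
  proof -
    have "Rq q \<le> (\<Sum>q<m. Rq q)" using that Rq1 by (intro member_le_sum) (auto intro: order_trans[OF zero_le_one])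
    then show ?thesis by (simp add: R_def)
  qed
  have gr: "taylor_growth R (\<lambda>u. phi q (cmb A u))" if "q < m" for q
  proof -
    have "\<exists>C. \<forall>u. norm (phi q (cmb A u)) \<le> C * Rq q ^ total_degree u * fact (total_degree u)" using Rq that by simp
    then obtain C where "\<forall>u. norm (phi q (cmb A u)) \<le> C * Rq q ^ total_degree u * fact (total_degree u)" ..
    then show ?thesis using Rq1[OF that] le[OF that] by (intro taylor_growthI[of _ C "Rq q"]) auto
  qed
  let ?f = "\<lambda>q. taylor p (\<lambda>u. phi q (cmb A u))"
  have "\<forall>k<m. c k = 0" if c: "\<forall>\<^sub>F x in nhds p. (\<Sum>k<m. c k * ?f k x) = 0" for c :: "nat \<Rightarrow> complex"
  proof -
    \<comment> \<open>A combination of the series is the series of the combined coefficients, so its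
      vanishing near \<open>p\<close> becomes a relation between the values of the
      \<open>phi q\<close>.\<close>
    define G where "G u = (\<Sum>q<m. c q * phi q (cmb A u))" for u
    have "\<exists>C. \<forall>u. norm (G u) \<le> C * R' ^ total_degree u * fact (total_degree u)" if R': "R' > R" for R'
    proof -
      have "\<forall>q\<in>{..<m}. \<exists>C. \<forall>u. norm (phi q (cmb A u)) \<le> C * R' ^ total_degree u * fact (total_degree u)"
        using gr R' by (auto simp: taylor_growth_def)
      from bchoice[OF this] obtain C where C: "\<forall>q\<in>{..<m}. \<forall>u. norm (phi q (cmb A u)) \<le> C q * R' ^ total_degree u * fact (total_degree u)" ..
      have "norm (G u) \<le> (\<Sum>q<m. norm (c q) * C q) * R' ^ total_degree u * fact (total_degree u)" for u
      proof -
        have "norm (G u) \<le> (\<Sum>q<m. norm (c q) * (C q * R' ^ total_degree u * fact (total_degree u)))"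
          unfolding G_def using C by (intro sum_norm_le) (auto simp: norm_mult intro!: mult_left_mono)
        then show ?thesis by (simp add: sum_distrib_right mult.assoc)
      qed
      then show ?thesis by blast
    qed
    then have grG: "taylor_growth R G" by (simp add: taylor_growth_def)
    have "(\<Sum>k<m. c k * ?f k x) = taylor p G x" if x: "x \<in> taylor_domain p (1 / R)" for x
    proof -
      have "(\<lambda>j. \<Sum>k<m. c k * homogeneous_part p (\<lambda>u. phi k (cmb A u)) j x) sums (\<Sum>k<m. c k * ?f k x)"
        using gr by (intro sums_sum sums_mult taylor_sums[OF _ R0 x]) auto
      moreover have "(\<Sum>k<m. c k * homogeneous_part p (\<lambda>u. phi k (cmb A u)) j x) = homogeneous_part p G j x" for j
        unfolding homogeneous_part_def G_def sum_distrib_left sum_distrib_right by (subst sum.swap) (simp add: mult.assoc)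
      ultimately show ?thesis using taylor_sums[OF grG R0 x] sums_unique2 by simp
    qed
    moreover have "\<forall>\<^sub>F x in nhds p. x \<in> taylor_domain p (1 / R)"
      using R0 by (intro eventually_nhds_in_open open_taylor_domain) (simp add: taylor_domain_def)
    ultimately have "\<forall>\<^sub>F x in nhds p. taylor p G x = 0" using c by (auto elim: eventually_elim2)
    then have "G u = 0" for u by (rule taylor_eq_0_imp[OF grG R0])
    then show ?thesis using indep[of c] by (simp add: G_def)
  qed
  moreover have "\<forall>k<m. solution_near (hypergeometric_ideal A \<beta>) p (?f k)"
    using gkz_solution[OF gr R0 rec] by blast
  ultimately show ?thesis unfolding solution_dim_def
    by (intro Sup_upper CollectI exI[of _ m] conjI refl exI[of _ ?f]) auto
qed

section \<open>Bases adapted to the face\<close>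

definition real_vec :: "int^'d \<Rightarrow> real^'d" where
  "real_vec a = (\<chi> i. of_int (a $ i))"

lemma real_vec_add: "real_vec (a + b) = real_vec a + real_vec b"
  by (simp add: real_vec_def vec_eq_iff)

lemma real_vec_eq_0_iff: "real_vec a = 0 \<longleftrightarrow> a = 0"
  by (simp add: real_vec_def vec_eq_iff)

definition basis_matrix :: "int^'n^'d \<Rightarrow> ('d \<Rightarrow> 'n) \<Rightarrow> real^'d^'d" where
  "basis_matrix A e = (\<chi> i j. of_int (A $ i $ e j))"

text \<open>The vectors to be avoided fill countably many hyperplanes, a null set, which cannot
  cover a nonempty open set.\<close>

lemma exists_generic_functional:
  fixes S :: "(real^'d) set"
  assumes "open S" "S \<noteq> {}"
  shows "\<exists>om\<in>S. \<forall>z :: int^'d. z \<noteq> 0 \<longrightarrow> om \<bullet> real_vec z \<noteq> 0"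
proof -
  let ?H = "\<lambda>z :: int^'d. {x. real_vec z \<bullet> x = 0}"
  have "negligible (\<Union>(?H ` {z. z \<noteq> 0}))"
  proof (rule negligible_countable_Union)
    show "countable (?H ` {z. z \<noteq> 0})"
    proof (intro countable_image)
      have "inj (vec_nth :: int^'d \<Rightarrow> 'd \<Rightarrow> int)" by (auto intro!: injI simp: vec_eq_iff)
      moreover have "countable (UNIV :: ('d \<Rightarrow> int) set)"
        using countable_PiE[of "UNIV :: 'd set" "\<lambda>_. UNIV :: int set"] by (simp add: PiE_UNIV_domain)
      ultimately have "countable (UNIV :: (int^'d) set)"
        using countable_image_inj_on countable_subset[OF subset_UNIV] by blast
      then show "countable {z :: int^'d. z \<noteq> 0}" using countable_subset[OF subset_UNIV] by blast
    qed
    show "negligible T" if "T \<in> ?H ` {z. z \<noteq> 0}" for T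
      using that by (auto intro!: negligible_hyperplane simp: real_vec_eq_0_iff)
  qed
  then have "\<not> S \<subseteq> \<Union>(?H ` {z. z \<noteq> 0})"
    using open_not_negligible[OF assms] negligible_subset by blast
  then show ?thesis by (auto simp: inner_commute)
qed

locale four_quadrants =
  fixes A :: "int^'n^'d" and B :: "int^2^'n" and r :: 'd and j1 j2 j3 j4 :: 'n
  assumes size: "CARD('n) = CARD('d) + 2"
    and first_row: "\<And>j. A $ r $ j = 1"
    and kernel: "range (\<lambda>c. B *v c) = {u. A *v u = 0}"
    and rows: "distinct [j1, j2, j3, j4]"
    and row1: "B $ j1 $ 1 > 0" "B $ j1 $ 2 > 0"
    and row2: "B $ j2 $ 1 < 0" "0 < B $ j2 $ 2"
    and row3: "B $ j3 $ 1 < 0" "B $ j3 $ 2 < 0"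
    and row4: "B $ j4 $ 1 > 0" "0 > B $ j4 $ 2"
begin

lemma index_ne:
  "j1 \<noteq> j2" "j1 \<noteq> j3" "j1 \<noteq> j4" "j2 \<noteq> j3" "j2 \<noteq> j4" "j3 \<noteq> j4"
  "j2 \<noteq> j1" "j3 \<noteq> j1" "j4 \<noteq> j1" "j3 \<noteq> j2" "j4 \<noteq> j2" "j4 \<noteq> j3"
  using rows by auto

definition face :: "'n set" where
  "face = UNIV - {j1, j2, j3, j4}"

lemma B_mult: "(B *v z) $ j = B $ j $ 1 * z $ 1 + B $ j $ 2 * z $ 2"
  by (simp add: matrix_vector_mult_def sum_2)

lemma A_B_mult: "(\<Sum>k\<in>UNIV. A $ i $ k * (B *v z) $ k) = 0"
proof -
  have "A *v (B *v z) = 0" using kernel by blast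
  then show ?thesis by (simp add: vec_eq_iff matrix_vector_mult_def)
qed

lemma A_B: "(\<Sum>k\<in>UNIV. A $ i $ k * B $ k $ m) = 0"
proof -
  have "(B *v axis m 1) $ k = B $ k $ m" for k
    by (simp add: matrix_vector_mult_def axis_def if_distrib cong: if_cong)
  then show ?thesis using A_B_mult[of i "axis m 1"] by simp
qed

lemma minor_pos: "B $ j1 $ 1 * B $ j2 $ 2 - B $ j1 $ 2 * B $ j2 $ 1 > 0"
  using mult_pos_pos[OF row1(1) row2(2)] mult_pos_neg[OF row1(2) row2(1)] by linarith

lemma minor_elimination:
  fixes x y :: real
  assumes "of_int (B $ j1 $ 1) * x + of_int (B $ j2 $ 1) * y = 0" "of_int (B $ j1 $ 2) * x + of_int (B $ j2 $ 2) * y = 0"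
  shows "x = 0 \<and> y = 0"
proof -
  let ?D = "B $ j1 $ 1 * B $ j2 $ 2 - B $ j1 $ 2 * B $ j2 $ 1"
  have "of_int ?D * x = of_int (B $ j2 $ 2) * (of_int (B $ j1 $ 1) * x + of_int (B $ j2 $ 1) * y)
      - of_int (B $ j2 $ 1) * (of_int (B $ j1 $ 2) * x + of_int (B $ j2 $ 2) * y)" by (simp add: algebra_simps)
  moreover have "of_int ?D * y = of_int (B $ j1 $ 1) * (of_int (B $ j1 $ 2) * x + of_int (B $ j2 $ 2) * y)
      - of_int (B $ j1 $ 2) * (of_int (B $ j1 $ 1) * x + of_int (B $ j2 $ 1) * y)" by (simp add: algebra_simps)
  ultimately have "of_int ?D * x = 0" "of_int ?D * y = 0" unfolding assms by simp_all
  moreover have "real_of_int ?D \<noteq> 0" using minor_pos by (metis less_irrefl of_int_eq_0_iff)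
  ultimately show ?thesis by simp
qed

text \<open>Gale duality: the rows \<open>j1\<close> and \<open>j2\<close> of \<open>B\<close> are
  independent, so no nonzero relation between the columns of \<open>A\<close> avoids both, and the
  other \<open>d\<close> columns are independent.\<close>

lemma kernel_eq_0:
  assumes "A *v w = 0" "w $ j1 = 0" "w $ j2 = 0"
  shows "w = 0"
proof -
  obtain z where z: "w = B *v z" using assms(1) kernel by blast
  let ?D = "B $ j1 $ 1 * B $ j2 $ 2 - B $ j1 $ 2 * B $ j2 $ 1"
  have e1: "B $ j1 $ 1 * z $ 1 + B $ j1 $ 2 * z $ 2 = 0" and e2: "B $ j2 $ 1 * z $ 1 + B $ j2 $ 2 * z $ 2 = 0"
    using assms(2,3) by (simp_all add: z B_mult)
  have "?D * z $ 1 = B $ j2 $ 2 * (B $ j1 $ 1 * z $ 1 + B $ j1 $ 2 * z $ 2) - B $ j1 $ 2 * (B $ j2 $ 1 * z $ 1 + B $ j2 $ 2 * z $ 2)"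
    by (simp add: algebra_simps)
  moreover have "?D * z $ 2 = B $ j1 $ 1 * (B $ j2 $ 1 * z $ 1 + B $ j2 $ 2 * z $ 2) - B $ j2 $ 1 * (B $ j1 $ 1 * z $ 1 + B $ j1 $ 2 * z $ 2)"
    by (simp add: algebra_simps)
  ultimately have "?D * z $ 1 = 0" "?D * z $ 2 = 0" unfolding e1 e2 by simp_all
  then have "z $ 1 = 0" "z $ 2 = 0" using minor_pos by auto
  then show ?thesis by (simp add: z vec_eq_iff B_mult)
qed

lemma exists_basis: "\<exists>e. bij_betw e UNIV (UNIV - {j1, j2}) \<and> det (basis_matrix A e) \<noteq> 0"
proof -
  have "card (UNIV - {j1, j2}) = CARD('d)"
    using size rows by (simp add: card_Diff_subset)
  then obtain e :: "'d \<Rightarrow> 'n" where e: "bij_betw e UNIV (UNIV - {j1, j2})"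
    by (metis finite_class.finite_UNIV finite finite_same_card_bij)
  have range: "range e = UNIV - {j1, j2}" and inj: "inj e" using e by (auto simp: bij_betw_def)
  have "\<forall>i. \<exists>l :: 'd \<Rightarrow> rat. (\<Sum>m\<in>UNIV. l m * of_int (A $ m $ e i)) = 1
         \<and> (\<forall>k\<in>range e - {e i}. (\<Sum>m\<in>UNIV. l m * of_int (A $ m $ k)) = 0)"
  proof
    fix i
    have "\<nexists>w :: int^'n. w \<noteq> 0 \<and> A *v w = 0 \<and> (\<forall>k. k \<notin> range e \<longrightarrow> w $ k = 0)"
      using kernel_eq_0 unfolding range by auto
    then show "\<exists>l :: 'd \<Rightarrow> rat. (\<Sum>m\<in>UNIV. l m * of_int (A $ m $ e i)) = 1
         \<and> (\<forall>k\<in>range e - {e i}. (\<Sum>m\<in>UNIV. l m * of_int (A $ m $ k)) = 0)"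
      using column_relation_or_functional[of "e i" "range e" A] by blast
  qed
  from choice[OF this] obtain l :: "'d \<Rightarrow> 'd \<Rightarrow> rat" where
    l: "\<forall>i. (\<Sum>m\<in>UNIV. l i m * of_int (A $ m $ e i)) = 1 \<and> (\<forall>k\<in>range e - {e i}. (\<Sum>m\<in>UNIV. l i m * of_int (A $ m $ k)) = 0)" ..
  define L :: "real^'d^'d" where "L = (\<chi> i m. of_rat (l i m))"
  have "L ** basis_matrix A e = mat 1"
  proof -
    have "(\<Sum>m\<in>UNIV. of_rat (l i m) * real_of_int (A $ m $ e j)) = (if i = j then 1 else 0)" for i j
    proof -
      have "(\<Sum>m\<in>UNIV. of_rat (l i m) * real_of_int (A $ m $ e j)) = of_rat (\<Sum>m\<in>UNIV. l i m * of_int (A $ m $ e j))"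
        by (simp add: of_rat_sum of_rat_mult)
      moreover have "(\<Sum>m\<in>UNIV. l i m * of_int (A $ m $ e j)) = (if i = j then 1 else 0)"
        using l inj by (cases "i = j") (auto simp: inj_eq)
      ultimately show ?thesis by simp
    qed
    then show ?thesis by (simp add: matrix_matrix_mult_def L_def basis_matrix_def mat_def vec_eq_iff)
  qed
  then have "det L * det (basis_matrix A e) = 1" by (metis det_I det_mul)
  then show ?thesis using e by auto
qed

text \<open>By Gale duality, numbers \<open>c k\<close> are the values of a linear form on the
  columns of \<open>A\<close> iff they are the coefficients of a relation between the rows of
  \<open>B\<close>. The signs of the rows \<open>j1\<close>, ..., \<open>j4\<close> admit a relation
  with positive coefficients.\<close>

lemma exists_face_functional:
  "\<exists>mu :: real^'d. (\<forall>k\<in>face. mu \<bullet> real_vec (column k A) = 0) \<and> (\<forall>k\<in>- face. mu \<bullet> real_vec (column k A) > 0)"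
proof -
  define P where "P = B $ j1 $ 1 * B $ j2 $ 2 - B $ j1 $ 2 * B $ j2 $ 1"
  define Q where "Q = B $ j3 $ 1 * B $ j4 $ 2 - B $ j4 $ 1 * B $ j3 $ 2"
  have PQ: "P > 0" "Q > 0"
    unfolding P_def Q_def using minor_pos mult_neg_neg[OF row3(1) row4(2)] mult_pos_neg[OF row4(1) row3(2)] by linarith+
  \<comment> \<open>Apart from the factors \<open>Q\<close> and \<open>P\<close>, the rows
    \<open>j1\<close>, \<open>j2\<close> combine to \<open>(0, P)\<close> and the rows
    \<open>j3\<close>, \<open>j4\<close> to \<open>(0, - Q)\<close>; the factors make the sum
    vanish.\<close>
  define c where "c k = (if k = j1 then - Q * B $ j2 $ 1 else if k = j2 then Q * B $ j1 $ 1
    else if k = j3 then P * B $ j4 $ 1 else if k = j4 then - P * B $ j3 $ 1 else 0)" for k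
  have c_pos: "c k > 0" if "k \<in> - face" for k
    using that PQ row1 row2 row3 row4 by (auto simp: face_def c_def mult_pos_neg mult_neg_pos)
  have c0: "c k = 0" if "k \<in> face" for k using that by (auto simp: face_def c_def)
  have c_rel: "(\<Sum>k\<in>UNIV. B $ k $ m * c k) = 0" for m
  proof -
    have "(\<Sum>k\<in>UNIV. B $ k $ m * c k) = (\<Sum>k\<in>{j1, j2, j3, j4}. B $ k $ m * c k)"
      by (rule sum.mono_neutral_right) (auto simp: c_def)
    also have "\<dots> = Q * (B $ j1 $ 1 * B $ j2 $ m - B $ j1 $ m * B $ j2 $ 1) + P * (B $ j4 $ 1 * B $ j3 $ m - B $ j3 $ 1 * B $ j4 $ m)"
      by (simp add: c_def algebra_simps index_ne)
    also have "\<dots> = 0" using exhaust_2[of m] by (auto simp: P_def Q_def algebra_simps)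
    finally show ?thesis .
  qed
  obtain e where e: "bij_betw e UNIV (UNIV - {j1, j2})" "det (basis_matrix A e) \<noteq> 0" using exists_basis by blast
  then obtain N where N: "N ** basis_matrix A e = mat 1"
    using invertible_det_nz[of "basis_matrix A e"] by (auto simp: invertible_def)
  define mu :: "real^'d" where "mu = (\<chi> m. \<Sum>i\<in>UNIV. of_int (c (e i)) * N $ i $ m)"
  have mu_e: "mu \<bullet> real_vec (column (e j) A) = of_int (c (e j))" for j
  proof -
    have "mu \<bullet> real_vec (column (e j) A) = (\<Sum>m\<in>UNIV. \<Sum>i\<in>UNIV. of_int (c (e i)) * (N $ i $ m * basis_matrix A e $ m $ j))"
      by (simp add: inner_vec_def mu_def real_vec_def column_def basis_matrix_def sum_distrib_right mult.assoc)
    also have "\<dots> = (\<Sum>i\<in>UNIV. of_int (c (e i)) * (N ** basis_matrix A e) $ i $ j)"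
      by (subst sum.swap) (simp add: matrix_matrix_mult_def sum_distrib_left)
    finally show ?thesis by (simp add: N mat_def if_distrib cong: if_cong)
  qed
  \<comment> \<open>By construction \<open>mu\<close> agrees with \<open>c\<close> on the basis
    columns. The discrepancies at \<open>j1\<close> and \<open>j2\<close> solve two equations whose
    determinant is the nonzero minor.\<close>
  define dl where "dl k = mu \<bullet> real_vec (column k A) - of_int (c k)" for k
  have dl0: "dl k = 0" if "k \<noteq> j1" "k \<noteq> j2" for k
  proof -
    have "k \<in> range e" using e(1) that by (auto simp: bij_betw_def)
    then show ?thesis using mu_e by (auto simp: dl_def)
  qed
  have "of_int (B $ j1 $ m) * dl j1 + of_int (B $ j2 $ m) * dl j2 = 0" for m
  proof -
    have "(\<Sum>k\<in>UNIV. of_int (B $ k $ m) * (mu \<bullet> real_vec (column k A))) = (\<Sum>i\<in>UNIV. mu $ i * of_int (\<Sum>k\<in>UNIV. A $ i $ k * B $ k $ m))"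
      by (simp add: inner_vec_def real_vec_def column_def sum_distrib_left ac_simps) (rule sum.swap)
    then have "(\<Sum>k\<in>UNIV. of_int (B $ k $ m) * (mu \<bullet> real_vec (column k A))) = 0" by (simp only: A_B) simp
    moreover have "(\<Sum>k\<in>UNIV. real_of_int (B $ k $ m) * of_int (c k)) = 0"
      using c_rel[of m] by (simp flip: of_int_mult of_int_sum)
    ultimately have "(\<Sum>k\<in>UNIV. of_int (B $ k $ m) * dl k) = 0" by (simp add: dl_def right_diff_distrib sum_subtractf)
    moreover have "(\<Sum>k\<in>UNIV. of_int (B $ k $ m) * dl k) = (\<Sum>k\<in>{j1, j2}. of_int (B $ k $ m) * dl k)"
      by (rule sum.mono_neutral_right) (auto simp: dl0)
    ultimately show ?thesis using rows by simp
  qed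
  then have "dl j1 = 0 \<and> dl j2 = 0" by (intro minor_elimination)
  then have "mu \<bullet> real_vec (column k A) = of_int (c k)" for k
    using dl0[of k] by (cases "k = j1 \<or> k = j2") (auto simp: dl_def)
  then show ?thesis using c_pos c0 by (intro exI[of _ mu]) auto
qed

text \<open>The basis is the heaviest for \<open>om\<close> among those containing the face.
  Exchanging \<open>e i\<close> for a column with nonzero coordinate \<open>i\<close> gives a basis
  again, whence the comparison of weights. Face columns must not be exchanged, so \<open>om\<close>
  is chosen to make them heavier than all others.\<close>

lemma exists_adapted_basis:
  "\<exists>(e :: 'd \<Rightarrow> 'n) (N :: real^'d^'d) (om :: real^'d).
     N ** basis_matrix A e = mat 1 \<and> basis_matrix A e ** N = mat 1 \<and> face \<subseteq> range e \<and>
     (\<forall>k. om \<bullet> real_vec (column k A) > 0) \<and> (\<forall>z :: int^'d. z \<noteq> 0 \<longrightarrow> om \<bullet> real_vec z \<noteq> 0) \<and>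
     (\<forall>i k. (N *v real_vec (column k A)) $ i \<noteq> 0 \<longrightarrow> column k A \<noteq> column (e i) A \<longrightarrow>
        om \<bullet> real_vec (column k A) < om \<bullet> real_vec (column (e i) A))"
proof -
  obtain mu :: "real^'d" where mu: "\<And>k. k \<in> face \<Longrightarrow> mu \<bullet> real_vec (column k A) = 0"
    "\<And>k. k \<notin> face \<Longrightarrow> mu \<bullet> real_vec (column k A) > 0" using exists_face_functional by auto
  define S where "S = {om :: real^'d. (\<forall>k\<in>UNIV. om \<bullet> real_vec (column k A) > 0) \<and>
      (\<forall>f\<in>face. \<forall>k\<in>- face. om \<bullet> real_vec (column k A) < om \<bullet> real_vec (column f A))}"
  have "open S"
    unfolding S_def Collect_conj_eq Collect_ball_eq
    by (intro open_Int open_INT ballI finite open_Collect_less continuous_intros)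
  moreover have "S \<noteq> {}"
  proof -
    define K where "K = 1 + (\<Sum>k\<in>UNIV. \<bar>mu \<bullet> real_vec (column k A)\<bar>)"
    have K: "mu \<bullet> real_vec (column k A) < K" for k
    proof -
      have "\<bar>mu \<bullet> real_vec (column k A)\<bar> \<le> (\<Sum>k\<in>UNIV. \<bar>mu \<bullet> real_vec (column k A)\<bar>)"
        by (rule member_le_sum) auto
      then show ?thesis by (simp add: K_def)
    qed
    have "axis r K \<bullet> real_vec (column k A) = K" for k
      by (simp add: inner_axis' real_vec_def column_def first_row)
    \<comment> \<open>Row \<open>r\<close> of \<open>A\<close> is constant 1, so
      \<open>axis r K\<close> takes the value \<open>K\<close> on every column; subtracting
      \<open>mu\<close>, which is 0 on the face and positive elsewhere, leaves the face columns
      heaviest.\<close>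
    then have "axis r K - mu \<in> S" using K mu by (simp add: S_def inner_diff_left)
    then show ?thesis by blast
  qed
  ultimately obtain om where om: "om \<in> S" "\<And>z :: int^'d. z \<noteq> 0 \<Longrightarrow> om \<bullet> real_vec z \<noteq> 0"
    using exists_generic_functional by blast
  let ?w = "\<lambda>k. om \<bullet> real_vec (column k A)"
  define E where "E = {e :: 'd \<Rightarrow> 'n. det (basis_matrix A e) \<noteq> 0 \<and> face \<subseteq> range e}"
  have "E \<noteq> {}"
  proof -
    obtain e where "bij_betw e UNIV (UNIV - {j1, j2})" "det (basis_matrix A e) \<noteq> 0" using exists_basis by blast
    then have "e \<in> E" by (auto simp: E_def face_def bij_betw_def)
    then show ?thesis by blast
  qed
  then obtain e where e: "e \<in> E" and max: "\<And>e'. e' \<in> E \<Longrightarrow> (\<Sum>i\<in>UNIV. ?w (e' i)) \<le> (\<Sum>i\<in>UNIV. ?w (e i))"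
    using finite_has_max[of E "\<lambda>e. \<Sum>i\<in>UNIV. ?w (e i)"] by auto
  obtain N where N: "N ** basis_matrix A e = mat 1" "basis_matrix A e ** N = mat 1"
    using e invertible_det_nz[of "basis_matrix A e"] by (auto simp: E_def invertible_def)
  have less: "?w k < ?w (e i)" if nz: "(N *v real_vec (column k A)) $ i \<noteq> 0" and ne: "column k A \<noteq> column (e i) A" for i k
  proof -
    have col: "real_vec (column (e j) A) = basis_matrix A e *v axis j 1" for j
      by (simp add: vec_eq_iff real_vec_def column_def basis_matrix_def matrix_vector_mult_def axis_def if_distrib cong: if_cong)
    have dual: "(N *v real_vec (column (e j) A)) $ i = (if i = j then 1 else 0)" for j
      unfolding col matrix_vector_mul_assoc N by (simp add: axis_def)
    have "?w k \<noteq> ?w (e i)"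
    proof
      assume "?w k = ?w (e i)"
      moreover have "real_vec (column k A - column (e i) A) = real_vec (column k A) - real_vec (column (e i) A)"
        by (simp add: real_vec_def vec_eq_iff)
      ultimately have "om \<bullet> real_vec (column k A - column (e i) A) = 0" by (simp add: inner_diff_right)
      then show False using om(2) ne by (metis right_minus_eq)
    qed
    moreover have "?w k \<le> ?w (e i)"
    proof (cases "e i \<in> face")
      case True
      have "k \<notin> face"
      proof
        assume "k \<in> face"
        then obtain j where "k = e j" using e by (auto simp: E_def)
        then show False using dual[of j] nz ne by (auto split: if_splits)
      qed
      then show ?thesis using om(1) True by (auto simp: S_def less_imp_le)
    next
      case False
      let ?e' = "e(i := k)" and ?x = "N *v real_vec (column k A)"
      have "basis_matrix A e *v ?x = real_vec (column k A)" by (simp add: matrix_vector_mul_assoc N)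
      then have "basis_matrix A ?e' = (\<chi> a b. if b = i then (basis_matrix A e *v ?x) $ a else basis_matrix A e $ a $ b)"
        by (simp add: vec_eq_iff basis_matrix_def real_vec_def column_def)
      then have "det (basis_matrix A ?e') = ?x $ i * det (basis_matrix A e)" by (simp only: cramer_lemma)
      moreover have "face \<subseteq> range ?e'"
      proof
        fix f assume "f \<in> face"
        then obtain j where "f = e j" using e by (auto simp: E_def)
        then have "f = ?e' j" using False \<open>f \<in> face\<close> by auto
        then show "f \<in> range ?e'" by blast
      qed
      ultimately have "?e' \<in> E" using nz e by (simp add: E_def)
      from max[OF this] show ?thesis by (simp add: sum.remove[of UNIV i])
    qed
    ultimately show ?thesis by simp
  qed
  show ?thesis
    using N e om less by (intro exI[of _ e] exI[of _ N] exI[of _ om]) (auto simp: E_def S_def)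
qed

end

section \<open>The hole of the semigroup\<close>

context four_quadrants
begin

text \<open>The exponent \<open>v - e\<^sub>3\<close> without its generic part.  The corresponding degree is a hole of the
  semigroup along the face spanned by the columns other than \<open>a\<^sub>1, ..., a\<^sub>4\<close>.\<close>

definition hole_exponent :: "int^'n" where
  "hole_exponent = pos_part (column 1 B) + pos_part (column 2 B) - axis j1 1 - axis j2 1 - axis j3 1 - axis j4 1"

definition hole :: "int^'d" where
  "hole = (\<chi> i. \<Sum>k\<in>UNIV. A $ i $ k * hole_exponent $ k)"

lemma hole_exponent_nth:
  "hole_exponent $ j1 = B $ j1 $ 1 + B $ j1 $ 2 - 1" "hole_exponent $ j2 = B $ j2 $ 2 - 1"
  "hole_exponent $ j3 = - 1" "hole_exponent $ j4 = B $ j4 $ 1 - 1"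
  "j \<in> face \<Longrightarrow> hole_exponent $ j = (if B $ j $ 1 \<ge> 0 then B $ j $ 1 else 0) + (if B $ j $ 2 \<ge> 0 then B $ j $ 2 else 0)"
  using row1 row2 row3 row4 by (auto simp: hole_exponent_def pos_part_def column_def axis_def index_ne face_def)

text \<open>Subtracting \<open>B *v z\<close> for the four vectors \<open>z\<close> with entries 0
  and 1 gives four representations of the hole. Each has a single negative entry, namely -1, and it
  sits at \<open>j3\<close>, \<open>j4\<close>, \<open>j2\<close>, \<open>j1\<close> for
  \<open>z = (0,0), (1,0), (0,1), (1,1)\<close>; adding the column there repairs it.\<close>

lemma hole_add_column:
  assumes "k \<notin> face"
  shows "hole + column k A + cmb A f \<in> range (cmb A)"
proof -
  define z :: "int^2" where "z = (\<chi> i. if i = 1 then (if k = j1 \<or> k = j4 then 1 else 0) else (if k = j1 \<or> k = j2 then 1 else 0))"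
  have z: "z $ 1 = (if k = j1 \<or> k = j4 then 1 else 0)" "z $ 2 = (if k = j1 \<or> k = j2 then 1 else 0)"
    by (simp_all add: z_def)
  have k: "k = j1 \<or> k = j2 \<or> k = j3 \<or> k = j4" using assms by (auto simp: face_def)
  have nonneg: "hole_exponent $ j - (B *v z) $ j + axis k 1 $ j \<ge> 0" for j
  proof -
    consider "j = j1" | "j = j2" | "j = j3" | "j = j4" | "j \<in> face" by (auto simp: face_def)
    then show ?thesis
    proof cases
      case 5
      then have "j \<noteq> k" using assms by blast
      then show ?thesis using 5 by (auto simp: B_mult z hole_exponent_nth axis_def)
    qed (use k row1 row2 row3 row4 in \<open>auto simp: B_mult z hole_exponent_nth axis_def index_ne\<close>)
  qed
  define u :: "nat^'n" where "u = (\<chi> j. nat (hole_exponent $ j - (B *v z) $ j + axis k 1 $ j) + f $ j)"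
  have u: "int (u $ j) = hole_exponent $ j - (B *v z) $ j + axis k 1 $ j + int (f $ j)" for j
    using nonneg[of j] by (simp add: u_def)
  have "(\<Sum>j\<in>UNIV. A $ i $ j * axis k 1 $ j) = column k A $ i" for i
    by (simp add: axis_def column_def if_distrib cong: if_cong)
  then have "cmb A u = hole + column k A + cmb A f"
    by (simp add: vec_eq_iff cmb_def hole_def u distrib_left right_diff_distrib sum.distrib sum_subtractf A_B_mult)
  then show ?thesis by (metis rangeI)
qed

text \<open>A representation in the semigroup is an integer point \<open>z\<close> with
  \<open>B *v z\<close> below the exponent at \<open>j1\<close>, ..., \<open>j4\<close>. An integer
  is at most 0 or at least 1, so \<open>z\<close> lies in one of four quadrants, and each of them
  violates one of the four inequalities.\<close>

lemma hole_not_in_semigroup: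
  assumes "\<And>j. j \<notin> face \<Longrightarrow> f $ j = 0"
  shows "hole + cmb A f \<notin> range (cmb A)"
proof
  assume "hole + cmb A f \<in> range (cmb A)"
  then obtain u where u: "hole + cmb A f = cmb A u" by blast
  define w :: "int^'n" where "w = (\<chi> j. hole_exponent $ j + int (f $ j) - int (u $ j))"
  have "A *v w = 0"
    using u by (simp add: vec_eq_iff matrix_vector_mult_def w_def cmb_def hole_def distrib_left right_diff_distrib sum.distrib sum_subtractf)
  then obtain z where z: "w = B *v z" using kernel by blast
  have le: "B $ j $ 1 * z $ 1 + B $ j $ 2 * z $ 2 \<le> hole_exponent $ j" if "j \<notin> face" for j
    using arg_cong[OF z, of "\<lambda>w. w $ j"] assms[OF that] by (simp add: w_def B_mult)
  have le1: "B $ j1 $ 1 * z $ 1 + B $ j1 $ 2 * z $ 2 \<le> B $ j1 $ 1 + B $ j1 $ 2 - 1"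
    and le2: "B $ j2 $ 1 * z $ 1 + B $ j2 $ 2 * z $ 2 \<le> B $ j2 $ 2 - 1"
    and le3: "B $ j3 $ 1 * z $ 1 + B $ j3 $ 2 * z $ 2 \<le> - 1"
    and le4: "B $ j4 $ 1 * z $ 1 + B $ j4 $ 2 * z $ 2 \<le> B $ j4 $ 1 - 1"
    using le[of j1] le[of j2] le[of j3] le[of j4] by (simp_all add: face_def hole_exponent_nth)
  consider "z $ 1 \<le> 0" "z $ 2 \<le> 0" | "z $ 1 \<ge> 1" "z $ 2 \<ge> 1" | "z $ 1 \<ge> 1" "z $ 2 \<le> 0" | "z $ 1 \<le> 0" "z $ 2 \<ge> 1"
    by linarith
  then show False
  proof cases
    case 1
    then have "B $ j3 $ 1 * z $ 1 \<ge> 0" "B $ j3 $ 2 * z $ 2 \<ge> 0" using row3 by (simp_all add: mult_nonpos_nonpos)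
    then show False using le3 by linarith
  next
    case 2
    then have "B $ j1 $ 1 * z $ 1 \<ge> B $ j1 $ 1" "B $ j1 $ 2 * z $ 2 \<ge> B $ j1 $ 2" using row1 by simp_all
    then show False using le1 by linarith
  next
    case 3
    then have "B $ j4 $ 1 * z $ 1 \<ge> B $ j4 $ 1" "B $ j4 $ 2 * z $ 2 \<ge> 0" using row4 by (simp_all add: mult_nonpos_nonpos)
    then show False using le4 by linarith
  next
    case 4
    then have "B $ j2 $ 1 * z $ 1 \<ge> 0" "B $ j2 $ 2 * z $ 2 \<ge> B $ j2 $ 2" using row2 by (simp_all add: mult_nonpos_nonpos)
    then show False using le2 by linarith
  qed
qed

lemma face_comb_inject:
  assumes "cmb A f = cmb A f'" "\<And>j. j \<notin> face \<Longrightarrow> f $ j = 0" "\<And>j. j \<notin> face \<Longrightarrow> f' $ j = 0"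
  shows "f = f'"
proof -
  define w :: "int^'n" where "w = (\<chi> j. int (f $ j) - int (f' $ j))"
  have "A *v w = 0"
    using assms(1) by (simp add: vec_eq_iff matrix_vector_mult_def w_def cmb_def right_diff_distrib sum_subtractf)
  moreover have "w $ j1 = 0" "w $ j2 = 0" using assms(2,3) by (simp_all add: w_def face_def)
  ultimately have "w = 0" by (rule kernel_eq_0)
  then show ?thesis by (simp add: w_def vec_eq_iff)
qed

text \<open>The element \<open>n\<close> of \<open>exists_functionals\<close> is the monomial of
  degree \<open>hole\<close>; the main work is the functional that keeps its multiples by
  polynomials with nonzero constant term out of the module.\<close>

theorem solution_dim_lower_bound:
  fixes p :: "complex^'n" and \<beta> :: "complex^'d"
  assumes lattice: "range (\<lambda>u. A *v u) = UNIV" and nondeg: "nondegenerate A k p"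
    and p: "\<And>j. p $ j \<noteq> 0" and psum: "\<And>j. (\<Sum>j' | column j' A = column j A. p $ j') \<noteq> 0"
    and \<beta>: "\<And>i. \<beta> $ i = of_int (hole $ i) + (\<Sum>j\<in>face. \<alpha> j * of_int (A $ i $ j))"
  shows "\<exists>m. normalized_volume r A \<le> real m \<and> enat (Suc m) \<le> solution_dim (hypergeometric_ideal A \<beta>) p"
proof -
  obtain e :: "'d \<Rightarrow> 'n" and N :: "real^'d^'d" and om :: "real^'d" where
    N: "N ** basis_matrix A e = mat 1" "basis_matrix A e ** N = mat 1" and face: "face \<subseteq> range e"
    and pos: "\<And>k. om \<bullet> real_vec (column k A) > 0" and gen: "\<And>z :: int^'d. z \<noteq> 0 \<Longrightarrow> om \<bullet> real_vec z \<noteq> 0"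
    and less: "\<And>i k. (N *v real_vec (column k A)) $ i \<noteq> 0 \<Longrightarrow> column k A \<noteq> column (e i) A \<Longrightarrow>
        om \<bullet> real_vec (column k A) < om \<bullet> real_vec (column (e i) A)"
    using exists_adapted_basis by blast
  define l :: "'d \<Rightarrow> int^'d \<Rightarrow> complex" where "l i a = of_real ((N *v real_vec a) $ i)" for i a
  define lb :: "'d \<Rightarrow> complex" where "lb i = (\<Sum>m\<in>UNIV. of_real (N $ i $ m) * \<beta> $ m)" for i
  have l_sum: "l i a = (\<Sum>m\<in>UNIV. of_real (N $ i $ m) * of_int (a $ m))" for i a
    by (simp add: l_def matrix_vector_mult_def real_vec_def)
  have l_add: "l i (a + b) = l i a + l i b" for i a b
    by (simp add: l_sum algebra_simps sum.distrib)
  have l_dual: "l i (column (e j) A) = (if i = j then 1 else 0)" for i j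
  proof -
    have "real_vec (column (e j) A) = basis_matrix A e *v axis j 1"
      by (simp add: vec_eq_iff real_vec_def column_def basis_matrix_def matrix_vector_mult_def axis_def if_distrib cong: if_cong)
    then have "(N *v real_vec (column (e j) A)) $ i = axis j 1 $ i"
      by (simp add: matrix_vector_mul_assoc N)
    then show ?thesis by (simp add: l_def axis_def)
  qed
  have Ncoord: "(\<Sum>j\<in>UNIV. of_int (A $ i $ e j) * (of_real (N $ j $ m) :: complex)) = (if i = m then 1 else 0)" for i m
  proof -
    have "(\<Sum>j\<in>UNIV. of_int (A $ i $ e j) * N $ j $ m) = (basis_matrix A e ** N) $ i $ m"
      by (simp add: matrix_matrix_mult_def basis_matrix_def)
    then have "(\<Sum>j\<in>UNIV. of_int (A $ i $ e j) * N $ j $ m) = (if i = m then 1 else 0)" by (simp add: N mat_def)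
    from arg_cong[OF this, of complex_of_real] show ?thesis by simp
  qed
  have N_sum: "(\<Sum>j\<in>UNIV. of_int (A $ i $ e j) * (\<Sum>m\<in>UNIV. of_real (N $ j $ m) * x m)) = x i" for i and x :: "'d \<Rightarrow> complex"
  proof -
    have "(\<Sum>j\<in>UNIV. of_int (A $ i $ e j) * (\<Sum>m\<in>UNIV. of_real (N $ j $ m) * x m))
        = (\<Sum>m\<in>UNIV. (\<Sum>j\<in>UNIV. of_int (A $ i $ e j) * of_real (N $ j $ m)) * x m)"
      by (simp add: sum_distrib_left sum_distrib_right mult.assoc) (rule sum.swap)
    then show ?thesis by (simp add: Ncoord if_distrib[where f = "\<lambda>z. z * _"] cong: if_cong)
  qed
  interpret M: gkz_module A p l lb e k
  proof unfold_locales
    show "of_int (a $ i) = (\<Sum>j\<in>UNIV. of_int (A $ i $ e j) * l j a)" for i a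
      unfolding l_sum by (rule N_sum[symmetric])
  qed (use l_add l_dual nondeg in auto)
  have l_face: "l i (column j A) = (if j = e i then 1 else 0)" if j: "j \<in> face" for i j
  proof -
    obtain i' where "j = e i'" using face j by blast
    moreover have "e i' = e i \<longleftrightarrow> i = i'" using l_dual[of i i'] l_dual[of i i] by (auto split: if_splits)
    ultimately show ?thesis using l_dual by simp
  qed
  have "inj e" by (rule injI) (metis l_dual zero_neq_one)
  have lb_eq: "lb i = l i hole + (\<Sum>j\<in>face. \<alpha> j * l i (column j A))" for i
  proof -
    have "lb i = l i hole + (\<Sum>m\<in>UNIV. \<Sum>j\<in>face. \<alpha> j * (of_real (N $ i $ m) * of_int (column j A $ m)))"
      unfolding lb_def l_sum[of i hole] \<beta> by (simp add: distrib_left sum.distrib sum_distrib_left column_def ac_simps)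
    then show ?thesis by (subst (asm) sum.swap) (simp add: l_sum[of i "column _ A"] sum_distrib_left)
  qed
  \<comment> \<open>\<beta> differs from the hole only along the face, and the forms dual to the two
    columns off the face do not see the difference.\<close>
  have lb_face: "lb i = l i hole + (if e i \<in> face then \<alpha> (e i) else 0)" for i
    unfolding lb_eq by (simp add: l_face if_distrib[where f = "\<lambda>z. _ * z"] cong: if_cong)
  define Fc where "Fc = {f :: nat^'n. \<forall>j. j \<notin> face \<longrightarrow> f $ j = 0}"
  have l_comb: "l i (cmb A f) = (if e i \<in> face then of_nat (f $ e i) else 0)" if "f \<in> Fc" for i f
  proof -
    have "l i (cmb A f) = (\<Sum>m\<in>UNIV. \<Sum>j\<in>UNIV. of_nat (f $ j) * (of_real (N $ i $ m) * of_int (column j A $ m)))"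
      unfolding l_sum cmb_def by (simp add: sum_distrib_left column_def ac_simps)
    also have "\<dots> = (\<Sum>j\<in>UNIV. of_nat (f $ j) * l i (column j A))"
      by (subst sum.swap) (simp add: l_sum sum_distrib_left)
    also have "\<dots> = (\<Sum>j\<in>face. of_nat (f $ j) * l i (column j A))"
      using that by (intro sum.mono_neutral_right) (auto simp: Fc_def)
    also have "\<dots> = (if e i \<in> face then of_nat (f $ e i) else 0)"
      by (simp add: l_face if_distrib[where f = "\<lambda>z. _ * z"] cong: if_cong)
    finally show ?thesis .
  qed
  have Fc_0: "0 \<in> Fc" by (simp add: Fc_def)
  have Fc_add: "f + axis j 1 \<in> Fc" if "f \<in> Fc" "j \<in> face" for f j
    using that by (auto simp: Fc_def axis_def)
  \<comment> \<open>The face accounts for \<open>d - 2\<close> of the \<open>d\<close> basis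
    columns, so two remain.\<close>
  obtain x y where xy: "x \<noteq> y" "e x \<notin> face" "e y \<notin> face"
  proof -
    have "e ` {i. e i \<in> face} = face" using face by auto
    then have "card {i. e i \<in> face} = card face" using \<open>inj e\<close> card_image[of e "{i. e i \<in> face}"] by (metis inj_on_subset subset_UNIV)
    moreover have "card face = CARD('d) - 2"
    proof -
      have "card {j1, j2, j3, j4} = 4" using index_ne by simp
      then show ?thesis using size by (simp add: face_def card_Diff_subset)
    qed
    moreover have "card {i. e i \<notin> face} = CARD('d) - card {i. e i \<in> face}"
    proof -
      have "{i. e i \<notin> face} = UNIV - {i. e i \<in> face}" by auto
      then show ?thesis by (simp add: card_Diff_subset)
    qed
    moreover have "CARD('d) \<ge> 2"
    proof -
      have "card {j1, j2, j3, j4} \<le> CARD('n)" by (rule card_mono) auto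
      then show ?thesis using index_ne size by simp
    qed
    ultimately have "card {i. e i \<notin> face} = 2" by simp
    then show ?thesis using that by (auto simp: card_2_iff)
  qed
  let ?t = "\<lambda>a :: int^'d. Poly_Mapping.single a (1 :: complex)"
  have op_hole: "M.op i (?t (hole + cmb A f)) = (\<Sum>j\<in>UNIV. pm_scale (l i (column j A) * p $ j) (?t (hole + cmb A f + column j A)))
      + pm_scale (l i (cmb A f) - (if e i \<in> face then \<alpha> (e i) else 0)) (?t (hole + cmb A f))" for i f
    unfolding gkz_op_single_1 by (simp add: gkz_symbol_def pm_scale_single lb_face l_add)
  have not_face: "?t (hole + cmb A f + column j A) \<in> M.N" if "j \<notin> face" for f j
    using hole_add_column[OF that, of f] by (auto simp: M.N_def ac_simps)
  have n: "M.op i (?t hole) \<in> M.N" if "e i \<notin> face" for i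
  proof -
    have "M.op i (?t hole) = (\<Sum>j\<in>UNIV. pm_scale (l i (column j A) * p $ j) (?t (hole + cmb A 0 + column j A)))"
      using op_hole[of i 0] l_comb[OF Fc_0, of i] that by simp
    also have "\<dots> \<in> M.N"
    proof (rule pm.subspace_sum[OF M.subspace_N])
      fix j
      show "pm_scale (l i (column j A) * p $ j) (?t (hole + cmb A 0 + column j A)) \<in> M.N"
      proof (cases "j \<in> face")
        case True
        then have "l i (column j A) = 0" using l_face that by auto
        then show ?thesis using pm.subspace_0[OF M.subspace_N] by simp
      next
        case False
        then show ?thesis by (intro pm.subspace_scale[OF M.subspace_N] not_face)
      qed
    qed
    finally show ?thesis .
  qed
  \<comment> \<open>The derivative of order \<open>f\<close> at \<open>p\<close> of the product of
    the powers \<open>x\<^sub>j^{\<alpha>\<^sub>j}\<close> over the face, divided by the value of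
    the product.\<close>
  define kap0 where "kap0 f = (\<Prod>j\<in>face. \<Prod>m<f $ j. (\<alpha> j - of_nat m) / p $ j)" for f :: "nat^'n"
  \<comment> \<open>Zero away from the translate of the face semigroup by \<open>hole\<close>; on it
    the exponent \<open>f\<close> is unique, because the face columns are independent.\<close>
  define kap where "kap a = (if \<exists>f\<in>Fc. a = hole + cmb A f then kap0 (SOME f. f \<in> Fc \<and> a = hole + cmb A f) else 0)" for a
  have kap: "kap (hole + cmb A f) = kap0 f" if "f \<in> Fc" for f
  proof -
    have "(SOME f'. f' \<in> Fc \<and> hole + cmb A f = hole + cmb A f') = f"
      by (rule some_equality) (use that face_comb_inject in \<open>auto simp: Fc_def\<close>)
    then show ?thesis using that by (auto simp: kap_def)
  qed
  have kap_N: "kap a = 0" if "a \<in> range (cmb A)" for a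
  proof -
    have "\<not> (\<exists>f\<in>Fc. a = hole + cmb A f)"
    proof
      assume "\<exists>f\<in>Fc. a = hole + cmb A f"
      then obtain f where "f \<in> Fc" "a = hole + cmb A f" ..
      then show False using hole_not_in_semigroup[of f] that by (simp add: Fc_def)
    qed
    then show ?thesis unfolding kap_def by (rule if_not_P)
  qed
  \<comment> \<open>This recursion will balance the shift by the face column \<open>j\<close>
    against the diagonal coefficient \<open>f $ j - \<alpha> j\<close>.\<close>
  have kap0_add: "p $ j * kap0 (f + axis j 1) = (\<alpha> j - of_nat (f $ j)) * kap0 f" if "j \<in> face" for f j
  proof -
    have "kap0 (f + axis j 1) = (\<Prod>m<Suc (f $ j). (\<alpha> j - of_nat m) / p $ j) * (\<Prod>i\<in>face - {j}. \<Prod>m<f $ i. (\<alpha> i - of_nat m) / p $ i)"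
      unfolding kap0_def using that by (subst prod.remove[of _ j]) (auto simp: axis_def intro!: prod.cong)
    moreover have "kap0 f = (\<Prod>m<f $ j. (\<alpha> j - of_nat m) / p $ j) * (\<Prod>i\<in>face - {j}. \<Prod>m<f $ i. (\<alpha> i - of_nat m) / p $ i)"
      unfolding kap0_def using that by (intro prod.remove) auto
    ultimately show ?thesis using p[of j] by (simp add: ac_simps)
  qed
  define chi where "chi h = (\<Sum>a \<in> Poly_Mapping.keys h. Poly_Mapping.lookup h a * kap a)" for h
  have chi_add: "chi (g + h) = chi g + chi h" for g h
    unfolding chi_def by (rule setsum_keys_plus_distrib) (simp_all add: algebra_simps)
  have chi_single: "chi (Poly_Mapping.single a c) = c * kap a" for a c
    by (cases "c = 0") (simp_all add: chi_def)
  have chi_scale: "chi (pm_scale c h) = c * chi h" for c h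
    by (induction h rule: pm_induct)
      (simp_all add: pm.scale_right_distrib chi_add pm_scale_single chi_single algebra_simps)
  have chi: "Vector_Spaces.linear pm_scale (*) chi"
    unfolding Vector_Spaces.linear_iff
    by (intro conjI allI chi_add chi_scale vector_space_pm_scale) (unfold_locales, simp_all add: algebra_simps)
  interpret chi: Vector_Spaces.linear pm_scale "(*)" chi by (rule chi)
  have chi_N: "chi h = 0" if "h \<in> M.N" for h
    unfolding chi_def by (rule sum.neutral) (use that kap_N in \<open>auto simp: M.N_def\<close>)
  \<comment> \<open>\<open>act_functional\<close> needs an invariant subspace containing the
    monomial of \<open>hole\<close>. Adding its translates along the face is enough, because the
    other columns lead into \<open>M.N\<close>.\<close>
  define N1 where "N1 = {h :: int^'d \<Rightarrow>\<^sub>0 complex. Poly_Mapping.keys h \<subseteq> range (cmb A) \<union> (\<lambda>f. hole + cmb A f) ` Fc}"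
  have sub1: "pm.subspace N1"
  proof (rule pm.subspaceI)
    show "0 \<in> N1" by (simp add: N1_def)
    show "g + h \<in> N1" if "g \<in> N1" "h \<in> N1" for g h
      using that keys_add[of g h] by (auto simp: N1_def)
    show "pm_scale c g \<in> N1" if "g \<in> N1" for c g
      using that by (auto simp: N1_def in_keys_iff)
  qed
  have N_N1: "M.N \<subseteq> N1" by (auto simp: M.N_def N1_def)
  have op_hole_N1: "M.op i (?t (hole + cmb A f)) \<in> N1" and chi_op_hole: "chi (M.op i (?t (hole + cmb A f))) = 0" if f: "f \<in> Fc" for i f
  proof -
    have shift: "hole + cmb A f + column j A = hole + cmb A (f + axis j 1)" for j
      by (simp only: cmb_add_axis add.assoc)
    have "?t (hole + cmb A f + column j A) \<in> N1" for j
    proof (cases "j \<in> face")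
      case True
      then show ?thesis unfolding shift N1_def using Fc_add[OF f] by auto
    next
      case False
      then show ?thesis using not_face N_N1 by blast
    qed
    moreover have "?t (hole + cmb A f) \<in> N1" using f by (auto simp: N1_def)
    ultimately show "M.op i (?t (hole + cmb A f)) \<in> N1"
      unfolding op_hole by (intro pm.subspace_add[OF sub1] pm.subspace_sum[OF sub1] pm.subspace_scale[OF sub1])
    have "chi (?t (hole + cmb A f + column j A)) = (if j \<in> face then kap0 (f + axis j 1) else 0)" for j
    proof (cases "j \<in> face")
      case True
      then show ?thesis unfolding shift by (simp add: chi_single kap[OF Fc_add[OF f True]] del: One_nat_def)
    next
      case False
      then show ?thesis using chi_N[OF not_face[OF False]] by simp
    qed
    \<comment> \<open>Only the face column \<open>e i\<close> can survive: \<open>l i\<close> kills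
      the other face columns, and the columns off the face lead into the module, where
      \<open>chi\<close> is zero.\<close>
    then have "(\<Sum>j\<in>UNIV. (l i (column j A) * p $ j) * chi (?t (hole + cmb A f + column j A)))
        = (\<Sum>j\<in>UNIV. if j = e i then (if e i \<in> face then p $ e i * kap0 (f + axis (e i) 1) else 0) else 0)"
      by (intro sum.cong refl) (auto simp: l_face)
    then have sum: "(\<Sum>j\<in>UNIV. (l i (column j A) * p $ j) * chi (?t (hole + cmb A f + column j A)))
        = (if e i \<in> face then p $ e i * kap0 (f + axis (e i) 1) else 0)" by simp
    have "chi (?t (hole + cmb A f)) = kap0 f" by (simp add: chi_single kap[OF f])
    then show "chi (M.op i (?t (hole + cmb A f))) = 0"
      unfolding op_hole chi.add chi.sum chi_scale sum l_comb[OF f]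
      by (cases "e i \<in> face") (auto simp: kap0_add left_diff_distrib simp del: One_nat_def)
  qed
  have op1: "M.op i h \<in> N1" and chi_op: "chi (M.op i h) = 0" if h: "h \<in> N1" for i h
  proof -
    have "M.op i (?t a) \<in> N1 \<and> chi (M.op i (?t a)) = 0" if a: "a \<in> Poly_Mapping.keys h" for a
    proof -
      have "a \<in> range (cmb A) \<union> (\<lambda>f. hole + cmb A f) ` Fc" using h a by (auto simp: N1_def)
      then show ?thesis
      proof
        assume "a \<in> range (cmb A)"
        then have "M.op i (?t a) \<in> M.N" using M.op_N M.t_cmb_N by blast
        then show ?thesis using N_N1 chi_N by blast
      next
        assume "a \<in> (\<lambda>f. hole + cmb A f) ` Fc"
        then show ?thesis using op_hole_N1 chi_op_hole by blast
      qed
    qed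
    moreover have "M.op i h = (\<Sum>a \<in> Poly_Mapping.keys h. pm_scale (Poly_Mapping.lookup h a) (M.op i (?t a)))"
      by (subst pm_decompose_scale) (simp add: gkz_op_sum gkz_op_scale)
    ultimately show "M.op i h \<in> N1" "chi (M.op i h) = 0"
      by (auto simp: chi.sum chi_scale intro!: pm.subspace_sum[OF sub1] pm.subspace_scale[OF sub1])
  qed
  \<comment> \<open>\<open>chi\<close> is 1 at the hole and 0 on the module, while a polynomial
    multiplies its value by the constant term.\<close>
  have notin: "M.ops.act s (?t hole) \<notin> M.N" if "Poly_Mapping.lookup s 0 \<noteq> 0" for s
  proof
    assume "M.ops.act s (?t hole) \<in> M.N"
    then have "chi (M.ops.act s (?t hole)) = 0" by (rule chi_N)
    moreover have "hole + cmb A 0 = hole" by simp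
    then have "?t hole \<in> N1" "kap hole = 1"
      using Fc_0 kap[OF Fc_0] by (force simp: N1_def, simp add: kap0_def)
    then have "chi (M.ops.act s (?t hole)) = Poly_Mapping.lookup s 0"
      using M.ops.act_functional[OF sub1 op1 _ chi chi_op] by (simp add: chi_single)
    ultimately show False using that by simp
  qed
  have torsion: "q = 0 \<or> h = 0" if "M.ops.act q h = 0" for q h
  proof (rule M.act_eq_0_imp[of "\<lambda>a. om \<bullet> real_vec a", OF _ _ pos _ psum that])
    show "om \<bullet> real_vec (a + b) = om \<bullet> real_vec a + om \<bullet> real_vec b" for a b
      by (simp add: real_vec_add inner_add_right)
    show "inj (\<lambda>a. om \<bullet> real_vec a)"
    proof (rule injI)
      fix a b :: "int^'d" assume "om \<bullet> real_vec a = om \<bullet> real_vec b"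
      moreover have "real_vec (a - b) = real_vec a - real_vec b" by (simp add: real_vec_def vec_eq_iff)
      ultimately have "om \<bullet> real_vec (a - b) = 0" by (simp add: inner_diff_right)
      then show "a = b" using gen by (metis right_minus_eq)
    qed
    show "om \<bullet> real_vec (column k A) < om \<bullet> real_vec (column (e i) A)"
      if "l i (column k A) \<noteq> 0" "column k A \<noteq> column (e i) A" for i k
      using that by (intro less) (auto simp: l_def)
  qed
  obtain m c and f :: "nat \<Rightarrow> (int^'d \<Rightarrow>\<^sub>0 complex) \<Rightarrow> complex" where
    bound: "\<forall>m'. card (cmb A ` {u. total_degree u \<le> m'}) \<le> m * card {g :: nat^'d. total_degree g \<le> m' + c}"
    and f: "\<forall>q<Suc m. Vector_Spaces.linear pm_scale (*) (f q) \<and> (\<forall>j. \<forall>h\<in>M.N. f q (M.op j h) = 0)"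
    and indep: "\<forall>c. (\<forall>u. (\<Sum>q<Suc m. c q * f q (?t (cmb A u))) = 0) \<longrightarrow> (\<forall>q<Suc m. c q = 0)"
    using M.exists_functionals[OF torsion xy(1) n[OF xy(2)] n[OF xy(3)] notin] by auto
  have "normalized_volume r A \<le> real m"
    using bound by (intro normalized_volume_le[OF first_row lattice]) blast
  moreover have "enat (Suc m) \<le> solution_dim (hypergeometric_ideal A \<beta>) p"
  proof (rule solution_dim_ge[where phi = "\<lambda>q a. f q (?t a)"])
    show "\<exists>C R. R \<ge> 1 \<and> (\<forall>u. norm (f q (?t (cmb A u))) \<le> C * R ^ total_degree u * fact (total_degree u))" if "q < Suc m" for q
    proof -
      have "Vector_Spaces.linear pm_scale (*) (f q)" "\<And>j h. h \<in> M.N \<Longrightarrow> f q (M.op j h) = 0" using f that by auto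
      then have "\<exists>C R. C \<ge> 0 \<and> R \<ge> 1 \<and> (\<forall>u. norm (f q (?t (cmb A u))) \<le> C * R ^ total_degree u * fact (total_degree u))"
        by (rule M.functional_growth)
      then show ?thesis by (elim exE conjE) (intro exI conjI)
    qed
    show "c q = 0" if "\<And>u. (\<Sum>q<Suc m. c q * f q (?t (cmb A u))) = 0" "q < Suc m" for c q
      using indep that by blast
    fix q u i assume q: "q < Suc m"
    interpret fq: Vector_Spaces.linear pm_scale "(*)" "f q" using f q by blast
    let ?a = "cmb A u"
    have zero: "(\<Sum>k\<in>UNIV. l j (column k A) * p $ k * f q (?t (?a + column k A))) + (l j ?a - lb j) * f q (?t ?a) = 0" for j
    proof -
      have "M.op j (?t ?a) = (\<Sum>k\<in>UNIV. pm_scale (l j (column k A) * p $ k) (?t (?a + column k A))) + pm_scale (l j ?a - lb j) (?t ?a)"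
        unfolding gkz_op_single_1 by (simp add: gkz_symbol_def pm_scale_single)
      moreover have "f q (M.op j (?t ?a)) = 0" using f q M.t_cmb_N by blast
      ultimately show ?thesis by (simp add: fq.add fq.sum fq.scale)
    qed
    \<comment> \<open>The equations for the dual forms are recombined into those for the rows of
      \<open>A\<close>, in which the homogeneities are written.\<close>
    have "0 = (\<Sum>j\<in>UNIV. of_int (A $ i $ e j) * ((\<Sum>k\<in>UNIV. l j (column k A) * p $ k * f q (?t (?a + column k A))) + (l j ?a - lb j) * f q (?t ?a)))"
      by (simp only: zero mult_zero_right sum.neutral_const)
    also have "\<dots> = (\<Sum>k\<in>UNIV. (\<Sum>j\<in>UNIV. of_int (A $ i $ e j) * l j (column k A)) * p $ k * f q (?t (?a + column k A)))
        + ((\<Sum>j\<in>UNIV. of_int (A $ i $ e j) * l j ?a) - (\<Sum>j\<in>UNIV. of_int (A $ i $ e j) * lb j)) * f q (?t ?a)"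
      by (simp add: distrib_left sum.distrib sum_distrib_left sum_distrib_right left_diff_distrib right_diff_distrib sum_subtractf mult.assoc)
        (rule sum.swap)
    also have "(\<Sum>j\<in>UNIV. of_int (A $ i $ e j) * lb j) = \<beta> $ i" unfolding lb_def by (rule N_sum)
    also have "(\<Sum>j\<in>UNIV. of_int (A $ i $ e j) * l j ?a) = of_int (?a $ i)" by (rule M.l_coordinates[symmetric])
    also have "(\<lambda>k. (\<Sum>j\<in>UNIV. of_int (A $ i $ e j) * l j (column k A)) * p $ k * f q (?t (?a + column k A)))
       = (\<lambda>k. of_int (A $ i $ k) * p $ k * f q (?t (?a + column k A)))"
      by (rule ext, subst M.l_coordinates[symmetric]) (simp add: column_def)
    finally show "(\<Sum>k\<in>UNIV. of_int (A $ i $ k) * p $ k * f q (?t (?a + column k A))) + (of_int (?a $ i) - \<beta> $ i) * f q (?t ?a) = 0"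
      by simp
  qed
  ultimately show ?thesis by blast
qed

end

section \<open>Generic base points and the rank inequality\<close>

theorem theorem4p8:
  fixes A :: "int^'n^'d" and B :: "int^2^'n"
    and r :: 'd and j1 j2 j3 j4 :: 'n
    and \<alpha> :: "'n \<Rightarrow> complex" and v :: "complex^'n" and \<beta> :: "complex^'d"
  assumes size: "CARD('n) = CARD('d) + 2"
    and rank_A: "rank (map_matrix real_of_int A) = CARD('d)"
    and first_row: "\<And>j. A $ r $ j = 1"
    and lattice: "range (\<lambda>u. A *v u) = UNIV"
    and kernel_basis: "Z_basis_columns B {u. A *v u = 0}"
    and rows: "distinct [j1, j2, j3, j4]"
    and row1: "B $ j1 $ 1 > 0" "B $ j1 $ 2 > 0"
    and row2: "B $ j2 $ 1 < 0" "0 < B $ j2 $ 2"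
    and row3: "B $ j3 $ 1 < 0" "B $ j3 $ 2 < 0"
    and row4: "B $ j4 $ 1 > 0" "0 > B $ j4 $ 2"
    and cone: "independent {row j2 (map_matrix real_of_int B), row j4 (map_matrix real_of_int B)} \<Longrightarrow>
       {z :: real^2. (map_matrix real_of_int B *v z) $ j2 \<ge> 0 \<and> (map_matrix real_of_int B *v z) $ j4 \<ge> 0}
         \<subseteq> {z. z $ 1 \<ge> 0 \<and> z $ 2 \<ge> 0}"
    and nonrational: "\<And>j. j \<notin> {j1, j2, j3, j4} \<Longrightarrow> \<alpha> j \<notin> \<rat>"
    and generic: "\<And>j. j \<notin> {j1, j2, j3, j4} \<Longrightarrow> \<alpha> j \<notin> rat_adjoin (\<alpha> ` (UNIV - {j1, j2, j3, j4, j}))"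
    and v: "v = (\<chi> j. of_int ((pos_part (column 1 B) + pos_part (column 2 B)) $ j))
              - axis j1 1 - axis j2 1 - axis j4 1
              + (\<Sum>j \<in> UNIV - {j1, j2, j3, j4}. axis j (\<alpha> j))"
    and \<beta>: "\<beta> = map_matrix of_int A *v (v - axis j3 1)"
  shows "ereal_of_enat (holonomic_rank (hypergeometric_ideal A \<beta>)) \<ge> ereal (normalized_volume r A + 1)"
proof -
  interpret four_quadrants A B r j1 j2 j3 j4
    by unfold_locales (use size first_row kernel_basis rows row1 row2 row3 row4 in \<open>auto simp: Z_basis_columns_def\<close>)
  have vk: "(v - axis j3 1) $ k = of_int (hole_exponent $ k) + (if k \<in> face then \<alpha> k else 0)" for k
  proof -
    have ax: "axis j (1::complex) $ k = of_int (axis j 1 $ k)" for j by (simp add: axis_def)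
    have "(\<Sum>j \<in> UNIV - {j1, j2, j3, j4}. axis j (\<alpha> j)) $ k = (\<Sum>j \<in> face. if j = k then \<alpha> k else 0)"
      unfolding face_def sum_component by (intro sum.cong refl) (auto simp: axis_def)
    then show ?thesis by (simp add: v hole_exponent_def ax)
  qed
  have \<beta>_eq: "\<beta> $ i = of_int (hole $ i) + (\<Sum>j\<in>face. \<alpha> j * of_int (A $ i $ j))" for i
  proof -
    have "\<beta> $ i = (\<Sum>k\<in>UNIV. of_int (A $ i $ k) * (of_int (hole_exponent $ k) + (if k \<in> face then \<alpha> k else 0)))"
      unfolding \<beta> matrix_vector_mult_def vk[symmetric] by (simp add: map_matrix_def)
    also have "\<dots> = of_int (hole $ i) + (\<Sum>k\<in>UNIV. if k \<in> face then \<alpha> k * of_int (A $ i $ k) else 0)"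
    proof -
      have "of_int (A $ i $ k) * (of_int (hole_exponent $ k) + (if k \<in> face then \<alpha> k else 0))
          = of_int (A $ i $ k * hole_exponent $ k) + (if k \<in> face then \<alpha> k * of_int (A $ i $ k) else 0)" for k
        by (simp add: distrib_left)
      then show ?thesis by (simp only: sum.distrib hole_def vec_lambda_beta of_int_sum)
    qed
    finally show ?thesis by (simp add: sum.If_cases)
  qed
  obtain k and p0 :: "real^'n" where p0: "\<And>j. p0 $ j > 0" "nondegenerate A k (\<chi> j. of_real (p0 $ j))"
    using exists_nondegenerate[OF first_row] by blast
  let ?p0 = "\<chi> j. complex_of_real (p0 $ j)"
  obtain q0 where q0: "polynomial_Cn q0" "q0 ?p0 \<noteq> 0" "\<And>p. q0 p \<noteq> 0 \<Longrightarrow> nondegenerate A k p"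
    using nondegenerate_generic[OF p0(2)] by blast
  \<comment> \<open>The factors ask for nondegeneracy, nonzero coordinates and nonzero sums over
    equal columns. At \<open>?p0\<close>, whose coordinates are positive reals, the sums cannot
    cancel.\<close>
  define q where "q p = q0 p * ((\<Prod>j\<in>UNIV. p $ j) * (\<Prod>j\<in>UNIV. \<Sum>j' | column j' A = column j A. p $ j'))" for p :: "complex^'n"
  have q_poly: "polynomial_Cn q"
    unfolding q_def[abs_def] by (intro polynomial_Cn.intros q0 polynomial_Cn_prod polynomial_Cn_sum)
  have q_nz: "q ?p0 \<noteq> 0"
  proof -
    have "(\<Sum>j' | column j' A = column j A. complex_of_real (p0 $ j')) \<noteq> 0" for j
    proof -
      have "(\<Sum>j' | column j' A = column j A. p0 $ j') > 0" using p0(1) by (intro sum_pos) auto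
      then show ?thesis by (metis less_irrefl of_real_eq_0_iff of_real_sum)
    qed
    moreover have "p0 $ j \<noteq> 0" for j using p0(1)[of j] by simp
    ultimately show ?thesis using q0(2) by (simp add: q_def)
  qed
  have dim: "\<exists>m. normalized_volume r A \<le> real m \<and> enat (Suc m) \<le> solution_dim (hypergeometric_ideal A \<beta>) p" if "q p \<noteq> 0" for p
    using that q0(3) by (intro solution_dim_lower_bound[OF lattice _ _ _ \<beta>_eq]) (auto simp: q_def)
  \<comment> \<open>The number \<open>m\<close> may depend on the point; rounding the volume up
    gives a lower bound that is common to all points.\<close>
  define R where "R = Suc (nat \<lceil>normalized_volume r A\<rceil>)"
  have "enat R \<le> solution_dim (hypergeometric_ideal A \<beta>) p" if nz: "q p \<noteq> 0" for p
  proof -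
    obtain m where m: "normalized_volume r A \<le> real m" "enat (Suc m) \<le> solution_dim (hypergeometric_ideal A \<beta>) p"
      using dim[OF nz] by blast
    have "R \<le> Suc m" unfolding R_def using m(1) by (simp add: ceiling_le_iff)
    then show ?thesis using m(2) by (meson enat_ord_simps(1) order_trans)
  qed
  then have "generically (\<lambda>p. enat R \<le> solution_dim (hypergeometric_ideal A \<beta>) p)"
    unfolding generically_def using q_poly q_nz by blast
  then have "enat R \<le> holonomic_rank (hypergeometric_ideal A \<beta>)"
    unfolding holonomic_rank_def by (intro Sup_upper) simp
  then have "ereal_of_enat (enat R) \<le> ereal_of_enat (holonomic_rank (hypergeometric_ideal A \<beta>))"
    by (simp only: ereal_of_enat_le_iff)
  moreover have "normalized_volume r A + 1 \<le> real R" unfolding R_def by simp linarith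
  ultimately show ?thesis by (simp add: order_trans[of _ "ereal (real R)"])
qed

end
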